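(* Let $S$ be a toric log del Pezzo surface of Picard number one over an algebraically closed field of characteristic zero, and let $S'$ be its minimal resolution. Then: 1. Either $S \cong \mathbb{P}(1,1,n)$ for some integer $n \geq 1$, or $S$ admits a cascade to one of $S(std^1_n)$, $S(std^2_n)$, $S(3A_2)$, where $n \geq 2$ is an integer. 2. Let $T$ be the basic surface of $S$. Then: (a) if $T=S(std^1_n)$, then $S'=[[-n, F_1, n-1, F_0]]$ for some fiber $F_1$ of type $I$ and a smooth fiber $F_0$; (b) if $T=S(std^2_n)$, then $S'=[[-n,F_1,n-2,F'_1]]$ for some fibers $F_1, F'_1$ of type $I$; (c) if $T=S(3A_2)$, then $S'=[[-n,F_1, -m, F_2]]$ for some integers $n,m$, some fiber $F_1$ of type $I$ and some fiber $F_2$ of type $II$.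
   Context: A toric log del Pezzo surface is a normal projective toric surface with at worst log terminal singularities and ample anticanonical divisor. A $(-1)$-curve is a smooth rational curve of self-intersection $-1$. A toric blow-down is the contraction of a torus-invariant $(-1)$-curve. A toric log del Pezzo surface $T$ of Picard number one, with minimal resolution $T'$, is called basic if for every $(-1)$-curve $C$ on $T'$ and every torus-invariant curve $D$ on $T'$ intersecting $C$ one has $D^2 \geq -2$. A toric log del Pezzo surface $S$ of Picard number one admits a cascade to $S_0$, and $S_0$ is called the basic surface of $S$, if there exist an integer $t\ge 0$, toric log del Pezzo surfaces $S_t := S, S_{t-1},\dots,S_0$ of Picard number one with minimal resolutions $\pi_k: S'_k\to S_k$ ($0\le k\le t$), and toric blow-downs $\phi_k: S'_k\to S'_{k-1}$ ($1\le k\le t$), such that $S_0$ is basic. The torus-invariant curves on a smooth projective toric surface form a cycle, and the surface is determined up to isomorphism by the cyclic sequence of their self-intersection numbers. For integers $n\ge 2$, the following smooth toric surfaces are given by these cyclic sequences: - $S(std^1_n)$: $(0,\,-n,\,-2,\,-1,\,-2,\,n-1)$; - $S(std^2_n)$: $(-2,\,-n,\,-2,\,-1,\,-2,\,n-2,\,-2,\,-1)$; - $S(3A_2)$: $(-1,-2,-2,-1,-2,-2,-1,-2,-2)$. "$S$ admits a cascade to $S(X)$", respectively "$T=S(X)$", for $S(X)$ one of these smooth surfaces, means that $S$ admits a cascade to a basic surface whose minimal resolution is isomorphic to $S(X)$, respectively that the minimal resolution of $T$ is isomorphic to $S(X)$. Writing $S'=[[a, F, b, G]]$ means that the smooth toric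 surface $S'$ admits a $\mathbb{P}^1$-fibration $\Phi:S'\to\mathbb{P}^1$ whose cycle of torus-invariant curves consists of two torus-invariant sections with self-intersection numbers $a$ and $b$, and two torus-invariant fibers $F$ and $G$. Fiber types: a singular fiber is of type $I_0$ if its components form a chain with self-intersection numbers $(-2,-1,-2)$, and of type $I$ if it can be contracted (by successively blowing down $(-1)$-curves, possibly none) to a fiber of type $I_0$. It is of type $II_0$ if its components form a chain with self-intersection numbers $(-1,-2,-2,-1)$, and of type $II$ if it can be contracted (in the same sense) to a fiber of type $II_0$. *)

theory Defs
  imports Main "HOL.Rat" "HOL-Library.Product_Plus" "HOL-Library.Extended_Nat"
begin

text \<open>
  Toric surfaces are encoded by fans in the lattice \<open>N = \<int>\<^sup>2\<close>; the dual lattice \<open>M\<close> is again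
  \<open>\<int>\<^sup>2\<close>, with the standard pairing.  A complete fan in the plane is determined by the set \<open>R\<close>
  of primitive generators of its rays: its two-dimensional cones are spanned by neighbouring rays.
  So a normal complete toric surface (complete toric surfaces are automatically projective) is
  given by such a set \<open>R\<close>, and its torus-invariant prime divisors \<open>D\<^sub>u\<close> by the elements
  \<open>u \<in> R\<close>.  The dictionary between fans and surfaces does not depend on the ground field.
\<close>

type_synonym vec = "int \<times> int"

definition det2 :: "vec \<Rightarrow> vec \<Rightarrow> int" where
  "det2 u w = fst u * snd w - snd u * fst w"

definition smul :: "int \<Rightarrow> vec \<Rightarrow> vec" where
  "smul d u = (d * fst u, d * snd u)"

definition pairing :: "'a::comm_ring_1 \<times> 'a \<Rightarrow> vec \<Rightarrow> 'a" where
  "pairing m u = fst m * of_int (fst u) + snd m * of_int (snd u)"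

definition primitive :: "vec \<Rightarrow> bool" where
  "primitive u \<longleftrightarrow> coprime (fst u) (snd u)"

text \<open>The lattice points of the cone spanned by \<open>u\<close> and \<open>w\<close>.\<close>

definition cone_pts :: "vec \<Rightarrow> vec \<Rightarrow> vec set" where
  "cone_pts u w = {v. \<exists>a b :: rat. 0 \<le> a \<and> 0 \<le> b \<and>
     of_int (fst v) = a * of_int (fst u) + b * of_int (fst w) \<and>
     of_int (snd v) = a * of_int (snd u) + b * of_int (snd w)}"

definition complete_fan :: "vec set \<Rightarrow> bool" where
  "complete_fan R \<longleftrightarrow> finite R \<and> (\<forall>u\<in>R. primitive u) \<and>
     (\<forall>v. \<exists>u\<in>R. \<exists>w\<in>R. 0 < det2 u w \<and> v \<in> cone_pts u w)"

text \<open>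
  \<open>u\<close> and \<open>w\<close> span a two-dimensional cone of the fan, in counterclockwise order.  For distinct
  \<open>u, w \<in> R\<close>, the curves \<open>D\<^sub>u\<close> and \<open>D\<^sub>w\<close> meet iff \<open>u, w\<close> or \<open>w, u\<close> span such a cone.
\<close>

definition max_cone :: "vec set \<Rightarrow> vec \<Rightarrow> vec \<Rightarrow> bool" where
  "max_cone R u w \<longleftrightarrow> u \<in> R \<and> w \<in> R \<and> 0 < det2 u w \<and>
     \<not> (\<exists>v\<in>R. 0 < det2 u v \<and> 0 < det2 v w)"

definition curves_meet :: "vec set \<Rightarrow> vec \<Rightarrow> vec \<Rightarrow> bool" where
  "curves_meet R u w \<longleftrightarrow> u \<in> R \<and> w \<in> R \<and> (u = w \<or> max_cone R u w \<or> max_cone R w u)"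

definition smooth_fan :: "vec set \<Rightarrow> bool" where
  "smooth_fan R \<longleftrightarrow> complete_fan R \<and> (\<forall>u w. max_cone R u w \<longrightarrow> det2 u w = 1)"

text \<open>
  Isomorphism of toric surfaces: an automorphism of the lattice (of either orientation) carrying
  one fan to the other.  Complete toric varieties which are isomorphic as abstract varieties are
  isomorphic in this sense.
\<close>

definition toric_iso :: "vec set \<Rightarrow> vec set \<Rightarrow> bool" where
  "toric_iso R R' \<longleftrightarrow> (\<exists>f :: vec \<Rightarrow> vec. bij f \<and> (\<forall>x y. f (x + y) = f x + f y) \<and> f ` R = R')"


text \<open>
  A torus-invariant Weil divisor \<open>\<Sum>\<^sub>u a(u) D\<^sub>u\<close> is a function \<open>a\<close> vanishing off \<open>R\<close>.  It is
  Cartier iff on each cone it is the divisor of a character (with the sign convention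
  \<open>\<langle>m\<^sub>\<sigma>, u\<rangle> = - a(u)\<close>), and \<open>div(\<chi>\<^sup>m) = \<Sum>\<^sub>u \<langle>m, u\<rangle> D\<^sub>u\<close>.  Every Cartier divisor is linearly
  equivalent to a torus-invariant one, so \<open>Pic = cartier_div / principal_div\<close>; the Picard number
  is the rank of this abelian group.
\<close>

definition weil_div :: "vec set \<Rightarrow> (vec \<Rightarrow> int) set" where
  "weil_div R = {a. \<forall>u. u \<notin> R \<longrightarrow> a u = 0}"

definition cartier_div :: "vec set \<Rightarrow> (vec \<Rightarrow> int) set" where
  "cartier_div R = {a \<in> weil_div R. \<forall>u w. max_cone R u w \<longrightarrow>
     (\<exists>m :: int \<times> int. pairing m u = - a u \<and> pairing m w = - a w)}"

definition principal_div :: "vec set \<Rightarrow> (vec \<Rightarrow> int) set" where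
  "principal_div R = {a \<in> weil_div R. \<exists>m :: int \<times> int. \<forall>u\<in>R. a u = pairing m u}"

definition pic_independent :: "vec set \<Rightarrow> (vec \<Rightarrow> int) set \<Rightarrow> bool" where
  "pic_independent R B \<longleftrightarrow> finite B \<and> B \<subseteq> cartier_div R \<and>
     (\<forall>c :: (vec \<Rightarrow> int) \<Rightarrow> int.
        (\<lambda>u. \<Sum>a\<in>B. c a * a u) \<in> principal_div R \<longrightarrow> (\<forall>a\<in>B. c a = 0))"

definition picard_number :: "vec set \<Rightarrow> enat" where
  "picard_number R = (SUP B\<in>{B. pic_independent R B}. enat (card B))"

definition canonical_div :: "vec set \<Rightarrow> vec \<Rightarrow> int" where
  "canonical_div R u = (if u \<in> R then - 1 else 0)"

text \<open>
  Ampleness of a (\<open>\<rat>\<close>-Cartier) divisor: its support function is strictly convex.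
\<close>

definition ample :: "vec set \<Rightarrow> (vec \<Rightarrow> int) \<Rightarrow> bool" where
  "ample R a \<longleftrightarrow> (\<forall>u w. max_cone R u w \<longrightarrow>
     (\<exists>m :: rat \<times> rat. pairing m u = - of_int (a u) \<and> pairing m w = - of_int (a w) \<and>
        (\<forall>x\<in>R - {u, w}. pairing m x > - of_int (a x))))"

text \<open>
  \<open>m\<close> is the local datum \<open>m\<^sub>\<sigma> \<in> M \<otimes> \<rat>\<close> of the \<open>\<rat>\<close>-Cartier divisor \<open>K\<close>.  The toric divisor over the surface
  belonging to a primitive \<open>v\<close> in the cone has discrepancy \<open>\<langle>m, v\<rangle> - 1\<close>, and
  toric divisors suffice for testing log terminality, as there are toric log resolutions.
\<close>

definition log_terminal :: "vec set \<Rightarrow> bool" where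
  "log_terminal R \<longleftrightarrow> (\<forall>u w. max_cone R u w \<longrightarrow>
     (\<exists>m :: rat \<times> rat.
        pairing m u = - of_int (canonical_div R u) \<and>
        pairing m w = - of_int (canonical_div R w) \<and>
        (\<forall>v. primitive v \<and> v \<in> cone_pts u w \<longrightarrow> pairing m v - 1 > - 1)))"

definition toric_log_del_Pezzo :: "vec set \<Rightarrow> bool" where
  "toric_log_del_Pezzo R \<longleftrightarrow> complete_fan R \<and> log_terminal R \<and> ample R (\<lambda>u. - canonical_div R u)"


text \<open>
  The self-intersection number of \<open>D\<^sub>u\<close> on a smooth surface, from the relation
  \<open>v + w + (D\<^sub>u)\<^sup>2 u = 0\<close> between \<open>u\<close> and its two neighbours \<open>v, w\<close>.
\<close>

definition self_int :: "vec set \<Rightarrow> vec \<Rightarrow> int" where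
  "self_int R u = (THE d. \<exists>v w. max_cone R v u \<and> max_cone R u w \<and> v + w + smul d u = 0)"

text \<open>
  Torus-invariant curves are smooth and rational, and a curve of negative self-intersection on a
  toric surface is torus-invariant.  Hence the following are all the \<open>(-1)\<close>-curves.
\<close>

definition minus_one_curve :: "vec set \<Rightarrow> vec \<Rightarrow> bool" where
  "minus_one_curve R u \<longleftrightarrow> u \<in> R \<and> self_int R u = - 1"

definition blow_down :: "vec set \<Rightarrow> vec \<Rightarrow> vec set \<Rightarrow> bool" where
  "blow_down R u R' \<longleftrightarrow> smooth_fan R \<and> smooth_fan R' \<and> minus_one_curve R u \<and> R' = R - {u}"

text \<open>
  For complete fans in the plane, \<open>R'\<close> refines \<open>R\<close> iff \<open>R \<subseteq> R'\<close>; the exceptional curves are the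
  \<open>D\<^sub>u\<close> with \<open>u \<in> R' - R\<close>.
\<close>

definition minimal_resolution :: "vec set \<Rightarrow> vec set \<Rightarrow> bool" where
  "minimal_resolution R R' \<longleftrightarrow> complete_fan R \<and> smooth_fan R' \<and> R \<subseteq> R' \<and>
     (\<forall>u\<in>R' - R. \<not> minus_one_curve R' u)"

definition basic :: "vec set \<Rightarrow> bool" where
  "basic T \<longleftrightarrow> toric_log_del_Pezzo T \<and> picard_number T = 1 \<and>
     (\<exists>T'. minimal_resolution T T' \<and>
        (\<forall>C D. minus_one_curve T' C \<and> curves_meet T' C D \<longrightarrow> self_int T' D \<ge> - 2))"

definition admits_cascade :: "vec set \<Rightarrow> vec set \<Rightarrow> bool" where
  "admits_cascade S T \<longleftrightarrow> (\<exists>(t::nat) (X :: nat \<Rightarrow> vec set) (X' :: nat \<Rightarrow> vec set).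
     X t = S \<and> X 0 = T \<and>
     (\<forall>k\<le>t. toric_log_del_Pezzo (X k) \<and> picard_number (X k) = 1 \<and>
        minimal_resolution (X k) (X' k)) \<and>
     (\<forall>k\<in>{1..t}. \<exists>u. blow_down (X' k) u (X' (k - 1))) \<and>
     basic T)"


definition has_cycle :: "vec set \<Rightarrow> int list \<Rightarrow> bool" where
  "has_cycle R ds \<longleftrightarrow> smooth_fan R \<and> (\<exists>us. distinct us \<and> set us = R \<and>
     (\<forall>i<length us. max_cone R (us ! i) (us ! (Suc i mod length us))) \<and>
     map (self_int R) us = ds)"

text \<open>
  \<open>R\<close> is isomorphic to the smooth toric surface given by the cyclic sequence \<open>ds\<close>, which is read
  up to rotation and, since \<^const>\<open>toric_iso\<close> may reverse the orientation, up to reversal.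
\<close>

definition iso_to_cycle :: "vec set \<Rightarrow> int list \<Rightarrow> bool" where
  "iso_to_cycle R ds \<longleftrightarrow> (\<exists>X. has_cycle X ds \<and> toric_iso R X)"

definition std1 :: "int \<Rightarrow> int list" where
  "std1 n = [0, - n, - 2, - 1, - 2, n - 1]"

definition std2 :: "int \<Rightarrow> int list" where
  "std2 n = [- 2, - n, - 2, - 1, - 2, n - 2, - 2, - 1]"

definition threeA2 :: "int list" where
  "threeA2 = [- 1, - 2, - 2, - 1, - 2, - 2, - 1, - 2, - 2]"

text \<open>\<open>T = S(X)\<close>, where the smooth surface \<open>S(X)\<close> is given by the cyclic sequence \<open>ds\<close>.\<close>

definition min_res_is :: "vec set \<Rightarrow> int list \<Rightarrow> bool" where
  "min_res_is T ds \<longleftrightarrow> (\<exists>T'. minimal_resolution T T' \<and> iso_to_cycle T' ds)"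

text \<open>
  The fan of the weighted projective plane \<open>\<P>(1,1,n)\<close>: its generators span \<open>\<int>\<^sup>2\<close> and satisfy
  \<open>(1,0) + (-1,-n) + n (0,1) = 0\<close>.
\<close>

definition P11 :: "int \<Rightarrow> vec set" where
  "P11 n = {(1, 0), (- 1, - n), (0, 1)}"


text \<open>
  A toric morphism to \<open>\<P>\<^sup>1\<close>, given by a homomorphism \<open>p\<close> of lattices mapping each cone into one of
  the cones \<open>\<int>\<^bsub>\<ge>0\<^esub>, \<int>\<^bsub>\<le>0\<^esub>\<close> of the fan of \<open>\<P>\<^sup>1\<close>.  Since \<open>p\<close> is onto, the fibers are connected,
  and the general fiber is the complete toric curve \<open>\<P>\<^sup>1\<close> with lattice \<open>ker p\<close>.  (A fibration of a
  complete toric surface is torus-equivariant by Blanchard's lemma.)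

  \<open>D\<^sub>u\<close> is horizontal iff \<open>p u = 0\<close>, and then it is a section, as \<open>u\<close> is primitive.  The two
  torus-invariant fibers are \<open>\<Sum> p(u) D\<^sub>u\<close> over \<open>p(u) > 0\<close> and \<open>\<Sum> -p(u) D\<^sub>u\<close> over
  \<open>p(u) < 0\<close>; they are represented by the sets of rays of their components.
\<close>

definition P1_fibration :: "vec set \<Rightarrow> (vec \<Rightarrow> int) \<Rightarrow> bool" where
  "P1_fibration R p \<longleftrightarrow> smooth_fan R \<and> (\<forall>x y. p (x + y) = p x + p y) \<and> surj p \<and>
     (\<forall>u w. max_cone R u w \<longrightarrow> (0 \<le> p u \<and> 0 \<le> p w) \<or> (p u \<le> 0 \<and> p w \<le> 0))"

text \<open>\<open>R = [[a, F, b, G]]\<close>, with \<open>p\<close> the fibration.\<close>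

definition fibered :: "vec set \<Rightarrow> (vec \<Rightarrow> int) \<Rightarrow> int \<Rightarrow> vec set \<Rightarrow> int \<Rightarrow> vec set \<Rightarrow> bool" where
  "fibered R p a F b G \<longleftrightarrow> P1_fibration R p \<and>
     (\<exists>x y. x \<noteq> y \<and> {u \<in> R. p u = 0} = {x, y} \<and> self_int R x = a \<and> self_int R y = b) \<and>
     F = {u \<in> R. 0 < p u} \<and> G = {u \<in> R. p u < 0}"

definition smooth_fiber :: "(vec \<Rightarrow> int) \<Rightarrow> vec set \<Rightarrow> bool" where
  "smooth_fiber p F \<longleftrightarrow> (\<exists>u. F = {u} \<and> \<bar>p u\<bar> = 1)"

definition is_chain :: "vec set \<Rightarrow> vec set \<Rightarrow> int list \<Rightarrow> bool" where
  "is_chain R F ds \<longleftrightarrow> (\<exists>us. distinct us \<and> set us = F \<and>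
     (\<forall>i. Suc i < length us \<longrightarrow> max_cone R (us ! i) (us ! Suc i)) \<and>
     map (self_int R) us = ds)"

text \<open>Blowing down a \<open>(-1)\<close>-curve contained in the fiber; a pair consists of a surface and a fiber.\<close>

definition fiber_blow_down :: "vec set \<times> vec set \<Rightarrow> vec set \<times> vec set \<Rightarrow> bool" where
  "fiber_blow_down RF RF' \<longleftrightarrow>
     (\<exists>u \<in> snd RF. blow_down (fst RF) u (fst RF') \<and> snd RF' = snd RF - {u})"

definition contracts_to :: "vec set \<Rightarrow> vec set \<Rightarrow> int list \<Rightarrow> bool" where
  "contracts_to R F ds \<longleftrightarrow>
     (\<exists>R' F'. fiber_blow_down\<^sup>*\<^sup>* (R, F) (R', F') \<and> is_chain R' F' ds)"

definition type_I :: "vec set \<Rightarrow> vec set \<Rightarrow> bool" where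
  "type_I R F \<longleftrightarrow> contracts_to R F [- 2, - 1, - 2]"

definition type_II :: "vec set \<Rightarrow> vec set \<Rightarrow> bool" where
  "type_II R F \<longleftrightarrow> contracts_to R F [- 1, - 2, - 2, - 1]"

end

theory Submission
  imports Defs
begin

text \<open>
  A complete toric surface of Picard number one has exactly three rays (\<open>picard_number_one_card\<close>),
  and conversely every complete fan with three rays is a toric log del Pezzo surface of Picard
  number one (\<open>picard_number_triple\<close>, \<open>triple_log_del_Pezzo\<close>).  So the theorem is about smooth fans
  that resolve three rays.

  The proof rests on the core of a smooth fan: the rays whose curves have self-intersection at
  least \<open>-1\<close>.  If \<open>v, w\<close> are the neighbours of \<open>u\<close>, then \<open>v + w = d u\<close>, where \<open>-d\<close> is the
  self-intersection of the curve of \<open>u\<close>.  If \<open>d \<ge> 2\<close>, this makes it impossible that \<open>u\<close> is the unique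
  maximum, among \<open>u, v, w\<close>, of a linear form that is positive at \<open>u\<close>
  (\<open>lex_max_self_int\<close>).  Hence in every direction some farthest ray lies in the core: the core meets
  every open half plane, so it is itself a complete fan (\<open>core_complete\<close>) and has at least three
  elements.  A curve contracted by a minimal resolution has self-intersection at most \<open>-2\<close>, so the core is
  contained in the three rays that are resolved, and therefore equal to them.  Minimal resolutions
  of surfaces of Picard number one are thus the smooth fans with a core of three elements, and
  the surface is recovered as the core.

  For the first part, let a smooth fan have a core of three elements.  If it has no \<open>(-1)\<close>-curve, it
  resolves some \<open>\<P>(1,1,n)\<close> (\<open>no_minus_one_curve_P11\<close>).  The neighbours of a \<open>(-1)\<close>-curve
  always have self-intersection at most \<open>-2\<close> (\<open>minus_one_neighbours\<close>).  If one of them is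
  at most \<open>-3\<close>, then blowing down keeps the size of the core and produces a new \<open>(-1)\<close>-curve, so the
  cascade continues and cannot end in \<open>\<P>(1,1,n)\<close> (\<open>rank_one_contraction\<close>).  Otherwise the surface
  is basic, and a \<open>(-1)\<close>-curve and its two \<open>(-2)\<close>-neighbours form a fiber of type \<open>I\<^sub>0\<close> of a
  \<open>\<P>\<^sup>1\<close>-fibration.  The component of largest multiplicity in the opposite fiber can be chosen in
  the core; if it is reduced, this leads to a smooth fiber or to the chain \<open>(-1,-2,-2,-1)\<close>,
  and otherwise to a second fiber of type \<open>I\<^sub>0\<close> (\<open>classification\<close>).

  For the second part, follow the cascade upwards.  A point that is blown up must lie on a
  \<open>(-1)\<close>-curve, for otherwise the core would acquire a fourth element
  (\<open>centre_on_minus_one_curve\<close>).  Hence the new curve is a component of a torus-invariant fiber.  It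
  changes the type of neither fiber: in its own fiber it can be contracted first, and the other fiber
  does not see it (\<open>fibred_type_blow_up\<close>).  Curves that neither are nor meet a \<open>(-1)\<close>-curve keep
  their self-intersection numbers forever (\<open>untouched_blow_up\<close>); for the first two families the
  sections are among them.
\<close>

section \<open>Vectors in the plane\<close>

(* Vectors are kept whole: quantifiers over them are not split into quantifiers over coordinates. *)
declare split_paired_All [simp del] split_paired_Ex [simp del]

lemma det2_simps [simp]:
  "det2 u u = 0" "det2 0 u = 0" "det2 u 0 = 0"
  "det2 (- u) w = - det2 u w" "det2 u (- w) = - det2 u w"
  "det2 (u + v) w = det2 u w + det2 v w" "det2 u (v + w) = det2 u v + det2 u w"
  "det2 (u - v) w = det2 u w - det2 v w" "det2 u (v - w) = det2 u v - det2 u w"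
  "det2 (smul k u) w = k * det2 u w" "det2 u (smul k w) = k * det2 u w"
  by (simp_all add: det2_def smul_def algebra_simps)

lemma det2_swap: "det2 w u = - det2 u w"
  by (simp add: det2_def)

lemma smul_simps [simp]:
  "smul 0 u = 0" "smul 1 u = u" "smul (- k) u = - smul k u" "smul k 0 = 0"
  "smul k (- u) = - smul k u"
  by (auto simp: smul_def prod_eq_iff)

text \<open>
  The incidences of four rays are compared through these two identities between determinants.
\<close>

lemma plucker: "det2 a v * det2 u b + det2 a b * det2 v u = det2 a u * det2 v b"
  by (simp add: det2_def algebra_simps)

lemma three_term: "det2 u v * det2 w z + det2 v w * det2 u z + det2 w u * det2 v z = 0"
  by (simp add: det2_def algebra_simps)

lemma vec_eq_if_dets_eq:
  assumes "det2 c c' \<noteq> 0" "det2 c u = det2 c w" "det2 c' u = det2 c' w"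
  shows "u = w"
proof -
  have "det2 c (u - w) = 0" "det2 c' (u - w) = 0" using assms by auto
  then have "det2 c c' * fst (u - w) = 0" "det2 c c' * snd (u - w) = 0"
    unfolding det2_def by algebra+
  with assms(1) show ?thesis by (simp add: prod_eq_iff)
qed

text \<open>
  In this form, primitivity is visibly preserved by automorphisms of the lattice, and it supplies a
  linear form with value \<open>1\<close> at the vector.
\<close>

lemma primitive_iff_bezout: "primitive u \<longleftrightarrow> (\<exists>w. det2 w u = 1)"
proof
  assume "primitive u"
  then have "gcd (fst u) (snd u) = 1" by (simp add: primitive_def)
  then obtain s t where "s * fst u + t * snd u = 1" by (metis bezout_int)
  then have "det2 (t, - s) u = 1" by (simp add: det2_def algebra_simps)
  then show "\<exists>w. det2 w u = 1" by blast
next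
  assume "\<exists>w. det2 w u = 1"
  then obtain w where "fst w * snd u - snd w * fst u = 1" by (auto simp: det2_def)
  then have "d dvd 1" if "d dvd fst u" "d dvd snd u" for d
    using that by (metis dvd_diff dvd_mult)
  then show "primitive u" unfolding primitive_def by (rule coprimeI)
qed

lemma primitive_nonzero: "primitive u \<Longrightarrow> u \<noteq> 0"
  by (auto simp: primitive_iff_bezout)

lemma collinear_primitive:
  assumes "primitive u" "det2 u v = 0"
  shows "\<exists>k. v = smul k u"
proof -
  obtain w where w: "det2 w u = 1" using assms(1) primitive_iff_bezout by auto
  have "det2 w u \<noteq> 0" using w by simp
  then have "v = smul (det2 w v) u"
    by (rule vec_eq_if_dets_eq) (use assms(2) w in auto)
  then show ?thesis ..
qed

lemma same_ray:
  assumes "primitive u" "primitive w" "det2 u w = 0" "0 < det2 c u" "0 < det2 c w"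
  shows "u = w"
proof -
  obtain k where k: "w = smul k u" using collinear_primitive assms by blast
  obtain z where "det2 z w = 1" using assms(2) primitive_iff_bezout by blast
  then have "k * det2 z u = 1" using k by simp
  moreover have "0 < k" using assms(4,5) k by (simp add: zero_less_mult_iff)
  ultimately have "k = 1" by (metis dvd_triv_left zdvd1_eq abs_of_pos)
  with k show ?thesis by simp
qed

lemma collinear_primitive_cases:
  assumes "primitive u" "primitive w" "det2 u w = 0"
  shows "w = u \<or> w = - u"
proof -
  obtain z where z: "det2 z u = 1" using assms(1) primitive_iff_bezout by blast
  have "det2 z w \<noteq> 0"
    using vec_eq_if_dets_eq[of z u w 0] z assms primitive_nonzero by auto
  then have "0 < det2 z w \<or> 0 < det2 (- z) w" by auto
  moreover have "primitive (- u)" using assms(1) by (simp add: primitive_def)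
  ultimately show ?thesis
    using same_ray[of u w z] same_ray[of "- u" w "- z"] assms z by auto
qed

lemma det2_pos_trans:
  assumes "0 < det2 c u" "0 < det2 c v" "0 < det2 c w" "0 < det2 u v" "0 < det2 v w"
  shows "0 < det2 u w"
proof -
  have "det2 c v * det2 u w = det2 c u * det2 v w + det2 c w * det2 u v"
    by (simp add: det2_def algebra_simps)
  also have "\<dots> > 0" using assms by (simp add: add_pos_pos)
  finally show ?thesis using assms(2) by (simp add: zero_less_mult_iff)
qed

text \<open>
  Inside an open half plane, turning counterclockwise is a strict linear order on rays (transitive
  by \<open>det2_pos_trans\<close>), so a finite set of rays has a first and a last element.
\<close>

lemma first_in_half_plane:
  assumes "finite A" "A \<noteq> {}" "\<And>a. a \<in> A \<Longrightarrow> 0 < det2 c a"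
  shows "\<exists>m\<in>A. \<forall>x\<in>A. 0 \<le> det2 m x"
proof -
  have "\<exists>m\<in>A. \<forall>x\<in>A. x \<noteq> m \<longrightarrow> \<not> 0 < det2 x m"
  proof (rule Finite_Set.bex_min_element[OF assms(1) _ _ assms(2)])
    show "asymp_on A (\<lambda>x y. 0 < det2 x y)"
      by (rule asymp_onI) (auto simp: det2_def mult.commute)
    show "transp_on A (\<lambda>x y. 0 < det2 x y)"
      by (rule transp_onI) (use det2_pos_trans assms(3) in blast)
  qed
  then show ?thesis by (metis det2_swap det2_simps(1) neg_le_0_iff_le not_le order_refl)
qed

lemma last_in_half_plane:
  assumes "finite A" "A \<noteq> {}" "\<And>a. a \<in> A \<Longrightarrow> 0 < det2 c a"
  shows "\<exists>m\<in>A. \<forall>x\<in>A. 0 \<le> det2 x m"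
proof -
  have "\<exists>m\<in>A. \<forall>x\<in>A. x \<noteq> m \<longrightarrow> \<not> 0 < det2 m x"
  proof (rule Finite_Set.bex_min_element[OF assms(1) _ _ assms(2), where R = "\<lambda>x y. 0 < det2 y x"])
    show "asymp_on A (\<lambda>x y. 0 < det2 y x)"
      by (rule asymp_onI) (auto simp: det2_def mult.commute)
    show "transp_on A (\<lambda>x y. 0 < det2 y x)"
      by (rule transp_onI) (use det2_pos_trans assms(3) in blast)
  qed
  then show ?thesis by (metis det2_swap det2_simps(1) neg_le_0_iff_le not_le order_refl)
qed

section \<open>Complete fans\<close>

lemma cone_pts_iff:
  assumes "0 < det2 u w"
  shows "v \<in> cone_pts u w \<longleftrightarrow> 0 \<le> det2 u v \<and> 0 \<le> det2 v w"
proof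
  assume "v \<in> cone_pts u w"
  then obtain a b :: rat where ab: "0 \<le> a" "0 \<le> b"
    "of_int (fst v) = a * of_int (fst u) + b * of_int (fst w)"
    "of_int (snd v) = a * of_int (snd u) + b * of_int (snd w)"
    by (auto simp: cone_pts_def)
  have "(of_int (det2 u v) :: rat) = b * of_int (det2 u w)"
    "(of_int (det2 v w) :: rat) = a * of_int (det2 u w)"
    by (simp_all add: det2_def ab algebra_simps)
  then have "0 \<le> (of_int (det2 u v) :: rat)" "0 \<le> (of_int (det2 v w) :: rat)"
    using ab assms by simp_all
  then show "0 \<le> det2 u v \<and> 0 \<le> det2 v w" by simp
next
  assume nn: "0 \<le> det2 u v \<and> 0 \<le> det2 v w"
  define d :: rat where "d = of_int (det2 u w)"
  have d: "d > 0" using assms by (simp add: d_def)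
  have "det2 v w * fst u + det2 u v * fst w = det2 u w * fst v"
    "det2 v w * snd u + det2 u v * snd w = det2 u w * snd v"
    by (simp_all add: det2_def algebra_simps)
  then have "of_int (det2 v w) * of_int (fst u) + of_int (det2 u v) * of_int (fst w) = d * of_int (fst v)"
    "of_int (det2 v w) * of_int (snd u) + of_int (det2 u v) * of_int (snd w) = d * of_int (snd v)"
    unfolding d_def by (metis of_int_add of_int_mult)+
  then have "of_int (fst v) = of_int (det2 v w) / d * of_int (fst u) + of_int (det2 u v) / d * of_int (fst w)"
    "of_int (snd v) = of_int (det2 v w) / d * of_int (snd u) + of_int (det2 u v) / d * of_int (snd w)"
    using d by (simp_all add: field_simps)
  moreover have "0 \<le> of_int (det2 v w) / d" "0 \<le> of_int (det2 u v) / d" using nn d by simp_all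
  ultimately show "v \<in> cone_pts u w" unfolding cone_pts_def by blast
qed

text \<open>
  This criterion replaces the covering by cones, so that adding rays, removing them and applying
  automorphisms become easy.  If the rays meet every open half plane, the rays next to a given
  vector on its two sides enclose an angle below \<open>180\<close> degrees: otherwise the open half plane to
  the left of the clockwise one would contain no ray.
\<close>

lemma complete_fan_iff:
  "complete_fan R \<longleftrightarrow> finite R \<and> (\<forall>u\<in>R. primitive u) \<and> (\<forall>x. x \<noteq> 0 \<longrightarrow> (\<exists>u\<in>R. 0 < det2 x u))"
proof (intro iffI conjI allI impI)
  fix x :: vec
  assume cf: "complete_fan R" and x: "x \<noteq> 0"
  define v where "v = (- snd x, fst x)"
  have "0 < det2 x v" using x
    by (cases x) (auto simp: det2_def v_def zero_prod_def sum_squares_gt_zero_iff)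
  moreover obtain u w where uw: "u \<in> R" "w \<in> R" "0 < det2 u w" "v \<in> cone_pts u w"
    using cf unfolding complete_fan_def by blast
  moreover have "0 \<le> det2 u v" "0 \<le> det2 v w" using uw cone_pts_iff by auto
  moreover have "det2 u w * det2 x v = det2 v w * det2 x u + det2 u v * det2 x w"
    by (simp add: det2_def algebra_simps)
  ultimately have "0 < det2 v w * det2 x u + det2 u v * det2 x w"
    by (metis mult_pos_pos)
  then have "0 < det2 x u \<or> 0 < det2 x w"
    using \<open>0 \<le> det2 u v\<close> \<open>0 \<le> det2 v w\<close> by (smt (verit) mult_nonneg_nonpos)
  then show "\<exists>u\<in>R. 0 < det2 x u" using uw by blast
next
  assume h: "finite R \<and> (\<forall>u\<in>R. primitive u) \<and> (\<forall>x. x \<noteq> 0 \<longrightarrow> (\<exists>u\<in>R. 0 < det2 x u))"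
  have "\<exists>u\<in>R. \<exists>w\<in>R. 0 < det2 u w \<and> v \<in> cone_pts u w" for v
  \<comment> \<open>The first case: \<open>v\<close> is zero or lies on a ray, so any cone at that ray contains
    it.\<close>
  proof (cases "v = 0 \<or> (\<exists>u\<in>R. det2 u v = 0 \<and> (\<forall>c. 0 < det2 c u \<longrightarrow> 0 < det2 c v))")
    case True
    then obtain u where u: "u \<in> R" "det2 u v = 0" "\<forall>c. 0 < det2 c u \<longrightarrow> 0 \<le> det2 c v"
    proof (cases "v = 0")
      case True
      obtain u where "u \<in> R" using h by (metis zero_neq_one zero_prod_def fst_conv)
      with True that show ?thesis by auto
    next
      case nz: False
      then obtain u where "u \<in> R" "det2 u v = 0" "\<forall>c. 0 < det2 c u \<longrightarrow> 0 < det2 c v"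
        using True by blast
      then show ?thesis by (meson less_imp_le that)
    qed
    obtain w where w: "w \<in> R" "0 < det2 u w" using h u primitive_nonzero by blast
    have "0 < det2 (- w) u" using w det2_swap[of w u] by simp
    then have "0 \<le> det2 (- w) v" using u by blast
    then have "0 \<le> det2 v w" using det2_swap[of w v] by simp
    then show ?thesis using u w cone_pts_iff[of u w v] by auto
  next
    case False
    then have v0: "v \<noteq> 0" by blast
    define L where "L = {w\<in>R. 0 < det2 v w}"
    define K where "K = {u\<in>R. 0 < det2 (- v) u}"
    have "L \<noteq> {}" using h v0 unfolding L_def by blast
    moreover have "K \<noteq> {}" using h v0 unfolding K_def
      by (metis (mono_tags, lifting) empty_Collect_eq neg_equal_0_iff_equal)
    moreover have "finite L" "finite K" using h by (simp_all add: L_def K_def)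
    ultimately obtain w u where w: "w \<in> L" "\<And>z. z \<in> L \<Longrightarrow> 0 \<le> det2 w z"
      and u: "u \<in> K" "\<And>z. z \<in> K \<Longrightarrow> 0 \<le> det2 z u"
      using first_in_half_plane[of L v] last_in_half_plane[of K "- v"]
      unfolding L_def K_def by blast
    have uv: "0 < det2 u v" and vw: "0 < det2 v w"
      using u w det2_swap[of v u] by (auto simp: K_def L_def)
    have uR: "u \<in> R" and wR: "w \<in> R" using u w by (auto simp: K_def L_def)
    have "0 < det2 u w"
    proof (rule ccontr)
      assume "\<not> 0 < det2 u w"
      then have wu: "0 \<le> det2 w u" using det2_swap[of w u] by simp
      obtain z where z: "z \<in> R" "0 < det2 u z" using h uR primitive_nonzero by blast
      consider "0 < det2 v z" | "det2 v z = 0" | "det2 v z < 0" by linarith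
      then show False
      proof cases
        case 1
        then have "0 \<le> det2 w z" using w z by (simp add: L_def)
        then have "0 \<le> det2 u v * det2 w z" "0 < det2 v w * det2 u z" "0 \<le> det2 w u * det2 v z"
          using uv vw wu z 1 by simp_all
        then show False using three_term[of u v w z] by linarith
      next
        case 2
        have "0 < det2 c v" if "0 < det2 c z" for c
        proof -
          have "det2 c z * det2 u v = det2 c v * det2 u z + det2 c u * det2 z v"
            by (simp add: det2_def algebra_simps)
          moreover have "det2 z v = 0" using 2 det2_swap[of z v] by simp
          moreover have "0 < det2 c z * det2 u v" using that uv by simp
          ultimately show ?thesis using z(2) by (simp add: zero_less_mult_iff)
        qed
        moreover have "det2 z v = 0" using 2 det2_swap[of z v] by simp
        ultimately show False using False z by blast
      next
        case 3
        then have "0 \<le> det2 z u" using u z by (simp add: K_def)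
        then show False using z det2_swap[of z u] by simp
      qed
    qed
    then show ?thesis using uR wR uv vw cone_pts_iff by (meson less_imp_le)
  qed
  with h show "complete_fan R" unfolding complete_fan_def by blast
qed (auto simp: complete_fan_def)

lemma complete_fanD:
  assumes "complete_fan R"
  shows "finite R" "u \<in> R \<Longrightarrow> primitive u" "x \<noteq> 0 \<Longrightarrow> \<exists>u\<in>R. 0 < det2 x u"
  using assms unfolding complete_fan_iff by blast+

lemma succ_exists:
  assumes "complete_fan R" "u \<in> R"
  shows "\<exists>w. max_cone R u w"
proof -
  let ?A = "{w\<in>R. 0 < det2 u w}"
  have "?A \<noteq> {}" using complete_fanD[OF assms(1)] assms(2) primitive_nonzero by blast
  moreover have "finite ?A" using complete_fanD(1)[OF assms(1)] by simp
  ultimately obtain m where "m \<in> ?A" "\<forall>x\<in>?A. 0 \<le> det2 m x"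
    using first_in_half_plane[of ?A u] by blast
  then have "max_cone R u m" using assms(2) unfolding max_cone_def
    by (smt (verit, best) det2_swap mem_Collect_eq)
  then show ?thesis ..
qed

lemma pred_exists:
  assumes "complete_fan R" "u \<in> R"
  shows "\<exists>w. max_cone R w u"
proof -
  let ?A = "{w\<in>R. 0 < det2 (- u) w}"
  have "- u \<noteq> 0" using complete_fanD(2)[OF assms] primitive_nonzero by auto
  then have "?A \<noteq> {}" using complete_fanD(3)[OF assms(1)] by blast
  moreover have "finite ?A" using complete_fanD(1)[OF assms(1)] by simp
  ultimately obtain m where "m \<in> ?A" "\<forall>x\<in>?A. 0 \<le> det2 x m"
    using last_in_half_plane[of ?A "- u"] by blast
  then have "max_cone R m u" using assms(2) unfolding max_cone_def
    by (smt (verit, best) det2_swap mem_Collect_eq det2_simps(4))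
  then show ?thesis ..
qed

lemma max_coneD: "max_cone R u w \<Longrightarrow> u \<in> R" "max_cone R u w \<Longrightarrow> w \<in> R" "max_cone R u w \<Longrightarrow> 0 < det2 u w"
  "max_cone R u w \<Longrightarrow> v \<in> R \<Longrightarrow> 0 < det2 u v \<Longrightarrow> det2 v w \<le> 0"
  unfolding max_cone_def by auto

lemma succ_unique:
  assumes "complete_fan R" "max_cone R u w" "max_cone R u w'"
  shows "w = w'"
proof -
  have "det2 w w' \<le> 0" "det2 w' w \<le> 0" using assms(2,3) max_coneD by blast+
  then have "det2 w w' = 0" using det2_swap[of w w'] by simp
  then show ?thesis using same_ray complete_fanD(2)[OF assms(1)] max_coneD assms(2,3) by metis
qed

lemma pred_unique:
  assumes "complete_fan R" "max_cone R w u" "max_cone R w' u"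
  shows "w = w'"
proof -
  have "det2 w w' \<le> 0" "det2 w' w \<le> 0" using assms(2,3) max_coneD not_less by metis+
  then have "det2 w w' = 0" using det2_swap[of w w'] by simp
  moreover have "0 < det2 (- u) w" "0 < det2 (- u) w'"
    using assms(2,3) max_coneD(3) det2_swap[of u] by auto
  ultimately show ?thesis using same_ray complete_fanD(2)[OF assms(1)] max_coneD assms(2,3) by metis
qed

lemma max_cone_asym: "max_cone R u w \<Longrightarrow> \<not> max_cone R w u"
  unfolding max_cone_def using det2_swap[of u w] by auto

lemma max_cone_neq: "max_cone R u w \<Longrightarrow> u \<noteq> w"
  unfolding max_cone_def by auto

lemma pred_closest:
  assumes "complete_fan R" "max_cone R a v" "s \<in> R" "0 < det2 s v"
  shows "0 \<le> det2 s a"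
proof -
  have "\<not> 0 < det2 a s" using max_coneD(4)[OF assms(2,3)] assms(4) by linarith
  then show ?thesis using det2_swap[of s a] by linarith
qed

lemma succ_closest:
  assumes "complete_fan R" "max_cone R v b" "t \<in> R" "0 < det2 v t"
  shows "0 \<le> det2 b t"
  using max_coneD(4)[OF assms(2,3,4)] det2_swap[of b t] by linarith

text \<open>
  If \<open>a\<close> lies between \<open>s\<close> and \<open>v\<close>, then the angle from \<open>a\<close> to \<open>t\<close> is below \<open>180\<close> degrees as soon as
  the angle from \<open>s\<close> to \<open>t\<close> is; the next lemma is the mirror image.
\<close>

lemma nested_left:
  assumes "0 < det2 s t" "0 < det2 s v" "0 \<le> det2 v t" "0 \<le> det2 s a" "0 < det2 a v"
  shows "0 < det2 a t"
proof -
  have "0 \<le> det2 s a * det2 v t" "0 < det2 s t * det2 a v" using assms by simp_all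
  then have "0 < det2 s v * det2 a t" using plucker[of s a v t] by linarith
  then show ?thesis using assms by (simp add: zero_less_mult_iff)
qed

lemma nested_right:
  assumes "0 < det2 s t" "0 \<le> det2 s v" "0 < det2 v t" "0 \<le> det2 b t" "0 < det2 v b"
  shows "0 < det2 s b"
proof -
  have "0 \<le> det2 s v * det2 b t" "0 < det2 s t * det2 v b" using assms by simp_all
  then have "0 < det2 s b * det2 v t" using plucker[of s v b t] by linarith
  then show ?thesis using assms by (simp add: zero_less_mult_iff)
qed

lemma in_cone_cases:
  assumes "primitive s" "primitive t" "primitive v" "0 < det2 s t" "v \<in> cone_pts s t" "v \<noteq> s" "v \<noteq> t"
  shows "0 < det2 s v" "0 < det2 v t"
proof -
  have nn: "0 \<le> det2 s v" "0 \<le> det2 v t" using assms cone_pts_iff by auto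
  have nz: "\<not> (det2 s v = 0 \<and> det2 t v = 0)"
    using vec_eq_if_dets_eq[of s t v 0] assms primitive_nonzero by auto
  show "0 < det2 s v"
  proof (rule ccontr)
    assume "\<not> 0 < det2 s v"
    then have "det2 s v = 0" "0 < det2 (- t) v" "0 < det2 (- t) s"
      using nn nz assms(4) det2_swap[of t v] det2_swap[of t s] by auto
    then show False using same_ray assms by blast
  qed
  show "0 < det2 v t"
  proof (rule ccontr)
    assume "\<not> 0 < det2 v t"
    then have "det2 v t = 0" "0 < det2 s v"
      using nn nz det2_swap[of t v] by auto
    then show False using same_ray assms by blast
  qed
qed

text \<open>
  The neighbours of \<open>v\<close> in the fan refined by \<open>v\<close> bound the cone of \<open>R\<close> whose interior contains \<open>v\<close>.
\<close>

lemma enclosing_max_cone: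
  assumes R: "complete_fan R" and v: "primitive v" "v \<notin> R"
  shows "\<exists>a b. max_cone R a b \<and> 0 < det2 a v \<and> 0 < det2 v b"
proof -
  have ins: "complete_fan (insert v R)" using R v unfolding complete_fan_iff by auto
  obtain a b where a: "max_cone (insert v R) a v" and b: "max_cone (insert v R) v b"
    using succ_exists[OF ins, of v] pred_exists[OF ins, of v] by auto
  have ab: "a \<in> R" "b \<in> R" using max_coneD[OF a] max_coneD[OF b] max_cone_neq a b by auto
  obtain s t where st: "s \<in> R" "t \<in> R" "0 < det2 s t" "v \<in> cone_pts s t"
    using R unfolding complete_fan_def by blast
  have sv: "0 < det2 s v" and vt: "0 < det2 v t"
    using in_cone_cases[of s t v] st v complete_fanD(2)[OF R] by auto
  have sa: "0 \<le> det2 s a" using pred_closest[OF ins a] st sv by auto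
  have bt: "0 \<le> det2 b t" using succ_closest[OF ins b] st vt by auto
  have av: "0 < det2 a v" and vb: "0 < det2 v b" using max_coneD(3)[OF a] max_coneD(3)[OF b] .
  have at: "0 < det2 a t" using nested_left[OF st(3) sv _ sa av] vt by simp
  have "0 < det2 a b" using nested_right[OF at _ vt bt vb] av by simp
  moreover have False if z: "z \<in> R" "0 < det2 a z" "0 < det2 z b" for z
  proof -
    have "\<not> 0 < det2 z v" "\<not> 0 < det2 v z"
      using max_coneD(4)[OF a, of z] max_coneD(4)[OF b, of z] z by auto
    then have "det2 z v = 0" using det2_swap[of z v] by linarith
    then have "z = v" using same_ray[of z v a] z av v complete_fanD(2)[OF R] by blast
    then show False using z v by blast
  qed
  ultimately have "max_cone R a b" using ab unfolding max_cone_def by blast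
  then show ?thesis using av vb by blast
qed

lemma complete_fan_card: "complete_fan R \<Longrightarrow> 3 \<le> card R"
proof -
  assume R: "complete_fan R"
  obtain u where u: "u \<in> R" using complete_fanD(3)[OF R, of "(1, 0)"] by (auto simp: zero_prod_def)
  obtain w where w: "w \<in> R" "0 < det2 u w" using succ_exists[OF R u] max_coneD by blast
  obtain z where z: "z \<in> R" "0 < det2 z u" using pred_exists[OF R u] max_coneD by blast
  have "u \<noteq> w" "u \<noteq> z" "w \<noteq> z" using w z det2_swap[of u z] by auto
  then have "card {u, w, z} = 3" by simp
  moreover have "{u, w, z} \<subseteq> R" using u w z by blast
  ultimately show ?thesis using card_mono complete_fanD(1)[OF R] by metis
qed

lemma complete_triple:
  assumes "complete_fan R" "card R = 3" "u \<in> R" "w \<in> R" "0 < det2 u w"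
  shows "\<exists>z. R = {u, w, z} \<and> 0 < det2 w z \<and> 0 < det2 z u"
proof -
  obtain z where z: "z \<in> R" "0 < det2 z u" using pred_exists[OF assms(1,3)] max_coneD by blast
  have "u \<noteq> w" "u \<noteq> z" "w \<noteq> z" using assms z det2_swap[of u z] by auto
  then have "card {u, w, z} = 3" by simp
  moreover have "{u, w, z} \<subseteq> R" using assms z by blast
  ultimately have eq: "R = {u, w, z}" using card_subset_eq complete_fanD(1)[OF assms(1)] assms(2) by metis
  obtain z' where z': "z' \<in> R" "0 < det2 w z'" using succ_exists[OF assms(1,4)] max_coneD by blast
  have "z' = z" using z' eq assms(5) det2_swap[of w u] by auto
  then show ?thesis using eq z z' by blast
qed

section \<open>Self-intersection numbers\<close>

lemma smooth_fanD:
  "smooth_fan R \<Longrightarrow> complete_fan R" "smooth_fan R \<Longrightarrow> max_cone R u w \<Longrightarrow> det2 u w = 1"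
  unfolding smooth_fan_def by auto

lemma self_int_eqI:
  assumes "smooth_fan R" "max_cone R v u" "max_cone R u w" "v + w + smul d u = 0"
  shows "self_int R u = d"
  unfolding self_int_def
proof (rule the_equality)
  show "\<exists>v w. max_cone R v u \<and> max_cone R u w \<and> v + w + smul d u = 0" using assms by blast
next
  fix e
  assume "\<exists>v w. max_cone R v u \<and> max_cone R u w \<and> v + w + smul e u = 0"
  then have "v + w + smul e u = 0"
    using assms succ_unique pred_unique smooth_fanD(1) by metis
  then have "smul e u = smul d u" using assms(4) by (metis add_left_cancel)
  moreover have "u \<noteq> 0" using assms(2) max_coneD(3) by fastforce
  ultimately show "e = d" by (auto simp: smul_def prod_eq_iff)
qed

lemma self_int_rel:
  assumes "smooth_fan R" "max_cone R v u" "max_cone R u w"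
  shows "v + w + smul (self_int R u) u = 0"
proof -
  have vu: "det2 v u = 1" and uw: "det2 u w = 1" using assms smooth_fanD by auto
  have "det2 u (v + w) = 0" using vu uw det2_swap[of u v] by simp
  moreover have "primitive u" using assms complete_fanD(2) smooth_fanD(1) max_coneD(1) by blast
  ultimately obtain k where "v + w = smul k u" using collinear_primitive by blast
  then have "v + w + smul (- k) u = 0" by (simp add: smul_def prod_eq_iff)
  then show ?thesis using self_int_eqI[OF assms] by metis
qed

lemma self_int_det:
  assumes "smooth_fan R" "max_cone R v u" "max_cone R u w"
  shows "det2 c v + det2 c w = - self_int R u * det2 c u"
proof -
  have "det2 c (v + w + smul (self_int R u) u) = 0" using self_int_rel[OF assms] by simp
  then show ?thesis by simp
qed

lemma neighbours_exist:
  assumes "smooth_fan R" "u \<in> R"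
  obtains v w where "max_cone R v u" "max_cone R u w"
  using pred_exists succ_exists smooth_fanD(1)[OF assms(1)] assms(2) by blast

text \<open>
  The second linear form breaks ties, so that the maximum is attained at a single vector when the
  forms are independent.
\<close>

definition lex_le :: "vec \<Rightarrow> vec \<Rightarrow> vec \<Rightarrow> vec \<Rightarrow> bool" where
  "lex_le c c' y z \<longleftrightarrow> det2 c y < det2 c z \<or> det2 c y = det2 c z \<and> det2 c' y \<le> det2 c' z"

lemma lex_max_exists:
  assumes "finite A" "A \<noteq> {}"
  shows "\<exists>z\<in>A. \<forall>y\<in>A. lex_le c c' y z"
proof -
  define m where "m = Max (det2 c ` A)"
  define B where "B = {z\<in>A. det2 c z = m}"
  have "m \<in> det2 c ` A" unfolding m_def using assms by simp
  then have B: "finite B" "B \<noteq> {}" using assms by (auto simp: B_def)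
  then have "Max (det2 c' ` B) \<in> det2 c' ` B" by simp
  then obtain z where z: "z \<in> B" "det2 c' z = Max (det2 c' ` B)" by auto
  have "lex_le c c' y z" if "y \<in> A" for y
  proof (cases "y \<in> B")
    case True
    then have "det2 c' y \<le> det2 c' z" using z B by simp
    then show ?thesis using True z by (auto simp: lex_le_def B_def)
  next
    case False
    have "det2 c y \<le> m" unfolding m_def using assms that by simp
    then show ?thesis using False that z by (auto simp: lex_le_def B_def)
  qed
  moreover have "z \<in> A" using z(1) by (simp add: B_def)
  ultimately show ?thesis by blast
qed

text \<open>
  With \<open>v + w = d u\<close> and \<open>d \<ge> 2\<close>, maximality of the first form at \<open>u\<close> forces equality at \<open>v, u, w\<close>
  and \<open>d = 2\<close>; then the second form is constant on them as well, which makes the three vectors equal.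
\<close>

lemma lex_max_self_int:
  assumes R: "smooth_fan R" "max_cone R v u" "max_cone R u w"
    and c: "0 < det2 c u" "det2 c c' \<noteq> 0" and le: "lex_le c c' v u" "lex_le c c' w u"
  shows "- 1 \<le> self_int R u"
proof (rule ccontr)
  assume "\<not> ?thesis"
  then have d: "2 \<le> - self_int R u" by simp
  have "2 * det2 c u \<le> - self_int R u * det2 c u" using d c(1) by (intro mult_right_mono) auto
  then have ge: "2 * det2 c u \<le> det2 c v + det2 c w" using self_int_det[OF R, of c] by simp
  then have eq: "det2 c v = det2 c u" "det2 c w = det2 c u" using le by (auto simp: lex_le_def)
  then have "- self_int R u * det2 c u = 2 * det2 c u" using self_int_det[OF R, of c] by simp
  then have "- self_int R u = 2" using c(1) mult_right_cancel[of "det2 c u"] by (metis less_irrefl)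
  then have "det2 c' v + det2 c' w = 2 * det2 c' u" using self_int_det[OF R, of c'] by simp
  then have "det2 c' v = det2 c' u" using le eq by (auto simp: lex_le_def)
  then have "v = u" using vec_eq_if_dets_eq c(2) eq by blast
  then show False using R(2) max_cone_neq by blast
qed

definition core :: "vec set \<Rightarrow> vec set" where
  "core R = {u\<in>R. - 1 \<le> self_int R u}"

lemma lex_max_in_core:
  assumes R: "smooth_fan R" and c: "det2 c c' \<noteq> 0"
  obtains z where "z \<in> core R" "0 < det2 c z" "\<And>y. y \<in> R \<Longrightarrow> lex_le c c' y z"
proof -
  have "c \<noteq> 0" using c by auto
  then obtain z0 where z0: "z0 \<in> R" "0 < det2 c z0"
    using complete_fanD(3)[OF smooth_fanD(1)[OF R]] by blast
  obtain z where z: "z \<in> R" "\<forall>y\<in>R. lex_le c c' y z"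
    using lex_max_exists[of R] complete_fanD(1)[OF smooth_fanD(1)[OF R]] z0 by blast
  then have pos: "0 < det2 c z" using z0 by (fastforce simp: lex_le_def)
  obtain v w where vw: "max_cone R v z" "max_cone R z w" using neighbours_exist[OF R z(1)] .
  then have "- 1 \<le> self_int R z"
    using lex_max_self_int[OF R vw pos c] z max_coneD by blast
  then show ?thesis using that z pos by (auto simp: core_def)
qed

lemma core_subset: "core R \<subseteq> R"
  by (auto simp: core_def)

lemma core_complete: "smooth_fan R \<Longrightarrow> complete_fan (core R)"
proof -
  assume R: "smooth_fan R"
  have "\<exists>u\<in>core R. 0 < det2 x u" if "x \<noteq> 0" for x :: vec
  proof -
    have "det2 x (- snd x, fst x) \<noteq> 0" using that
      by (cases x) (auto simp: det2_def zero_prod_def sum_squares_eq_zero_iff)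
    then show ?thesis using lex_max_in_core[OF R] by blast
  qed
  moreover have "finite (core R)" "\<forall>u\<in>core R. primitive u"
    using complete_fanD(1,2)[OF smooth_fanD(1)[OF R]] by (auto simp: core_def)
  ultimately show ?thesis by (simp add: complete_fan_iff)
qed

section \<open>Minimal resolutions\<close>

text \<open>
  The ray \<open>u\<close> is interior to a strictly convex cone that also contains its neighbours, and a linear
  form positive on that cone shows that \<open>v + w\<close> is a positive multiple of \<open>u\<close>.
\<close>

lemma exceptional_self_int:
  assumes "complete_fan S" "smooth_fan R" "S \<subseteq> R" "u \<in> R" "u \<notin> S"
  shows "self_int R u \<le> - 1"
proof -
  note R = smooth_fanD(1)[OF assms(2)]
  obtain a b where ab: "max_cone S a b" "0 < det2 a u" "0 < det2 u b"
    using enclosing_max_cone[OF assms(1) complete_fanD(2)[OF R assms(4)] assms(5)] by blast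
  obtain v w where vw: "max_cone R v u" "max_cone R u w" using neighbours_exist[OF assms(2,4)] .
  have "a \<in> R" "b \<in> R" "0 < det2 a b" using ab(1) max_coneD assms(3) by blast+
  then have "0 \<le> det2 a v" "0 \<le> det2 w b"
    using pred_closest[OF R vw(1)] succ_closest[OF R vw(2)] ab by blast+
  moreover have "0 < det2 a w"
    using nested_right[of a b u w] \<open>0 < det2 a b\<close> ab \<open>0 \<le> det2 w b\<close> max_coneD(3)[OF vw(2)] by simp
  ultimately have "0 < - self_int R u * det2 a u" using self_int_det[OF assms(2) vw, of a] by simp
  then show ?thesis using ab(2) by (simp add: mult_less_0_iff)
qed

lemma minimal_resolutionD:
  assumes "minimal_resolution S R"
  shows "complete_fan S" "smooth_fan R" "S \<subseteq> R" "core R \<subseteq> S"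
proof -
  show 1: "complete_fan S" "smooth_fan R" "S \<subseteq> R"
    using assms by (auto simp: minimal_resolution_def)
  show "core R \<subseteq> S"
  proof
    fix u assume u: "u \<in> core R"
    show "u \<in> S"
    proof (rule ccontr)
      assume "u \<notin> S"
      then have "self_int R u = - 1"
        using exceptional_self_int[OF 1, of u] u by (auto simp: core_def)
      then show False using assms u \<open>u \<notin> S\<close>
        by (auto simp: minimal_resolution_def minus_one_curve_def core_def)
    qed
  qed
qed

lemma minimal_resolution_core:
  assumes "minimal_resolution S R" "card S = 3"
  shows "core R = S"
proof -
  note D = minimal_resolutionD[OF assms(1)]
  have "3 \<le> card (core R)" using complete_fan_card[OF core_complete[OF D(2)]] .
  moreover have "finite S" using complete_fanD(1)[OF D(1)] .
  ultimately show ?thesis using card_seteq[OF _ D(4)] assms(2) by simp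
qed

lemma minimal_resolution_of_core:
  assumes "smooth_fan R"
  shows "minimal_resolution (core R) R"
  unfolding minimal_resolution_def
  using assms core_complete[OF assms] core_subset[of R]
  by (auto simp: core_def minus_one_curve_def)

text \<open>
  The maximum principle, applied inside one smooth cone: the ray of \<open>R1\<close> strictly between \<open>a\<close> and
  \<open>b\<close> that is farthest from the segment \<open>ab\<close> would have self-intersection at least \<open>-1\<close>, although it
  is not a ray of \<open>S\<close>.
\<close>

lemma no_ray_between:
  assumes R1: "minimal_resolution S R1" and R2: "minimal_resolution S R2"
    and ab: "max_cone R2 a b" "a \<in> R1" "b \<in> R1"
    and v: "v \<in> R1" "0 < det2 a v" "0 < det2 v b"
  shows False
proof -
  note D1 = minimal_resolutionD[OF R1] and D2 = minimal_resolutionD[OF R2]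
  note C1 = smooth_fanD(1)[OF D1(2)]
  define A where "A = {z\<in>R1. 0 < det2 a z \<and> 0 < det2 z b}"
  have ab1: "det2 a b = 1" "det2 b a = - 1"
    using smooth_fanD(2)[OF D2(2) ab(1)] det2_swap[of b a] by simp_all
  \<comment> \<open>The form \<open>det2 (a - b)\<close> has value \<open>1\<close> at \<open>a\<close> and
    \<open>b\<close>, and is the sum of the two coordinates of a point of the cone.\<close>
  have "finite A" "A \<noteq> {}" using complete_fanD(1)[OF C1] v by (auto simp: A_def)
  then obtain z where z: "z \<in> A" "\<forall>y\<in>A. lex_le (a - b) a y z"
    using lex_max_exists by blast
  then have zR: "z \<in> R1" and az: "0 < det2 a z" and zb: "0 < det2 z b" by (auto simp: A_def)
  have pos: "2 \<le> det2 (a - b) z" using az zb det2_swap[of b z] by simp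
  obtain p q where pq: "max_cone R1 p z" "max_cone R1 z q" using neighbours_exist[OF D1(2) zR] .
  have ap: "0 \<le> det2 a p" using pred_closest[OF C1 pq(1) ab(2) az] .
  have qb: "0 \<le> det2 q b" using succ_closest[OF C1 pq(2) ab(3) zb] .
  have pb: "0 < det2 p b"
    using nested_left[of a b z p] ab1 az zb ap max_coneD(3)[OF pq(1)] by simp
  have aq: "0 < det2 a q"
    using nested_right[of a b z q] ab1 az zb qb max_coneD(3)[OF pq(2)] by simp
  have prims: "primitive a" "primitive b" "primitive p" "primitive q"
    using complete_fanD(2)[OF C1] ab pq max_coneD by blast+
  have "lex_le (a - b) a p z"
  proof (cases "det2 a p = 0")
    case True
    then have "a = p" using same_ray[OF prims(1,3), of "- b"] ab1 pb det2_swap[of b p] by simp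
    then show ?thesis using pos ab1 by (simp add: lex_le_def)
  next
    case False
    then show ?thesis using ap pb z(2) max_coneD(1)[OF pq(1)] by (simp add: A_def)
  qed
  moreover have "lex_le (a - b) a q z"
  proof (cases "det2 q b = 0")
    case True
    then have "q = b" using same_ray[OF prims(4,2), of a] ab1 aq by simp
    then show ?thesis using pos ab1 by (simp add: lex_le_def)
  next
    case False
    then show ?thesis using qb aq z(2) max_coneD(2)[OF pq(2)] by (simp add: A_def)
  qed
  ultimately have "- 1 \<le> self_int R1 z"
    using lex_max_self_int[OF D1(2) pq, of "a - b" a] pos ab1 by simp
  then have "z \<in> S" using D1(4) zR by (auto simp: core_def)
  then have "z \<in> R2" using D2(3) by blast
  then show False using max_coneD(4)[OF ab(1)] az zb by fastforce
qed

text \<open>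
  If two minimal resolutions of \<open>S\<close> differ, choose in a cone of \<open>S\<close> a ray \<open>v\<close> that belongs to only
  one of them and is as low as possible for a linear form \<open>f\<close> that is positive on the cone.  In the
  other fan, \<open>v\<close> is a sum of positive multiples of two adjacent rays; these are lower, hence common
  to both fans, and \<open>no_ray_between\<close> applies.
\<close>

lemma minimal_resolution_unique:
  assumes R1: "minimal_resolution S R1" and R2: "minimal_resolution S R2"
  shows "R1 = R2"
proof (rule ccontr)
  assume "R1 \<noteq> R2"
  define D where "D = (R1 - R2) \<union> (R2 - R1)"
  note D1 = minimal_resolutionD[OF R1] and D2 = minimal_resolutionD[OF R2]
  note C1 = smooth_fanD(1)[OF D1(2)] and C2 = smooth_fanD(1)[OF D2(2)]
  obtain v0 where v0: "v0 \<in> D" using \<open>R1 \<noteq> R2\<close> by (auto simp: D_def)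
  obtain s t where st: "s \<in> S" "t \<in> S" "0 < det2 s t" "v0 \<in> cone_pts s t"
    using D1(1) unfolding complete_fan_def by blast
  define f where "f z = det2 s z + det2 z t" for z
  define E where "E = {z\<in>D. z \<in> cone_pts s t}"
  have "finite (f ` E)" "f ` E \<noteq> {}"
    using v0 st complete_fanD(1)[OF C1] complete_fanD(1)[OF C2] by (auto simp: E_def D_def)
  then have "Min (f ` E) \<in> f ` E" "\<And>z. z \<in> E \<Longrightarrow> Min (f ` E) \<le> f z" by auto
  then obtain v where v: "v \<in> E" "\<And>z. z \<in> E \<Longrightarrow> f v \<le> f z" by auto
  have *: False if Q: "minimal_resolution S Q1" "minimal_resolution S Q2"
    and D: "D = (Q1 - Q2) \<union> (Q2 - Q1)" and vQ: "v \<in> Q1" "v \<notin> Q2" for Q1 Q2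
  proof -
    note E1 = minimal_resolutionD[OF Q(1)] and E2 = minimal_resolutionD[OF Q(2)]
    note B1 = smooth_fanD(1)[OF E1(2)] and B2 = smooth_fanD(1)[OF E2(2)]
    have pv: "primitive v" using complete_fanD(2)[OF B1 vQ(1)] .
    have ps: "primitive s" "primitive t" using complete_fanD(2)[OF D1(1)] st by auto
    have sQ: "s \<in> Q2" "t \<in> Q2" using st E2(3) by auto
    have sv: "0 < det2 s v" and vt: "0 < det2 v t"
      using in_cone_cases[OF ps pv st(3)] v sQ vQ by (auto simp: E_def)
    obtain a b where ab: "max_cone Q2 a b" "0 < det2 a v" "0 < det2 v b"
      using enclosing_max_cone[OF B2 pv vQ(2)] by blast
    have ab1: "det2 a b = 1" using smooth_fanD(2)[OF E2(2) ab(1)] .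
    have abQ: "a \<in> Q2" "b \<in> Q2" using max_coneD ab(1) by blast+
    have sa: "0 \<le> det2 s a"
    proof (rule ccontr)
      assume "\<not> ?thesis"
      then have as: "0 < det2 a s" using det2_swap[of a s] by simp
      have "0 < det2 s b" using nested_right[of a b v v] ab ab1 nested_left[of a b v s] as sv by simp
      then show False using max_coneD(4)[OF ab(1) sQ(1) as] by simp
    qed
    have bt: "0 \<le> det2 b t"
    proof (rule ccontr)
      assume "\<not> ?thesis"
      then have tb: "0 < det2 t b" using det2_swap[of t b] by simp
      have "0 < det2 a t" using nested_right[of a b v t] ab ab1 tb vt by simp
      then show False using max_coneD(4)[OF ab(1) sQ(2)] tb by simp
    qed
    have at: "0 < det2 a t" using nested_left[OF st(3) sv _ sa ab(2)] vt by simp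
    have sb: "0 < det2 s b" using nested_right[OF st(3) _ vt bt ab(3)] sv by simp
    have "v = smul (det2 v b) a + smul (det2 a v) b"
      by (rule vec_eq_if_dets_eq[of a b]) (use ab1 det2_swap[of b a] det2_swap[of b v] in auto)
    then have "f v = f (smul (det2 v b) a + smul (det2 a v) b)" by simp
    then have fv: "f v = det2 v b * f a + det2 a v * f b" by (simp add: f_def algebra_simps)
    have fp: "0 < f a" "0 < f b" using sa at sb bt by (simp_all add: f_def)
    then have "f a \<le> det2 v b * f a" "f b \<le> det2 a v * f b" using ab by simp_all
    then have lt: "f a < f v" "f b < f v" using fv fp by linarith+
    have "a \<in> cone_pts s t" "b \<in> cone_pts s t"
      using cone_pts_iff[OF st(3)] sa at sb bt by auto
    then have "a \<in> Q1" "b \<in> Q1" using v(2)[of a] v(2)[of b] lt abQ D unfolding E_def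
      by (metis (mono_tags, lifting) DiffI UnI2 mem_Collect_eq not_less)+
    then show False using no_ray_between[OF Q ab(1) _ _ vQ(1) ab(2,3)] by blast
  qed
  show False using *[OF R1 R2] *[OF R2 R1] v(1) by (auto simp: E_def D_def)
qed

section \<open>Picard number one\<close>

lemma det_dvd_pairing:
  assumes "det2 u w \<noteq> 0" "det2 u w dvd a" "det2 u w dvd b"
  obtains m :: "int \<times> int" where "pairing m u = a" "pairing m w = b"
proof -
  obtain a' b' where ab: "a = det2 u w * a'" "b = det2 u w * b'" using assms by (auto elim!: dvdE)
  define m where "m = (a' * snd w - b' * snd u, b' * fst u - a' * fst w)"
  have "pairing m u = a" "pairing m w = b"
    by (simp_all add: pairing_def m_def ab det2_def algebra_simps)
  then show ?thesis by (rule that)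
qed

lemma rational_pairing:
  assumes "det2 u w \<noteq> 0"
  obtains m :: "rat \<times> rat" where "pairing m u = a" "pairing m w = b"
proof -
  define d :: rat where "d = of_int (det2 u w)"
  have d: "d \<noteq> 0" using assms by (simp add: d_def)
  have d_eq: "of_int (fst u) * of_int (snd w) - of_int (snd u) * of_int (fst w) = d"
    by (simp add: d_def det2_def)
  define m where "m = ((a * of_int (snd w) - b * of_int (snd u)) / d,
     (b * of_int (fst u) - a * of_int (fst w)) / d)"
  have "pairing m u = a * (of_int (fst u) * of_int (snd w) - of_int (snd u) * of_int (fst w)) / d"
    "pairing m w = b * (of_int (fst u) * of_int (snd w) - of_int (snd u) * of_int (fst w)) / d"
    using d by (simp_all add: pairing_def m_def field_simps)
  then have "pairing m u = a" "pairing m w = b" unfolding d_eq using d by simp_all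
  then show ?thesis by (rule that)
qed

lemma pairing_three_term:
  fixes m :: "'a::comm_ring_1 \<times> 'a"
  shows "of_int (det2 u w) * pairing m z + of_int (det2 w z) * pairing m u
    + of_int (det2 z u) * pairing m w = 0"
  by (simp add: pairing_def det2_def algebra_simps)

text \<open>
  Every prime divisor becomes Cartier after multiplication by this number, as the local equations can be
  solved by Cramer's rule.
\<close>

definition det_multiple :: "vec set \<Rightarrow> int" where
  "det_multiple R = (\<Prod>(u, w)\<in>{(u, w) \<in> R \<times> R. det2 u w \<noteq> 0}. det2 u w)"

lemma det_multiple:
  assumes "finite R"
  shows "det_multiple R \<noteq> 0" "u \<in> R \<Longrightarrow> w \<in> R \<Longrightarrow> det2 u w \<noteq> 0 \<Longrightarrow> det2 u w dvd det_multiple R"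
proof -
  have fin: "finite {(u, w) \<in> R \<times> R. det2 u w \<noteq> 0}"
    by (rule finite_subset[of _ "R \<times> R"]) (use assms in auto)
  show "det_multiple R \<noteq> 0" unfolding det_multiple_def prod_zero_iff[OF fin] by auto
  assume "u \<in> R" "w \<in> R" "det2 u w \<noteq> 0"
  then show "det2 u w dvd det_multiple R"
    unfolding det_multiple_def by (intro dvd_prod_eqI[OF fin, of "(u, w)"]) auto
qed

definition ray_div :: "vec set \<Rightarrow> vec \<Rightarrow> vec \<Rightarrow> int" where
  "ray_div R z u = (if u = z then det_multiple R else 0)"

lemma ray_div_cartier:
  assumes "finite R" "z \<in> R"
  shows "ray_div R z \<in> cartier_div R"
proof -
  have "\<exists>m :: int \<times> int. pairing m u = - ray_div R z u \<and> pairing m w = - ray_div R z w"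
    if "max_cone R u w" for u w
  proof -
    have "u \<in> R" "w \<in> R" "det2 u w \<noteq> 0" using max_coneD[OF that] by auto
    then have "det2 u w dvd det_multiple R" using det_multiple(2)[OF assms(1)] by blast
    then have "det2 u w dvd - ray_div R z x" for x by (cases "x = z") (simp_all add: ray_div_def)
    then show ?thesis using det_dvd_pairing[OF \<open>det2 u w \<noteq> 0\<close>] by metis
  qed
  then show ?thesis using assms(2) by (auto simp: cartier_div_def weil_div_def ray_div_def)
qed

text \<open>
  A principal divisor that vanishes on two independent rays is zero, so the remaining rays give
  independent classes.
\<close>

lemma ray_divs_independent:
  assumes R: "finite R" and Z: "Z \<subseteq> R" and uw: "u \<in> R" "w \<in> R" "u \<notin> Z" "w \<notin> Z" "det2 u w \<noteq> 0"
  shows "pic_independent R (ray_div R ` Z)" "card (ray_div R ` Z) = card Z"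
proof -
  have N: "det_multiple R \<noteq> 0" using det_multiple(1)[OF R] .
  have inj: "inj_on (ray_div R) Z"
  proof (rule inj_onI)
    fix y z assume "ray_div R y = ray_div R z"
    then have "ray_div R y y = ray_div R z y" by simp
    then show "y = z" using N by (simp add: ray_div_def split: if_splits)
  qed
  then show "card (ray_div R ` Z) = card Z" by (rule card_image)
  have fin: "finite Z" using finite_subset[OF Z R] .
  have zero: "c a = 0" if c: "(\<lambda>u. \<Sum>a\<in>ray_div R ` Z. c a * a u) \<in> principal_div R"
    and a: "a \<in> ray_div R ` Z" for c :: "(vec \<Rightarrow> int) \<Rightarrow> int" and a
  proof -
    obtain z where z: "z \<in> Z" "a = ray_div R z" using a by blast
    have sum: "(\<Sum>a\<in>ray_div R ` Z. c a * a x) = (if x \<in> Z then c (ray_div R x) * det_multiple R else 0)" for x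
    proof -
      have "(\<Sum>a\<in>ray_div R ` Z. c a * a x) = (\<Sum>z\<in>Z. c (ray_div R z) * ray_div R z x)"
        using inj by (simp add: sum.reindex)
      also have "\<dots> = (\<Sum>z\<in>Z. if x = z then c (ray_div R x) * det_multiple R else 0)"
        by (rule sum.cong) (auto simp: ray_div_def)
      also have "\<dots> = (if x \<in> Z then c (ray_div R x) * det_multiple R else 0)"
        using fin by simp
      finally show ?thesis .
    qed
    obtain m :: "int \<times> int" where m: "\<And>x. x \<in> R \<Longrightarrow>
        (if x \<in> Z then c (ray_div R x) * det_multiple R else 0) = pairing m x"
      using c unfolding principal_div_def sum by auto
    have "pairing m u = 0" "pairing m w = 0" using m[of u] m[of w] uw by simp_all
    then have "pairing m z = 0" using pairing_three_term[of u w m z] uw(5) by simp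
    then have "c (ray_div R z) * det_multiple R = 0" using m[of z] z Z by auto
    then show ?thesis using N z by simp
  qed
  show "pic_independent R (ray_div R ` Z)"
    unfolding pic_independent_def using zero fin ray_div_cartier[OF R] Z by blast
qed

lemma picard_number_ge:
  assumes "pic_independent R B"
  shows "enat (card B) \<le> picard_number R"
  unfolding picard_number_def using assms by (intro SUP_upper) simp

lemma picard_number_one_card:
  assumes "complete_fan R" "picard_number R = 1"
  shows "card R = 3"
proof (rule ccontr)
  assume "card R \<noteq> 3"
  then have c: "4 \<le> card R" using complete_fan_card[OF assms(1)] by simp
  have fin: "finite R" using complete_fanD(1)[OF assms(1)] .
  obtain u where u: "u \<in> R" using c by fastforce
  obtain w where w: "max_cone R u w" using succ_exists[OF assms(1) u] by blast
  have wR: "w \<in> R" and uw: "det2 u w \<noteq> 0" using max_coneD[OF w] by auto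
  have "card (R - {u, w}) = card R - 2" using u wR max_cone_neq[OF w] fin by (simp add: card_Diff_subset)
  then have "2 \<le> card (R - {u, w})" using c by linarith
  then obtain Z where Z: "Z \<subseteq> R - {u, w}" "card Z = 2"
    using obtain_subset_with_card_n by metis
  then have "pic_independent R (ray_div R ` Z)" "card (ray_div R ` Z) = 2"
    using ray_divs_independent[OF fin, of Z u w] u wR uw by auto
  then have "enat 2 \<le> 1" using picard_number_ge assms(2) by metis
  then show False by (simp add: one_enat_def)
qed

text \<open>
  The linear relation \<open>det2 w z u + det2 z u w + det2 u w z = 0\<close> between the three rays defines the
  degree \<open>\<phi>\<close> below, whose kernel consists of the divisors with a principal multiple; so any two
  classes are dependent.
\<close>

lemma picard_number_triple:
  assumes R: "complete_fan R" "card R = 3"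
  shows "picard_number R = 1"
proof (rule antisym)
  have fin: "finite R" using complete_fanD(1)[OF R(1)] .
  obtain u where u: "u \<in> R" using R(2) by fastforce
  obtain w where w: "w \<in> R" "0 < det2 u w" using succ_exists[OF R(1) u] max_coneD by blast
  obtain z where z: "R = {u, w, z}" "0 < det2 w z" "0 < det2 z u"
    using complete_triple[OF R u w] by blast
  have zu: "z \<noteq> u" "z \<noteq> w" "w \<noteq> u" using z w by auto
  have "enat (card (ray_div R ` {z})) \<le> picard_number R"
    using ray_divs_independent(1)[OF fin, of "{z}" u w] u w z(1) zu
    by (intro picard_number_ge) auto
  then show "1 \<le> picard_number R" by (simp add: one_enat_def)
  have "card B \<le> 1" if B: "pic_independent R B" for B
  proof (rule ccontr)
    assume "\<not> card B \<le> 1"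
    then obtain a b where ab: "a \<in> B" "b \<in> B" "a \<noteq> b"
      by (metis One_nat_def card_le_Suc0_iff_eq card.infinite le0)
    have finB: "finite B" and cart: "B \<subseteq> cartier_div R" using B by (auto simp: pic_independent_def)
    define \<phi> where "\<phi> d = det2 w z * d u + det2 z u * d w + det2 u w * d z" for d :: "vec \<Rightarrow> int"
    have key: "c a = 0 \<and> c b = 0"
      if c: "\<And>d. d \<noteq> a \<Longrightarrow> d \<noteq> b \<Longrightarrow> c d = 0" "det2 u w dvd c a" "det2 u w dvd c b"
        "c a * \<phi> a + c b * \<phi> b = 0" for c
    proof -
      define e where "e x = c a * a x + c b * b x" for x
      have sum: "(\<lambda>x. \<Sum>d\<in>B. c d * d x) = e"
      proof
        fix x
        have "(\<Sum>d\<in>B. c d * d x) = (\<Sum>d\<in>{a, b}. c d * d x)"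
          by (rule sum.mono_neutral_right) (use finB ab c(1) in auto)
        then show "(\<Sum>d\<in>B. c d * d x) = e x" using ab by (simp add: e_def)
      qed
      have "det2 u w dvd e u" "det2 u w dvd e w" using c by (simp_all add: e_def)
      then obtain m :: "int \<times> int" where m: "pairing m u = e u" "pairing m w = e w"
        using det_dvd_pairing[of u w] w by (metis less_irrefl)
      have "det2 w z * e u + det2 z u * e w + det2 u w * e z = 0"
        using c(4) by (simp add: e_def \<phi>_def algebra_simps)
      moreover have "det2 u w * pairing m z + det2 w z * e u + det2 z u * e w = 0"
        using pairing_three_term[of u w m z] m by simp
      ultimately have "det2 u w * pairing m z = det2 u w * e z" by linarith
      then have "pairing m z = e z" using w by simp
      then have "\<forall>x\<in>R. e x = pairing m x" using m z(1) by auto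
      moreover have "a \<in> weil_div R" "b \<in> weil_div R" using cart ab unfolding cartier_div_def by blast+
      then have "e \<in> weil_div R" by (simp add: e_def weil_div_def)
      ultimately have "(\<lambda>x. \<Sum>d\<in>B. c d * d x) \<in> principal_div R"
        unfolding sum principal_div_def by blast
      then show ?thesis using B ab unfolding pic_independent_def by blast
    qed
    \<comment> \<open>The relation \<open>\<phi>(b) a - \<phi>(a) b\<close> of degree \<open>0\<close>,
      multiplied by \<open>det2 u w\<close> to make the combination integrally principal.\<close>
    define c1 where "c1 d = (if d = a then det2 u w * \<phi> b else if d = b then - det2 u w * \<phi> a else 0)" for d
    have "c1 a = 0 \<and> c1 b = 0"
      by (rule key) (use ab in \<open>auto simp: c1_def\<close>)
    then have "\<phi> a = 0" using ab w by (auto simp: c1_def)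
    \<comment> \<open>If the degrees of \<open>a\<close> and \<open>b\<close> vanish, already a multiple of
      \<open>a\<close> is principal.\<close>
    define c2 where "c2 d = (if d = a then det2 u w else 0)" for d
    have "c2 a = 0 \<and> c2 b = 0"
      by (rule key) (use ab \<open>\<phi> a = 0\<close> in \<open>auto simp: c2_def\<close>)
    then show False using w by (simp add: c2_def)
  qed
  then show "picard_number R \<le> 1"
    unfolding picard_number_def by (intro SUP_least) (simp add: one_enat_def)
qed

text \<open>
  On each cone the piecewise linear function of \<open>-K\<close> is given by a linear form that is constant on
  the two rays, and the positive relation between the three rays determines its sign at the third.
\<close>

lemma triple_log_del_Pezzo:
  assumes R: "complete_fan R" "card R = 3"
  shows "toric_log_del_Pezzo R"
proof -
  have "log_terminal R"
    unfolding log_terminal_def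
  proof (intro allI impI)
    fix u w assume uw: "max_cone R u w"
    have uwR: "u \<in> R" "w \<in> R" "0 < det2 u w" using max_coneD[OF uw] by auto
    obtain m :: "rat \<times> rat" where m: "pairing m u = 1" "pairing m w = 1"
      using rational_pairing[of u w 1 1] uwR by auto
    have "pairing m v - 1 > - 1" if v: "primitive v" "v \<in> cone_pts u w" for v
    proof -
      have nn: "0 \<le> det2 u v" "0 \<le> det2 v w" using cone_pts_iff uwR v by blast+
      have "det2 u v \<noteq> 0 \<or> det2 w v \<noteq> 0"
        using vec_eq_if_dets_eq[of u w v 0] uwR primitive_nonzero[OF v(1)] by auto
      then have "0 < det2 u v + det2 v w" using nn det2_swap[of v w] by linarith
      then have "(0::rat) < of_int (det2 u v + det2 v w)" by linarith
      moreover have "of_int (det2 u w) * pairing m v = of_int (det2 u v + det2 v w)"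
        using pairing_three_term[of u w m v] m det2_swap[of w v] det2_swap[of v u] by simp
      ultimately have "0 < of_int (det2 u w) * pairing m v" by simp
      then show ?thesis using uwR(3) by (simp add: zero_less_mult_iff)
    qed
    then show "\<exists>m :: rat \<times> rat. pairing m u = - of_int (canonical_div R u) \<and>
        pairing m w = - of_int (canonical_div R w) \<and>
        (\<forall>v. primitive v \<and> v \<in> cone_pts u w \<longrightarrow> pairing m v - 1 > - 1)"
      using m uwR by (intro exI[of _ m]) (simp add: canonical_div_def)
  qed
  moreover have "ample R (\<lambda>u. - canonical_div R u)"
    unfolding ample_def
  proof (intro allI impI)
    fix u w assume uw: "max_cone R u w"
    have uwR: "u \<in> R" "w \<in> R" "0 < det2 u w" using max_coneD[OF uw] by auto
    obtain z where z: "R = {u, w, z}" "0 < det2 w z" "0 < det2 z u"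
      using complete_triple[OF R uwR] by blast
    obtain m :: "rat \<times> rat" where m: "pairing m u = - 1" "pairing m w = - 1"
      using rational_pairing[of u w "-1" "-1"] uwR by auto
    have "of_int (det2 u w) * pairing m z = of_int (det2 w z + det2 z u)"
      using pairing_three_term[of u w m z] m by simp
    also have "\<dots> > 0" using z by linarith
    finally have "0 < pairing m z" using uwR(3) by (simp add: zero_less_mult_iff)
    then show "\<exists>m :: rat \<times> rat. pairing m u = - of_int (- canonical_div R u) \<and>
       pairing m w = - of_int (- canonical_div R w) \<and>
        (\<forall>x\<in>R - {u, w}. pairing m x > - of_int (- canonical_div R x))"
      using m uwR z(1) by (intro exI[of _ m]) (auto simp: canonical_div_def)
  qed
  ultimately show ?thesis using R(1) by (simp add: toric_log_del_Pezzo_def)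
qed

section \<open>Blowing down\<close>

text \<open>
  The blow-down of the \<open>(-1)\<close>-curve of \<open>u\<close>, together with the two curves that it meets.
\<close>

locale contraction =
  fixes R :: "vec set" and u v w :: vec
  assumes smooth: "smooth_fan R" and vu: "max_cone R v u" and uw: "max_cone R u w"
    and self_int_u: "self_int R u = - 1"
begin

lemma u_eq: "u = v + w"
  using self_int_rel[OF smooth vu uw] self_int_u by simp

lemma rays: "u \<in> R" "v \<in> R - {u}" "w \<in> R - {u}" "v \<noteq> w"
proof -
  show "u \<in> R" "v \<in> R - {u}" "w \<in> R - {u}"
    using vu uw max_coneD max_cone_neq by blast+
  show "v \<noteq> w" using vu uw max_cone_asym by blast
qed

lemma det_vw: "det2 v u = 1" "det2 u w = 1" "det2 v w = 1"
proof -
  show "det2 v u = 1" "det2 u w = 1" using smooth_fanD(2)[OF smooth] vu uw by auto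
  then show "det2 v w = 1" unfolding u_eq by simp
qed

lemma max_cone_contraction:
  "max_cone (R - {u}) a b \<longleftrightarrow> max_cone R a b \<and> a \<noteq> u \<and> b \<noteq> u \<or> a = v \<and> b = w"
proof
  assume ab: "max_cone (R - {u}) a b"
  note C = smooth_fanD(1)[OF smooth] and prim = complete_fanD(2)[OF smooth_fanD(1)[OF smooth]]
  have abR: "a \<in> R" "a \<noteq> u" "b \<in> R" "b \<noteq> u" "0 < det2 a b" using max_coneD[OF ab] by auto
  show "max_cone R a b \<and> a \<noteq> u \<and> b \<noteq> u \<or> a = v \<and> b = w"
  proof (cases "0 < det2 a u \<and> 0 < det2 u b")
    case False
    then show ?thesis using ab by (auto simp: max_cone_def)
  next
    case True
    have av: "0 \<le> det2 a v" using pred_closest[OF C vu] abR True by blast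
    have wb: "0 \<le> det2 w b" using succ_closest[OF C uw] abR True by blast
    have vb: "0 < det2 v b" using nested_left[of a b u v] abR True av det_vw by simp
    have aw: "0 < det2 a w" using nested_right[of a b u w] abR True wb det_vw by simp
    have "det2 a v = 0" using max_coneD(4)[OF ab, of v] rays vb av by force
    then have "a = v" using same_ray[of a v "- b"] prim abR rays vb det2_swap[of b] by simp
    have "det2 w b = 0" using max_coneD(4)[OF ab, of w] rays wb aw by force
    then have "w = b" using same_ray[of w b a] prim abR rays aw by simp
    then show ?thesis using \<open>a = v\<close> by simp
  qed
next
  have "max_cone (R - {u}) v w"
    unfolding max_cone_def
  proof (intro conjI notI)
    assume "\<exists>z\<in>R - {u}. 0 < det2 v z \<and> 0 < det2 z w"
    then obtain z where z: "z \<in> R" "z \<noteq> u" "0 < det2 v z" "0 < det2 z w" by blast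
    have "det2 z u \<le> 0" using max_coneD(4)[OF vu z(1,3)] .
    moreover have "\<not> 0 < det2 u z" using max_coneD(4)[OF uw z(1)] z(4) by linarith
    ultimately have "det2 u z = 0" using det2_swap[of u z] by simp
    then have "u = z" using same_ray[of u z v] z det_vw rays(1)
      complete_fanD(2)[OF smooth_fanD(1)[OF smooth]] by simp
    then show False using z by simp
  qed (use rays det_vw in auto)
  moreover assume "max_cone R a b \<and> a \<noteq> u \<and> b \<noteq> u \<or> a = v \<and> b = w"
  ultimately show "max_cone (R - {u}) a b" by (auto simp: max_cone_def)
qed

lemma smooth_contraction: "smooth_fan (R - {u})"
proof -
  note C = smooth_fanD(1)[OF smooth]
  have "\<exists>z\<in>R - {u}. 0 < det2 x z" if x: "x \<noteq> 0" for x
  proof -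
    obtain z where z: "z \<in> R" "0 < det2 x z" using complete_fanD(3)[OF C x] by blast
    show ?thesis
    proof (cases "z = u")
      case True
      then have "0 < det2 x v \<or> 0 < det2 x w" using z(2) unfolding True u_eq by auto
      then show ?thesis using rays by blast
    qed (use z in blast)
  qed
  then have "complete_fan (R - {u})"
    using complete_fanD(1,2)[OF C] by (simp add: complete_fan_iff)
  then show ?thesis unfolding smooth_fan_def max_cone_contraction
    using smooth_fanD(2)[OF smooth] det_vw(3) by blast
qed

lemma self_int_contraction:
  assumes "z \<in> R - {u}"
  shows "self_int (R - {u}) z = self_int R z + (if z = v \<or> z = w then 1 else 0)"
proof -
  note C = smooth_fanD(1)[OF smooth]
  obtain a b where ab: "max_cone R a z" "max_cone R z b"
    using neighbours_exist[OF smooth] assms by blast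
  have rel: "a + b + smul (self_int R z) z = 0" using self_int_rel[OF smooth ab] .
  consider "z = v" | "z = w" | "z \<noteq> v" "z \<noteq> w" by blast
  then show ?thesis
  proof cases
    case 1
    have "b = u" using ab(2) vu succ_unique[OF C] 1 by blast
    have "a \<noteq> u" using ab(1) vu max_cone_asym 1 by blast
    have "max_cone (R - {u}) a z" "max_cone (R - {u}) z w"
      using max_cone_contraction ab \<open>a \<noteq> u\<close> assms 1 by auto
    moreover have "a + w + smul (self_int R z + 1) z = 0"
      using rel unfolding \<open>b = u\<close> u_eq 1 by (auto simp: smul_def prod_eq_iff algebra_simps)
    ultimately show ?thesis using self_int_eqI[OF smooth_contraction] 1 by simp
  next
    case 2
    have "a = u" using ab(1) uw pred_unique[OF C] 2 by blast
    have "b \<noteq> u" using ab(2) uw max_cone_asym 2 by blast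
    have "max_cone (R - {u}) v z" "max_cone (R - {u}) z b"
      using max_cone_contraction ab \<open>b \<noteq> u\<close> assms 2 by auto
    moreover have "v + b + smul (self_int R z + 1) z = 0"
      using rel unfolding \<open>a = u\<close> u_eq 2 by (auto simp: smul_def prod_eq_iff algebra_simps)
    ultimately show ?thesis using self_int_eqI[OF smooth_contraction] 2 by simp
  next
    case 3
    have "b \<noteq> u" using ab(2) vu pred_unique[OF C] 3 by blast
    moreover have "a \<noteq> u" using ab(1) uw succ_unique[OF C] 3 by blast
    ultimately have "max_cone (R - {u}) a z" "max_cone (R - {u}) z b"
      using max_cone_contraction ab assms by auto
    then show ?thesis using self_int_eqI[OF smooth_contraction] rel 3 by simp
  qed
qed

lemma blow_down_contraction: "blow_down R u (R - {u})"
  using smooth smooth_contraction rays self_int_u by (simp add: blow_down_def minus_one_curve_def)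

end

lemma contraction_exists:
  assumes "smooth_fan R" "minus_one_curve R u"
  obtains v w where "contraction R u v w"
proof -
  obtain v w where "max_cone R v u" "max_cone R u w"
    using neighbours_exist[OF assms(1), of u] assms(2) unfolding minus_one_curve_def by blast
  then show ?thesis using that[of v w] assms by (simp add: contraction_def minus_one_curve_def)
qed

lemma blow_downE:
  assumes "blow_down R u R'"
  obtains v w where "contraction R u v w" "R' = R - {u}"
  using assms contraction_exists unfolding blow_down_def by blast

section \<open>Minimal resolutions of surfaces of Picard number one\<close>

text \<open>
  These are exactly the minimal resolutions of the toric log del Pezzo surfaces of Picard number one;
  the surface itself is the core (\<open>rank_one_resolution_core\<close>, \<open>rank_one_resolution_of\<close>).
\<close>

definition rank_one_resolution :: "vec set \<Rightarrow> bool" where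
  "rank_one_resolution R \<longleftrightarrow> smooth_fan R \<and> card (core R) = 3"

lemma rank_one_resolution_core:
  assumes "rank_one_resolution R"
  shows "smooth_fan R" "toric_log_del_Pezzo (core R)" "picard_number (core R) = 1"
    "minimal_resolution (core R) R"
  using assms core_complete triple_log_del_Pezzo picard_number_triple minimal_resolution_of_core
  unfolding rank_one_resolution_def by blast+

lemma rank_one_resolution_of:
  assumes "picard_number S = 1" "minimal_resolution S R"
  shows "rank_one_resolution R" "core R = S"
proof -
  have "card S = 3" using picard_number_one_card minimal_resolutionD(1)[OF assms(2)] assms(1) by blast
  then show "core R = S" using minimal_resolution_core[OF assms(2)] by blast
  then show "rank_one_resolution R"
    using minimal_resolutionD(2)[OF assms(2)] \<open>card S = 3\<close> by (simp add: rank_one_resolution_def)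
qed

text \<open>
  If the \<open>(-1)\<close>-ray \<open>u\<close> and its neighbour \<open>w\<close> were both in the core, a third ray would complete them to
  the fan of the core.  A linear form that vanishes at \<open>w\<close> and is positive at \<open>u\<close> is then negative at the
  third ray, so the maximum principle forces it to be maximal at \<open>u\<close>, even with ties broken in favour
  of \<open>v\<close>.  But \<open>v = u - w\<close> has the same value as \<open>u\<close>.
\<close>

lemma minus_one_neighbours:
  assumes "rank_one_resolution R" "contraction R u v w"
  shows "self_int R v \<le> - 2" "self_int R w \<le> - 2"
proof -
  interpret contraction R u v w by fact
  have card: "card (core R) = 3" using assms(1) by (simp add: rank_one_resolution_def)
  have u: "u \<in> core R" using rays self_int_u by (simp add: core_def)
  show "self_int R w \<le> - 2"
  proof (rule ccontr)
    assume "\<not> ?thesis"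
    then have "w \<in> core R" using rays by (simp add: core_def)
    then obtain b where b: "core R = {u, w, b}" "0 < det2 w b"
      using complete_triple[OF core_complete[OF smooth] card u] det_vw by (metis zero_less_one)
    \<comment> \<open>The tie-breaking form \<open>det2 (- u)\<close> is smaller at \<open>u\<close> than at
      \<open>v\<close>.\<close>
    have "det2 (- w) (- u) \<noteq> 0" using det_vw det2_swap[of w u] by simp
    then obtain z where z: "z \<in> core R" "0 < det2 (- w) z" "\<And>y. y \<in> R \<Longrightarrow> lex_le (- w) (- u) y z"
      using lex_max_in_core[OF smooth] by blast
    have "z = u" using z b by auto
    then have "lex_le (- w) (- u) v u" using z(3)[of v] rays by simp
    then show False using det_vw det2_swap[of w u] det2_swap[of w v] det2_swap[of u v]
      by (simp add: lex_le_def)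
  qed
  show "self_int R v \<le> - 2"
  proof (rule ccontr)
    assume "\<not> ?thesis"
    then have "v \<in> core R" using rays by (simp add: core_def)
    then obtain b where b: "core R = {v, u, b}" "0 < det2 b v"
      using complete_triple[OF core_complete[OF smooth] card _ u] det_vw by (metis zero_less_one)
    have "det2 v u \<noteq> 0" using det_vw by simp
    then obtain z where z: "z \<in> core R" "0 < det2 v z" "\<And>y. y \<in> R \<Longrightarrow> lex_le v u y z"
      using lex_max_in_core[OF smooth] by blast
    have "z = u" using z b det2_swap[of v b] by auto
    then have "lex_le v u w u" using z(3)[of w] rays by simp
    then show False using det_vw by (simp add: lex_le_def)
  qed
qed

text \<open>
  Contracting \<open>u\<close> raises the self-intersection of \<open>v\<close> and \<open>w\<close> by one.  As one of them
  stays below \<open>-1\<close>, only the other can enter the core, while \<open>u\<close> leaves it; since the core never has fewer than three elements, one of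
  them does enter, with self-intersection exactly \<open>-1\<close>.
\<close>

lemma rank_one_contraction:
  assumes R: "rank_one_resolution R" and con: "contraction R u v w"
    and low: "self_int R v \<le> - 3 \<or> self_int R w \<le> - 3"
  shows "rank_one_resolution (R - {u})" "\<exists>z. minus_one_curve (R - {u}) z"
proof -
  interpret contraction R u v w by fact
  have le: "self_int R v \<le> - 2" "self_int R w \<le> - 2" using minus_one_neighbours[OF R con] .
  have card: "card (core R) = 3" using R by (simp add: rank_one_resolution_def)
  have fin: "finite (core R)" using card card.infinite by fastforce
  have u: "u \<in> core R" using rays self_int_u by (simp add: core_def)
  obtain z where z: "z \<in> {v, w}" "core (R - {u}) \<subseteq> insert z (core R - {u})"
  proof (cases "self_int R v \<le> - 3")
    case True
    have "y = w \<or> y \<in> core R - {u}" if "y \<in> core (R - {u})" for y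
      using that True self_int_contraction[of y] by (auto simp: core_def split: if_splits)
    then show ?thesis by (intro that[of w]) auto
  next
    case False
    then have "self_int R w \<le> - 3" using low by simp
    then have "y = v \<or> y \<in> core R - {u}" if "y \<in> core (R - {u})" for y
      using that self_int_contraction[of y] by (auto simp: core_def split: if_splits)
    then show ?thesis by (intro that[of v]) auto
  qed
  have zc: "z \<notin> core R" using z(1) le by (auto simp: core_def)
  then have c3: "card (insert z (core R - {u})) = 3" using card u fin by simp
  have ge: "3 \<le> card (core (R - {u}))"
    using complete_fan_card[OF core_complete[OF smooth_contraction]] .
  have eq: "core (R - {u}) = insert z (core R - {u})"
    by (rule card_seteq) (use z fin c3 ge in auto)
  then show "rank_one_resolution (R - {u})"
    using c3 smooth_contraction by (simp add: rank_one_resolution_def)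
  have "z \<in> core (R - {u})" using eq by blast
  then have "self_int (R - {u}) z = - 1"
    using self_int_contraction[of z] z(1) le by (auto simp: core_def split: if_splits)
  then show "\<exists>z. minus_one_curve (R - {u}) z"
    using \<open>z \<in> core (R - {u})\<close> by (auto simp: minus_one_curve_def core_def)
qed

section \<open>Resolutions without (-1)-curves\<close>

text \<open>
  If \<open>u\<close> has positive self-intersection, then \<open>w\<close> and \<open>v\<close> enclose an angle below \<open>180\<close> degrees, and all
  rays except \<open>u\<close> lie in their cone; \<open>det2 (w - v)\<close> is positive on that cone.
\<close>

lemma positive_curve_support:
  assumes R: "smooth_fan R" and vuw: "max_cone R v u" "max_cone R u w"
    and pos: "0 < self_int R u" and z: "z \<in> R" "z \<noteq> u"
  shows "0 < det2 (w - v) z"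
proof -
  note C = smooth_fanD(1)[OF R] and prim = complete_fanD(2)[OF smooth_fanD(1)[OF R]]
  define m where "m = self_int R u"
  have m: "0 < m" using pos by (simp add: m_def)
  have dets: "det2 v u = 1" "det2 u w = 1" using smooth_fanD(2)[OF R] vuw by auto
  have wv: "det2 w v = m"
    using self_int_det[OF R vuw, of w] dets det2_swap[of w u] by (simp add: m_def)
  have uR: "u \<in> R" using vuw max_coneD by blast
  consider "0 < det2 u z" | "0 < det2 z u" | "det2 u z = 0" using det2_swap[of z u] by linarith
  then show ?thesis
  proof cases
    case 1
    have "0 \<le> det2 w z" using succ_closest[OF C vuw(2) z(1) 1] .
    moreover have "z = smul (det2 u z) w - smul (det2 w z) u"
      by (rule vec_eq_if_dets_eq[of u w]) (use dets det2_swap[of w u] in auto)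
    then have "det2 (w - v) z = det2 (w - v) (smul (det2 u z) w - smul (det2 w z) u)" by simp
    then have "det2 (w - v) z = m * det2 u z + 2 * det2 w z"
      using dets wv det2_swap[of v w] det2_swap[of w u] by (simp add: algebra_simps)
    moreover have "0 < m * det2 u z" using m 1 by simp
    ultimately show ?thesis by linarith
  next
    case 2
    have "0 \<le> det2 z v" using pred_closest[OF C vuw(1) z(1) 2] .
    moreover have "z = smul (det2 z u) v - smul (det2 z v) u"
      by (rule vec_eq_if_dets_eq[of v u])
        (use dets det2_swap[of u v] det2_swap[of z v] det2_swap[of z u] in auto)
    then have "det2 (w - v) z = det2 (w - v) (smul (det2 z u) v - smul (det2 z v) u)" by simp
    then have "det2 (w - v) z = m * det2 z u + 2 * det2 z v"
      using dets wv det2_swap[of v w] det2_swap[of w u] by (simp add: algebra_simps)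
    moreover have "0 < m * det2 z u" using m 2 by simp
    ultimately show ?thesis by linarith
  next
    case 3
    then have "z = - u" using collinear_primitive_cases[of u z] prim uR z by blast
    then show ?thesis using dets det2_swap[of w u] by simp
  qed
qed

text \<open>
  A ray in the interior of a strictly convex cone that contains both its neighbours has negative
  self-intersection.
\<close>

lemma positive_curve_core:
  assumes R: "smooth_fan R" and vuw: "max_cone R v u" "max_cone R u w" and pos: "0 < self_int R u"
    and z: "z \<in> R" "0 \<le> self_int R z"
  shows "z \<in> {u, v, w}"
proof (rule ccontr)
  assume nz: "z \<notin> {u, v, w}"
  note C = smooth_fanD(1)[OF R]
  obtain p q where pq: "max_cone R p z" "max_cone R z q" using neighbours_exist[OF R z(1)] .
  have "p \<noteq> u" "q \<noteq> u" using pq vuw succ_unique[OF C] pred_unique[OF C] nz by blast+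
  then have "0 < det2 (w - v) p" "0 < det2 (w - v) q" "0 < det2 (w - v) z"
    using positive_curve_support[OF R vuw pos] pq max_coneD nz by blast+
  then have "0 < - self_int R z * det2 (w - v) z"
    using self_int_det[OF R pq, of "w - v"] by linarith
  then show False using z(2) \<open>0 < det2 (w - v) z\<close> by (simp add: mult_less_0_iff)
qed

lemma toric_iso_P11:
  assumes "det2 u w = 1" "v + w + smul m u = 0"
  shows "toric_iso {u, v, w} (P11 m)"
proof -
  define f where "f z = (det2 u z, det2 z w)" for z
  define g where "g y = smul (fst y) w + smul (snd y) u" for y :: vec
  have "f (g y) = y" for y using assms det2_swap[of w u] by (simp add: f_def g_def)
  moreover have "g (f z) = z" for z
    by (rule vec_eq_if_dets_eq[of u w])
      (use assms det2_swap[of w u] det2_swap[of z w] in \<open>auto simp: f_def g_def\<close>)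
  ultimately have "bij f" by (metis bijI')
  moreover have "f (y + z) = f y + f z" for y z by (simp add: f_def)
  moreover have "v = - w - smul m u" using assms(2) by (simp add: eq_neg_iff_add_eq_0 algebra_simps)
  then have "f v = (- 1, - m)" "f u = (0, 1)" "f w = (1, 0)"
    using assms(1) by (simp_all add: f_def)
  then have "f ` {u, v, w} = P11 m" by (auto simp: P11_def)
  ultimately show ?thesis unfolding toric_iso_def by blast
qed

text \<open>
  Suppose that all core curves have self-intersection zero.  The neighbours of a core ray \<open>u\<close> are then
  opposite vectors \<open>v\<close> and \<open>w = -v\<close>.  A core ray \<open>b\<close> beyond the line through them has opposite
  neighbours too, which can only be \<open>v\<close> and \<open>w\<close>.  The self-intersections of \<open>v\<close> and \<open>w\<close>
  have sum zero, so both of them vanish, since neither can be positive, and the core contains four rays.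
\<close>

lemma not_all_core_zero:
  assumes R: "rank_one_resolution R" and zero: "\<And>z. z \<in> core R \<Longrightarrow> self_int R z = 0"
  shows False
proof -
  note S = rank_one_resolution_core(1)[OF R]
  note C = smooth_fanD(1)[OF S] and prim = complete_fanD(2)[OF smooth_fanD(1)[OF S]]
  have card: "card (core R) = 3" using R by (simp add: rank_one_resolution_def)
  then obtain u where u: "u \<in> core R" by fastforce
  then have uR: "u \<in> R" using core_subset by blast
  obtain v w where vuw: "max_cone R v u" "max_cone R u w" using neighbours_exist[OF S uR] .
  have vw: "v = - w" using self_int_rel[OF S vuw] zero[OF u] by (simp add: eq_neg_iff_add_eq_0)
  have wR: "w \<in> R" "v \<in> R" using vuw max_coneD by blast+
  have "w \<noteq> 0" using vuw(2) max_coneD(3) by fastforce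
  then obtain b where b: "b \<in> core R" "0 < det2 w b"
    using complete_fanD(3)[OF core_complete[OF S]] by blast
  then have bR: "b \<in> R" using core_subset by blast
  obtain p q where pq: "max_cone R p b" "max_cone R b q" using neighbours_exist[OF S bR] .
  have pq_eq: "p = - q" using self_int_rel[OF S pq] zero[OF b(1)] by (simp add: eq_neg_iff_add_eq_0)
  have "0 < det2 b v" using b(2) det2_swap[of b w] vw by simp
  then have "0 \<le> det2 q v" using succ_closest[OF C pq(2) wR(2)] by blast
  moreover have "0 \<le> det2 w p" using pred_closest[OF C pq(1) wR(1) b(2)] .
  ultimately have "det2 w p = 0" using vw pq_eq det2_swap[of q w] by simp
  moreover have "0 < det2 (- b) w" "0 < det2 (- b) p"
    using b(2) max_coneD(3)[OF pq(1)] det2_swap[of b w] det2_swap[of b p] by auto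
  ultimately have "p = w" using same_ray[of w p "- b"] prim wR max_coneD(1)[OF pq(1)] by simp
  then have wb: "max_cone R w b" and bv: "max_cone R b v" using pq pq_eq vw by auto
  have "self_int R w = - self_int R v"
  proof -
    have "smul (self_int R w) w = smul (self_int R v) v"
      using self_int_rel[OF S vuw(2) wb] self_int_rel[OF S bv vuw(1)] by (metis add.commute add_left_cancel)
    then have "smul (self_int R w + self_int R v) w = 0"
      unfolding vw by (auto simp: smul_def prod_eq_iff algebra_simps)
    then have "self_int R w + self_int R v = 0" using \<open>w \<noteq> 0\<close> by (auto simp: smul_def prod_eq_iff)
    then show ?thesis by simp
  qed
  then have "w \<in> core R \<or> v \<in> core R" using wR by (auto simp: core_def)
  then have "self_int R w = 0 \<and> self_int R v = 0" using zero[of w] zero[of v] \<open>self_int R w = - self_int R v\<close> by auto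
  then have sub: "{u, w, b, v} \<subseteq> core R" using u b wR by (simp add: core_def)
  have "w \<noteq> v" using vw \<open>w \<noteq> 0\<close> by (auto simp: prod_eq_iff)
  moreover have "u \<noteq> b" using b(2) max_coneD(3)[OF vuw(2)] det2_swap[of w u] by auto
  ultimately have "card {u, w, b, v} = 4"
    using max_cone_neq[OF vuw(1)] max_cone_neq[OF vuw(2)] max_cone_neq[OF wb] max_cone_neq[OF bv] by simp
  moreover have "finite (core R)" using card card.infinite by fastforce
  ultimately show False using card_mono[OF _ sub] card by simp
qed

lemma no_minus_one_curve_P11:
  assumes R: "rank_one_resolution R" and no: "\<And>z. \<not> minus_one_curve R z"
  shows "\<exists>n\<ge>1. toric_iso (core R) (P11 n)"
proof -
  note S = rank_one_resolution_core(1)[OF R]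
  have card: "card (core R) = 3" using R by (simp add: rank_one_resolution_def)
  have nonneg: "0 \<le> self_int R z" if "z \<in> core R" for z
    using no[of z] that by (force simp: core_def minus_one_curve_def)
  obtain u where u: "u \<in> core R" "self_int R u \<noteq> 0" using not_all_core_zero[OF R] by blast
  then have uR: "u \<in> R" and pos: "0 < self_int R u" using nonneg[of u] core_subset by auto
  obtain v w where vuw: "max_cone R v u" "max_cone R u w" using neighbours_exist[OF S uR] .
  have "core R \<subseteq> {u, v, w}"
    using positive_curve_core[OF S vuw pos] nonneg core_subset by blast
  moreover have "card {u, v, w} \<le> 3" by (simp add: card_insert_if)
  ultimately have "core R = {u, v, w}" using card card_seteq[of "{u, v, w}" "core R"] by simp
  moreover have "toric_iso {u, v, w} (P11 (self_int R u))"
    using toric_iso_P11 smooth_fanD(2)[OF S vuw(2)] self_int_rel[OF S vuw] by blast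
  ultimately show ?thesis using pos by (intro exI[of _ "self_int R u"]) auto
qed

section \<open>Cycles of curves\<close>

text \<open>
  Automorphisms of the lattice have determinant \<open>\<plusminus>1\<close>.
\<close>

lemma additive_bij_det:
  fixes f :: "vec \<Rightarrow> vec"
  assumes "bij f" and add: "\<And>x y. f (x + y) = f x + f y"
  obtains e :: int where "e = 1 \<or> e = - 1" "\<And>x y. det2 (f x) (f y) = e * det2 x y"
proof -
  have f0: "f 0 = 0" using add[of 0 0] by simp
  have neg: "f (- x) = - f x" for x using add[of x "- x"] f0 by (simp add: eq_neg_iff_add_eq_0 add.commute)
  have nat: "f (smul (int n) x) = smul (int n) (f x)" for n x
  proof (induction n)
    case (Suc n)
    have "smul (int (Suc n)) y = smul (int n) y + y" for y by (simp add: smul_def prod_eq_iff algebra_simps)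
    then show ?case using Suc add by simp
  qed (simp add: f0)
  have smul: "f (smul k x) = smul k (f x)" for k x
  proof (cases "0 \<le> k")
    case True
    then show ?thesis using nat[of "nat k"] by simp
  next
    case False
    then show ?thesis using nat[of "nat (- k)" x] neg[of "smul (- k) x"] by simp
  qed
  define e where "e = det2 (f (1, 0)) (f (0, 1))"
  have fx: "f x = smul (fst x) (f (1, 0)) + smul (snd x) (f (0, 1))" for x
  proof -
    have "x = smul (fst x) (1, 0) + smul (snd x) (0, 1)" by (simp add: smul_def prod_eq_iff)
    then have "f x = f (smul (fst x) (1, 0) + smul (snd x) (0, 1))" by simp
    then show ?thesis by (simp add: add smul)
  qed
  have det: "det2 (f x) (f y) = e * det2 x y" for x y
    unfolding fx[of x] fx[of y] using det2_swap[of "f (0, 1)" "f (1, 0)"]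
    by (simp add: e_def det2_def[of x y] algebra_simps)
  obtain a b where "f a = (1, 0)" "f b = (0, 1)" using assms(1) by (metis bij_pointE)
  then have "e * det2 a b = 1" using det[of a b] by (simp add: det2_def)
  then have "e = 1 \<or> e = - 1" using zmult_eq_1_iff by blast
  then show ?thesis using that det by blast
qed

lemma additive_bij_max_cone:
  assumes "bij f" "e = 1 \<or> e = (- 1 :: int)" "\<And>x y. det2 (f x) (f y) = e * det2 x y"
  shows "max_cone (f ` R) (f u) (f w) \<longleftrightarrow> (if e = 1 then max_cone R u w else max_cone R w u)"
proof -
  have inj: "f x \<in> f ` R \<longleftrightarrow> x \<in> R" for x using assms(1) by (auto simp: bij_def inj_def)
  from assms(2) show ?thesis
  proof
    assume "e = 1"
    then show ?thesis unfolding max_cone_def by (simp add: inj assms(3))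
  next
    assume e: "e = - 1"
    have "det2 (f x) (f y) = det2 y x" for x y using assms(3) e det2_swap[of y x] by simp
    then show ?thesis unfolding max_cone_def using e by (auto simp: inj)
  qed
qed

lemma additive_bij_smooth:
  assumes bij: "bij f" and e: "e = 1 \<or> e = (- 1 :: int)" "\<And>x y. det2 (f x) (f y) = e * det2 x y"
    and R: "smooth_fan R"
  shows "smooth_fan (f ` R)"
proof -
  note C = smooth_fanD(1)[OF R]
  have ee: "e * e = 1" using e(1) by auto
  have surj: "\<exists>y. x = f y" for x using bij by (metis bij_pointE)
  have "f 0 = 0"
  proof -
    obtain a b where "f a = (1, 0)" "f b = (0, 1)" using bij by (metis bij_pointE)
    then show ?thesis using e(2)[of a 0] e(2)[of b 0] by (simp add: det2_def prod_eq_iff)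
  qed
  have "primitive (f u)" if u: "u \<in> R" for u
  proof -
    obtain w where "det2 w u = 1" using complete_fanD(2)[OF C u] primitive_iff_bezout by blast
    then have "det2 (smul e (f w)) (f u) = 1" using ee e(2) by simp
    then show ?thesis using primitive_iff_bezout by blast
  qed
  moreover have "\<exists>u\<in>f ` R. 0 < det2 x u" if "x \<noteq> 0" for x
  proof -
    obtain y where y: "x = f y" using surj by blast
    have "smul e y \<noteq> 0" using that y \<open>f 0 = 0\<close> e(1) by auto
    then obtain u where "u \<in> R" "0 < det2 (smul e y) u" using complete_fanD(3)[OF C] by blast
    then show ?thesis using y e(2) by (intro bexI[of _ "f u"]) auto
  qed
  ultimately have "complete_fan (f ` R)" using complete_fanD(1)[OF C] by (auto simp: complete_fan_iff)
  moreover have "det2 x y = 1" if xy: "max_cone (f ` R) x y" for x y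
  proof -
    obtain u w where uw: "x = f u" "y = f w" using surj by metis
    then have "if e = 1 then max_cone R u w else max_cone R w u"
      using xy additive_bij_max_cone[OF bij e] by blast
    then have "if e = 1 then det2 u w = 1 else det2 w u = 1" using smooth_fanD(2)[OF R] by (auto split: if_splits)
    then show ?thesis using e uw det2_swap[of u w] by (auto split: if_splits)
  qed
  ultimately show ?thesis by (simp add: smooth_fan_def)
qed

lemma additive_bij_self_int:
  assumes bij: "bij f" and add: "\<And>x y. f (x + y) = f x + f y"
    and e: "e = 1 \<or> e = (- 1 :: int)" "\<And>x y. det2 (f x) (f y) = e * det2 x y"
    and R: "smooth_fan R" and u: "u \<in> R"
  shows "self_int (f ` R) (f u) = self_int R u"
proof -
  obtain v w where vw: "max_cone R v u" "max_cone R u w" using neighbours_exist[OF R u] .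
  have fR: "smooth_fan (f ` R)" using additive_bij_smooth[OF bij e R] .
  let ?d = "self_int R u"
  have "f v + f w + smul ?d (f u) = 0"
  proof -
    have *: "det2 x (f v + f w + smul ?d (f u)) = 0" for x
    proof -
      obtain y where y: "x = f y" using bij by (metis bij_pointE)
      have "det2 x (f v + f w + smul ?d (f u)) = e * det2 y (v + w + smul ?d u)"
        unfolding y by (simp add: e(2) algebra_simps)
      then show ?thesis using self_int_rel[OF R vw] by simp
    qed
    show ?thesis
      by (rule vec_eq_if_dets_eq[of "(1, 0)" "(0, 1)"]) (unfold *, simp_all add: det2_def)
  qed
  moreover have "max_cone (f ` R) (f v) (f u) \<and> max_cone (f ` R) (f u) (f w) \<or>
      max_cone (f ` R) (f w) (f u) \<and> max_cone (f ` R) (f u) (f v)"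
    using additive_bij_max_cone[OF bij e] vw by (auto split: if_splits)
  ultimately show ?thesis using self_int_eqI[OF fR] by (metis add.commute)
qed

definition cyclic_chain :: "(vec \<Rightarrow> vec \<Rightarrow> bool) \<Rightarrow> vec list \<Rightarrow> bool" where
  "cyclic_chain P us \<longleftrightarrow> (\<forall>i<length us. P (us ! i) (us ! (Suc i mod length us)))"

lemma cyclic_chain_iff_successively:
  assumes "us \<noteq> []"
  shows "cyclic_chain P us \<longleftrightarrow> successively P (us @ [hd us])"
proof -
  have "(us @ [hd us]) ! Suc i = us ! (Suc i mod length us)" if "i < length us" for i
    using that assms by (cases "Suc i = length us") (auto simp: nth_append hd_conv_nth)
  then show ?thesis unfolding cyclic_chain_def successively_conv_nth by (simp add: nth_append)
qed

text \<open>
  The cycle of curves without a choice of orientation, because isomorphisms may reverse it.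
\<close>

definition ring_of_curves :: "vec set \<Rightarrow> vec list \<Rightarrow> bool" where
  "ring_of_curves R us \<longleftrightarrow> smooth_fan R \<and> distinct us \<and> set us = R \<and>
     (cyclic_chain (max_cone R) us \<or> cyclic_chain (\<lambda>u w. max_cone R w u) us)"

lemma ring_of_curvesI:
  assumes "smooth_fan R" "distinct us" "R = set us" "us \<noteq> []"
    "successively (max_cone R) (us @ [hd us]) \<or> successively (\<lambda>u w. max_cone R w u) (us @ [hd us])"
  shows "ring_of_curves R us"
  using assms(5) unfolding ring_of_curves_def
  by (simp only: assms(1,2) assms(3)[symmetric] cyclic_chain_iff_successively[OF assms(4)] simp_thms)

lemma ring_of_curves_image:
  assumes f: "bij f" "\<And>x y. f (x + y) = f x + f y" and us: "ring_of_curves R us"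
  shows "ring_of_curves (f ` R) (map f us)" "map (self_int (f ` R)) (map f us) = map (self_int R) us"
    "cyclic_chain (max_cone (f ` R)) (map f us) \<longleftrightarrow>
      (if \<forall>x y. det2 (f x) (f y) = det2 x y then cyclic_chain (max_cone R) us
       else cyclic_chain (\<lambda>u w. max_cone R w u) us)"
proof -
  obtain e where e: "e = 1 \<or> e = - 1" "\<And>x y. det2 (f x) (f y) = e * det2 x y"
    using additive_bij_det[OF f] by blast
  have R: "smooth_fan R" and set: "set us = R" "distinct us" using us by (auto simp: ring_of_curves_def)
  have e1: "(\<forall>x y. det2 (f x) (f y) = det2 x y) \<longleftrightarrow> e = 1"
  proof -
    have "det2 (1, 0) (0, 1) = 1" by (simp add: det2_def)
    then show ?thesis using e by (metis mult_1 mult.right_neutral)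
  qed
  have mc: "max_cone (f ` R) (f u) (f w) \<longleftrightarrow> (if e = 1 then max_cone R u w else max_cone R w u)" for u w
    using additive_bij_max_cone[OF f(1) e] .
  have idx: "Suc i mod length us < length us" if "i < length us" for i
    using that by (intro mod_less_divisor) linarith
  have cc: "cyclic_chain (max_cone (f ` R)) (map f us) \<longleftrightarrow>
      (if e = 1 then cyclic_chain (max_cone R) us else cyclic_chain (\<lambda>u w. max_cone R w u) us)"
    "cyclic_chain (\<lambda>u w. max_cone (f ` R) w u) (map f us) \<longleftrightarrow>
      (if e = 1 then cyclic_chain (\<lambda>u w. max_cone R w u) us else cyclic_chain (max_cone R) us)"
    unfolding cyclic_chain_def by (simp_all add: mc idx)
  show "cyclic_chain (max_cone (f ` R)) (map f us) \<longleftrightarrow>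
      (if \<forall>x y. det2 (f x) (f y) = det2 x y then cyclic_chain (max_cone R) us
       else cyclic_chain (\<lambda>u w. max_cone R w u) us)"
    using cc e1 by simp
  have "distinct (map f us)" using set f(1) by (simp add: distinct_map bij_def inj_on_def)
  moreover have "set (map f us) = f ` R" using set by simp
  ultimately show "ring_of_curves (f ` R) (map f us)"
    using us cc additive_bij_smooth[OF f(1) e R] by (auto simp: ring_of_curves_def)
  show "map (self_int (f ` R)) (map f us) = map (self_int R) us"
    using additive_bij_self_int[OF f e R] set by auto
qed

text \<open>
  An isomorphism can be used to transport the list of rays, and a list that runs clockwise becomes
  counterclockwise after a reflection.
\<close>

lemma iso_to_cycle_iff:
  "iso_to_cycle R ds \<longleftrightarrow> (\<exists>us. ring_of_curves R us \<and> map (self_int R) us = ds)"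
proof
  assume "iso_to_cycle R ds"
  then obtain X f us where X: "smooth_fan X" "distinct us" "set us = X" "cyclic_chain (max_cone X) us"
    "map (self_int X) us = ds" and f: "bij f" "\<forall>x y. f (x + y) = f x + f y" "f ` R = X"
    unfolding iso_to_cycle_def has_cycle_def toric_iso_def cyclic_chain_def by blast
  define g where "g = inv f"
  have g: "bij g" using f(1) by (simp add: g_def bij_imp_bij_inv)
  have fg: "f (g x) = x" "g (f x) = x" for x
    using f(1) by (simp_all add: g_def bij_def surj_f_inv_f inv_f_f)
  have "g (x + y) = g x + g y" for x y by (metis f(2) fg)
  moreover have "ring_of_curves X us" using X by (simp add: ring_of_curves_def)
  moreover have "g ` X = R" unfolding f(3)[symmetric] image_image fg(2) by simp
  ultimately show "\<exists>us. ring_of_curves R us \<and> map (self_int R) us = ds"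
    using ring_of_curves_image[OF g] X(5) by metis
next
  assume "\<exists>us. ring_of_curves R us \<and> map (self_int R) us = ds"
  then obtain us where us: "ring_of_curves R us" "map (self_int R) us = ds" by blast
  have cyc: "has_cycle X ds"
    if "ring_of_curves X vs" "map (self_int X) vs = ds" "cyclic_chain (max_cone X) vs" for X vs
    using that unfolding has_cycle_def ring_of_curves_def cyclic_chain_def by blast
  show "iso_to_cycle R ds"
  proof (cases "cyclic_chain (max_cone R) us")
    case True
    moreover have "toric_iso R R" unfolding toric_iso_def by (rule exI[of _ id]) simp
    ultimately show ?thesis using cyc[OF us] unfolding iso_to_cycle_def by blast
  next
    case False
    define f :: "vec \<Rightarrow> vec" where "f x = (fst x, - snd x)" for x
    have "f (f x) = x" for x by (simp add: f_def)
    then have f: "bij f" "\<And>x y. f (x + y) = f x + f y" by (metis bijI') (simp add: f_def)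
    have "det2 (f (1, 0)) (f (0, 1)) \<noteq> det2 (1, 0) (0, 1)" by (simp add: f_def det2_def)
    then have "cyclic_chain (max_cone (f ` R)) (map f us)"
      using ring_of_curves_image(3)[OF f us(1)] us(1) False by (auto simp: ring_of_curves_def)
    moreover have "toric_iso R (f ` R)" unfolding toric_iso_def using f by blast
    ultimately show ?thesis
      using cyc ring_of_curves_image(1,2)[OF f us(1)] us(2) unfolding iso_to_cycle_def by metis
  qed
qed

lemma min_res_is_iff:
  assumes "minimal_resolution T T'"
  shows "min_res_is T ds \<longleftrightarrow> (\<exists>us. ring_of_curves T' us \<and> map (self_int T') us = ds)"
  using assms minimal_resolution_unique unfolding min_res_is_def iso_to_cycle_iff by metis

section \<open>Basic surfaces\<close>

lemma succ_step:
  assumes "complete_fan R" "max_cone R a b" "z \<in> R" "0 < det2 a z"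
  shows "z = b \<or> 0 < det2 b z"
proof (cases "det2 b z = 0")
  case True
  then show ?thesis
    using same_ray[of b z a] assms complete_fanD(2)[OF assms(1)] max_coneD[OF assms(2)] by auto
next
  case False
  then show ?thesis using succ_closest[OF assms] by simp
qed

text \<open>
  The relations at \<open>v\<close> and \<open>w\<close> show that the rays next to this chain are \<open>x = v - w\<close> and \<open>-x\<close>.  So
  \<open>det2 x\<close> is a \<open>\<P>\<^sup>1\<close>-fibration with sections \<open>x, -x\<close>, and the chain is the whole fiber over one of
  the two fixed points; the rays with \<open>det2 x z < 0\<close> form the other fiber, with multiplicities
  \<open>- det2 x z\<close>.
\<close>

locale I0_fibre = contraction +
  assumes self_int_v: "self_int R v = - 2" and self_int_w: "self_int R w = - 2"
begin

lemmas C = smooth_fanD(1)[OF smooth]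
lemmas prim = complete_fanD(2)[OF C]
lemmas cone1 = smooth_fanD(2)[OF smooth]

definition x where "x = v - w"

lemma xv: "max_cone R x v"
proof -
  obtain y where y: "max_cone R y v" using pred_exists[OF C] rays by blast
  then have "y + u + smul (- 2) v = 0" using self_int_rel[OF smooth y vu] self_int_v by simp
  then have "y = x" by (simp add: x_def u_eq smul_def prod_eq_iff)
  then show ?thesis using y by simp
qed

lemma wx: "max_cone R w (- x)"
proof -
  obtain y where y: "max_cone R w y" using succ_exists[OF C] rays by blast
  then have "u + y + smul (- 2) w = 0" using self_int_rel[OF smooth uw y] self_int_w by simp
  then have "y = - x" by (simp add: x_def u_eq smul_def prod_eq_iff)
  then show ?thesis using y by simp
qed

lemma x_rays: "x \<in> R" "- x \<in> R"
  using xv wx max_coneD by blast+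

lemma x_det: "det2 x v = 1" "det2 x w = 1" "det2 x u = 2" "det2 v x = - 1" "x \<noteq> - x"
proof -
  show *: "det2 x v = 1" "det2 x w = 1" "det2 x u = 2" "det2 v x = - 1"
    using det_vw det2_swap[of w v] det2_swap[of w u] by (simp_all add: x_def u_eq)
  show "x \<noteq> - x" using * by (auto simp: prod_eq_iff det2_def)
qed

lemma horizontal: "z \<in> R \<Longrightarrow> det2 x z = 0 \<Longrightarrow> z = x \<or> z = - x"
  using collinear_primitive_cases prim x_rays by blast

lemma upper: "z \<in> R \<Longrightarrow> 0 < det2 x z \<Longrightarrow> z \<in> {v, u, w}"
  using succ_step[OF C xv] succ_step[OF C vu] succ_step[OF C uw] succ_step[OF C wx] by fastforce

lemma ray_cases:
  assumes "z \<in> R"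
  obtains "z \<in> {x, v, u, w, - x}" | "det2 x z < 0"
  using upper[OF assms] horizontal[OF assms] by (cases "det2 x z" "0 :: int" rule: linorder_cases) blast+

lemma neq_by_det: "det2 x y \<noteq> det2 x z \<Longrightarrow> y \<noteq> z"
  by blast

definition a where "a = self_int R x"
definition b where "b = self_int R (- x)"

text \<open>
  The components \<open>g, h\<close> of the lower fiber that meet the sections are both reduced, and they differ by a
  multiple of \<open>x\<close> that records the sum \<open>a + b\<close> of the self-intersections of the sections.
\<close>

lemma lower_ends:
  assumes "max_cone R (- x) g" "max_cone R h x"
  shows "g = smul b x - w" "h = - v - smul a x" "det2 x g = - 1" "det2 x h = - 1"
    "det2 g x = 1" "h = g - smul (1 + a + b) x"
proof -
  have rel: "h + v + smul a x = 0" "w + g + smul b (- x) = 0"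
    using self_int_rel[OF smooth assms(2) xv] self_int_rel[OF smooth wx assms(1)]
    by (simp_all add: a_def b_def)
  show g: "g = smul b x - w" and h: "h = - v - smul a x"
    using rel by (simp_all add: smul_def prod_eq_iff)
  show "det2 x g = - 1" "det2 x h = - 1" "det2 g x = 1"
    using x_det det2_swap[of x w] by (simp_all add: g h)
  show "h = g - smul (1 + a + b) x" by (simp add: g h x_def smul_def prod_eq_iff algebra_simps)
qed

lemma pred_in_lower:
  assumes "max_cone R p z" "det2 x z < 0"
  shows "p = - x \<or> det2 x p < 0"
proof -
  have "0 \<le> det2 (- x) p" using pred_closest[OF C assms(1) x_rays(2)] assms(2) by simp
  moreover have "p \<noteq> x" using assms max_coneD(3)[OF assms(1)] by auto
  moreover have "p \<in> R" using assms max_coneD by blast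
  ultimately show ?thesis using horizontal[of p] by force
qed

lemma succ_in_lower:
  assumes "max_cone R z s" "det2 x z < 0"
  shows "s = x \<or> det2 x s < 0"
proof -
  have "0 \<le> det2 s x" using succ_closest[OF C assms(1) x_rays(1)] assms(2) det2_swap[of z x] by simp
  moreover have "s \<noteq> - x" using assms max_coneD(3)[OF assms(1)] det2_swap[of z x] by auto
  moreover have "s \<in> R" using assms max_coneD by blast
  ultimately show ?thesis using horizontal[of s] det2_swap[of s x] by force
qed

end

text \<open>
  On a basic surface the neighbours of a \<open>(-1)\<close>-curve have self-intersection at least \<open>-2\<close>, hence equal
  to \<open>-2\<close> by \<open>minus_one_neighbours\<close>.
\<close>

locale basic_fibre = I0_fibre +
  assumes card_core: "card (core R) = 3"
    and basic_curves: "\<And>u' v' w'. contraction R u' v' w' \<Longrightarrow> self_int R v' = - 2 \<and> self_int R w' = - 2"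
begin

text \<open>
  Otherwise \<open>x, -x, u, g\<close> would be four elements of the core.
\<close>

lemma sections:
  assumes "g \<in> R" "- 1 \<le> self_int R g" "det2 x g < 0"
  shows "a \<le> - 2 \<or> b \<le> - 2"
proof (rule ccontr)
  assume "\<not> ?thesis"
  then have sub: "{x, - x, u, g} \<subseteq> core R"
    using assms x_rays rays(1) self_int_u by (auto simp: core_def a_def b_def)
  have "distinct [x, - x, u, g]" using x_det(5) assms(3) by (simp add: neq_by_det x_det)
  then have "card {x, - x, u, g} = 4" using distinct_card by fastforce
  moreover have "finite (core R)" using card_core card.infinite by fastforce
  ultimately show False using card_mono[OF _ sub] card_core by simp
qed

lemma smooth_lower_fibre:
  assumes g: "max_cone R (- x) g" "max_cone R g x"
  shows "\<exists>n\<ge>2. min_res_is (core R) (std1 n)"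
proof -
  note L = lower_ends[OF g]
  have g0: "self_int R g = 0" by (rule self_int_eqI[OF smooth g]) simp
  have gR: "g \<in> R" using g max_coneD by blast
  \<comment> \<open>Both ends of the lower fiber are \<open>g\<close>, so the sections have self-intersection
    sum \<open>-1\<close>.\<close>
  have "smul (1 + a + b) x = 0" using L(6) by (simp add: smul_def prod_eq_iff)
  then have "1 + a + b = 0" using x_det by (auto simp: smul_def prod_eq_iff det2_def)
  then have ab: "b = - a - 1" by simp
  have "z = g" if "z \<in> R" "det2 x z < 0" for z
    using succ_step[OF C g(1), of z] succ_step[OF C g(2), of z] that by auto
  then have R_eq: "R = {g, x, v, u, w, - x}"
    using ray_cases gR x_rays rays by blast
  note chain = g xv vu uw wx
  have dist: "distinct [g, x, v, u, w, - x]" using x_det(5) rays(4) by (simp add: neq_by_det x_det L)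
  have ring1: "ring_of_curves R [g, x, v, u, w, - x]"
    by (rule ring_of_curvesI[OF smooth dist]) (simp_all add: R_eq[symmetric] chain)
  have dist': "distinct [g, - x, w, u, v, x]" and set': "R = set [g, - x, w, u, v, x]"
    using dist R_eq by auto
  have ring2: "ring_of_curves R [g, - x, w, u, v, x]"
    by (rule ring_of_curvesI[OF smooth dist' set']) (simp_all add: chain)
  note self_ints = g0 self_int_u self_int_v self_int_w a_def[symmetric] b_def[symmetric] ab
  have "a \<le> - 2 \<or> b \<le> - 2" using sections gR g0 L(3) by simp
  then show ?thesis
  proof
    assume "a \<le> - 2"
    moreover have "map (self_int R) [g, x, v, u, w, - x] = std1 (- a)"
      by (simp add: std1_def self_ints)
    ultimately show ?thesis
      using ring1 min_res_is_iff[OF minimal_resolution_of_core[OF smooth]] by (intro exI[of _ "- a"]) auto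
  next
    assume "b \<le> - 2"
    moreover have "map (self_int R) [g, - x, w, u, v, x] = std1 (- b)"
      by (simp add: std1_def self_ints)
    ultimately show ?thesis
      using ring2 min_res_is_iff[OF minimal_resolution_of_core[OF smooth]] by (intro exI[of _ "- b"]) auto
  qed
qed

lemma I0_lower_fibre:
  assumes r: "max_cone R (- x) r" "max_cone R r t" "max_cone R t s" "max_cone R s x"
    and selfs: "self_int R r = - 2" "self_int R t = - 1" "self_int R s = - 2"
  shows "\<exists>n\<ge>2. min_res_is (core R) (std2 n)"
proof -
  note L = lower_ends[OF r(1,4)]
  have inR: "r \<in> R" "t \<in> R" "s \<in> R" using r max_coneD by blast+
  have t_eq: "t = r + s" using self_int_rel[OF smooth r(2,3)] selfs by simp
  have "t + x + smul (- 2) s = 0" using self_int_rel[OF smooth r(3,4)] selfs by simp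
  then have "s = r + x" by (simp add: t_eq smul_def prod_eq_iff)
  then have "smul (2 + a + b) x = 0" using L(6) by (simp add: smul_def prod_eq_iff algebra_simps)
  then have "2 + a + b = 0" using x_det by (auto simp: smul_def prod_eq_iff det2_def)
  then have ab: "b = - a - 2" by simp
  have dt: "det2 x t = - 2" using L t_eq by simp
  have "z \<in> {r, t, s}" if "z \<in> R" "det2 x z < 0" for z
    using succ_step[OF C r(1), of z] succ_step[OF C r(2), of z] succ_step[OF C r(3), of z]
      succ_step[OF C r(4), of z] that by auto
  then have R_eq: "R = {s, x, v, u, w, - x, r, t}"
    using ray_cases inR x_rays rays by blast
  have r_ne_s: "s \<noteq> r" using \<open>s = r + x\<close> x_det by auto
  note chain = r xv vu uw wx
  have dist: "distinct [s, x, v, u, w, - x, r, t]"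
    using x_det(5) rays(4) r_ne_s by (simp add: neq_by_det x_det L dt)
  have ring1: "ring_of_curves R [s, x, v, u, w, - x, r, t]"
    by (rule ring_of_curvesI[OF smooth dist]) (simp_all add: R_eq[symmetric] chain)
  have dist': "distinct [r, - x, w, u, v, x, s, t]" and set': "R = set [r, - x, w, u, v, x, s, t]"
    using dist R_eq by auto
  have ring2: "ring_of_curves R [r, - x, w, u, v, x, s, t]"
    by (rule ring_of_curvesI[OF smooth dist' set']) (simp_all add: chain)
  note self_ints = selfs self_int_u self_int_v self_int_w a_def[symmetric] b_def[symmetric] ab
  have "a \<le> - 2 \<or> b \<le> - 2" using sections inR selfs dt by simp
  then show ?thesis
  proof
    assume "a \<le> - 2"
    moreover have "map (self_int R) [s, x, v, u, w, - x, r, t] = std2 (- a)"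
      by (simp add: std2_def self_ints)
    ultimately show ?thesis
      using ring1 min_res_is_iff[OF minimal_resolution_of_core[OF smooth]] by (intro exI[of _ "- a"]) auto
  next
    assume "b \<le> - 2"
    moreover have "map (self_int R) [r, - x, w, u, v, x, s, t] = std2 (- b)"
      by (simp add: std2_def self_ints)
    ultimately show ?thesis
      using ring2 min_res_is_iff[OF minimal_resolution_of_core[OF smooth]] by (intro exI[of _ "- b"]) auto
  qed
qed

text \<open>
  If all components are reduced, each is the preceding one plus \<open>x\<close>.  The two ends are then
  \<open>(-1)\<close>-curves, so the sections that they meet are \<open>(-2)\<close>-curves; the sum \<open>-4\<close> of their
  self-intersections means \<open>h = g + 3 x\<close>, and there are four components.
\<close>

lemma reduced_lower_fibre:
  assumes g: "max_cone R (- x) g" "max_cone R h x" and ne: "g \<noteq> h"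
    and reduced: "\<And>z. z \<in> R \<Longrightarrow> - 1 \<le> det2 x z"
  shows "min_res_is (core R) threeA2"
proof -
  note L = lower_ends[OF g]
  have next_eq: "s = z + x" if s: "max_cone R z s" "det2 x z = - 1" "z \<noteq> h" for z s
  proof -
    have "s \<noteq> x" using s(1,3) g(2) pred_unique[OF C] by blast
    then have "det2 x s < 0" using succ_in_lower[OF s(1)] s(2) by simp
    then have "det2 x s = - 1" using reduced[of s] max_coneD(2)[OF s(1)] by simp
    moreover have "det2 z s = 1" using cone1 s(1) by blast
    ultimately show ?thesis
      by (intro vec_eq_if_dets_eq[of x z]) (use s(2) det2_swap[of z x] in auto)
  qed
  obtain k where gk: "max_cone R g k" using succ_exists[OF C max_coneD(2)[OF g(1)]] by blast
  then have k: "k = g + x" using next_eq[OF gk L(3) ne] by simp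
  then have g1: "self_int R g = - 1" by (intro self_int_eqI[OF smooth g(1) gk]) simp
  obtain l where lh: "max_cone R l h" using pred_exists[OF C max_coneD(1)[OF g(2)]] by blast
  have "l \<noteq> - x" using lh g(1) succ_unique[OF C] ne by blast
  then have "det2 x l < 0" using pred_in_lower[OF lh] L(4) by simp
  then have "det2 x l = - 1" using reduced[of l] max_coneD(1)[OF lh] by simp
  then have l: "h = l + x" using next_eq[OF lh] max_cone_neq[OF lh] by blast
  then have h1: "self_int R h = - 1" by (intro self_int_eqI[OF smooth lh g(2)]) simp
  have cg: "contraction R g (- x) k" and ch: "contraction R h l x"
    using smooth g gk lh g1 h1 by (simp_all add: contraction_def)
  have "b = - 2" "a = - 2" "self_int R k = - 2" "self_int R l = - 2"
    using basic_curves[OF cg] basic_curves[OF ch] by (simp_all add: a_def b_def)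
  then have h: "h = g + smul 3 x" using L(6) by (simp add: smul_def prod_eq_iff)
  then have l': "l = k + x" using l k by (simp add: smul_def prod_eq_iff)
  have xn: "x \<noteq> 0" using x_det by auto
  have "k \<noteq> h" using k h xn by (auto simp: smul_def prod_eq_iff)
  then obtain m where km: "max_cone R k m" using succ_exists[OF C max_coneD(2)[OF gk]] by blast
  have dk: "det2 x k = - 1" using k L by simp
  have kl: "max_cone R k l" using next_eq[OF km dk \<open>k \<noteq> h\<close>] km l' by simp
  have inR: "g \<in> R" "k \<in> R" "l \<in> R" "h \<in> R" using g kl max_coneD by blast+
  have "z \<in> {g, k, l, h}" if "z \<in> R" "det2 x z < 0" for z
    using succ_step[OF C g(1), of z] succ_step[OF C gk, of z] succ_step[OF C kl, of z]
      succ_step[OF C lh, of z] succ_step[OF C g(2), of z] that by auto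
  then have R_eq: "R = {u, w, - x, g, k, l, h, x, v}"
    using ray_cases inR x_rays rays by blast
  have ne2: "g \<noteq> k" "g \<noteq> l" "k \<noteq> l" "l \<noteq> h"
    using k l' h xn by (auto simp: smul_def prod_eq_iff)
  note chain = g gk kl lh xv vu uw wx
  have dist: "distinct [u, w, - x, g, k, l, h, x, v]"
    using x_det(5)[symmetric] rays(4) ne2 ne \<open>k \<noteq> h\<close>
    by (simp add: neq_by_det x_det(1-4) L(3,4) dk \<open>det2 x l = - 1\<close>)
  have "ring_of_curves R [u, w, - x, g, k, l, h, x, v]"
    by (rule ring_of_curvesI[OF smooth dist]) (simp_all add: R_eq[symmetric] chain)
  moreover have "map (self_int R) [u, w, - x, g, k, l, h, x, v] = threeA2"
    using \<open>b = - 2\<close> \<open>a = - 2\<close> \<open>self_int R k = - 2\<close> \<open>self_int R l = - 2\<close> g1 h1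
      self_int_u self_int_v self_int_w by (simp add: threeA2_def a_def b_def)
  ultimately show ?thesis
    unfolding min_res_is_iff[OF minimal_resolution_of_core[OF smooth]] by blast
qed

text \<open>
  A component \<open>t\<close> of maximal multiplicity at least two does not meet the sections.  If its
  self-intersection were nonnegative, the linear form \<open>det2 x\<close> could not be negative at both neighbours.  So \<open>t\<close> is
  a \<open>(-1)\<close>-curve between two \<open>(-2)\<close>-curves, and such a chain fills the fiber.
\<close>

lemma nonreduced_lower_fibre:
  assumes t: "t \<in> core R" "det2 x t \<le> - 2"
  shows "\<exists>n\<ge>2. min_res_is (core R) (std2 n)"
proof -
  have tR: "t \<in> R" and ge: "- 1 \<le> self_int R t" using t(1) by (auto simp: core_def)
  obtain r s where rt: "max_cone R r t" and ts: "max_cone R t s" using neighbours_exist[OF smooth tR] .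
  have "r \<noteq> - x" using cone1[OF rt] t(2) by auto
  then have r: "det2 x r < 0" using pred_in_lower[OF rt] t(2) by simp
  have "s \<noteq> x" using cone1[OF ts] t(2) det2_swap[of t x] by auto
  then have s: "det2 x s < 0" using succ_in_lower[OF ts] t(2) by simp
  have "self_int R t = - 1"
  proof (rule ccontr)
    assume "self_int R t \<noteq> - 1"
    then have "0 \<le> - self_int R t * det2 x t" using ge t(2) by (simp add: mult_nonneg_nonpos)
    then show False using self_int_det[OF smooth rt ts, of x] r s by simp
  qed
  then have con: "contraction R t r s" using smooth rt ts by (simp add: contraction_def)
  then have rs: "self_int R r = - 2" "self_int R s = - 2" using basic_curves by blast+
  have t_eq: "t = r + s" using self_int_rel[OF smooth rt ts] \<open>self_int R t = - 1\<close> by simp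
  obtain y where yr: "max_cone R y r" using pred_exists[OF C] rt max_coneD by blast
  obtain y' where sy: "max_cone R s y'" using succ_exists[OF C] ts max_coneD by blast
  have "y + t + smul (- 2) r = 0" using self_int_rel[OF smooth yr rt] rs by simp
  then have y: "y = r - s" by (simp add: t_eq smul_def prod_eq_iff)
  have "t + y' + smul (- 2) s = 0" using self_int_rel[OF smooth ts sy] rs by simp
  then have y': "y' = s - r" by (simp add: t_eq smul_def prod_eq_iff)
  have "y' = - y" using y y' by simp
  then have "y = - x" using pred_in_lower[OF yr r] succ_in_lower[OF sy s] by (metis det2_simps(5) minus_minus neg_less_0_iff_less less_asym)
  then have "y' = x" using \<open>y' = - y\<close> by simp
  then show ?thesis
    using I0_lower_fibre[of r t s] yr rt ts sy \<open>y = - x\<close> rs \<open>self_int R t = - 1\<close> by simp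
qed

lemma classification:
  "(\<exists>n\<ge>2. min_res_is (core R) (std1 n)) \<or> (\<exists>n\<ge>2. min_res_is (core R) (std2 n)) \<or>
    min_res_is (core R) threeA2"
proof -
  have "det2 (- x) v \<noteq> 0" using x_det by simp
  \<comment> \<open>A component of maximal multiplicity in the lower fiber, which the maximum principle places
    in the core; \<open>v\<close> only serves to break ties.\<close>
  then obtain t where t: "t \<in> core R" "0 < det2 (- x) t" "\<And>y. y \<in> R \<Longrightarrow> lex_le (- x) v y t"
    using lex_max_in_core[OF smooth] by blast
  show ?thesis
  proof (cases "det2 x t \<le> - 2")
    case True
    then show ?thesis using nonreduced_lower_fibre[OF t(1)] by blast
  next
    case False
    then have reduced: "- 1 \<le> det2 x z" if "z \<in> R" for z
      using t(2) t(3)[OF that] by (auto simp: lex_le_def)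
    obtain g h where gh: "max_cone R (- x) g" "max_cone R h x"
      using succ_exists[OF C x_rays(2)] pred_exists[OF C x_rays(1)] by blast
    show ?thesis
    proof (cases "g = h")
      case True
      then show ?thesis using smooth_lower_fibre gh by blast
    next
      case False
      then show ?thesis using reduced_lower_fibre[OF gh] reduced by blast
    qed
  qed
qed

end

section \<open>Cascades\<close>

lemma cascadeE:
  assumes "admits_cascade S T"
  obtains t X X' where "X t = S" "X 0 = T" "basic T"
    "\<And>k. k \<le> t \<Longrightarrow> rank_one_resolution (X' k)" "\<And>k. k \<le> t \<Longrightarrow> X k = core (X' k)"
    "\<And>k. k < t \<Longrightarrow> \<exists>u. blow_down (X' (Suc k)) u (X' k)"
proof -
  obtain t :: nat and X X' where X: "X t = S" "X 0 = T" "basic T"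
    "\<forall>k\<le>t. toric_log_del_Pezzo (X k) \<and> picard_number (X k) = 1 \<and> minimal_resolution (X k) (X' k)"
    "\<forall>k\<in>{1..t}. \<exists>u. blow_down (X' k) u (X' (k - 1))"
    using assms unfolding admits_cascade_def by blast
  have r: "rank_one_resolution (X' k)" "X k = core (X' k)" if "k \<le> t" for k
    using rank_one_resolution_of[of "X k" "X' k"] X(4) that by auto
  have b: "\<exists>u. blow_down (X' (Suc k)) u (X' k)" if "k < t" for k
    using X(5)[rule_format, of "Suc k"] that by simp
  show ?thesis by (rule that[OF X(1-3) r b])
qed

lemma cascade_trivial:
  assumes "basic T"
  shows "admits_cascade T T"
proof -
  obtain T' where "minimal_resolution T T'" using assms by (auto simp: basic_def)
  then show ?thesis unfolding admits_cascade_def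
    using assms by (intro exI[of _ 0] exI[of _ "\<lambda>_. T"] exI[of _ "\<lambda>_. T'"]) (simp add: basic_def)
qed

text \<open>
  A cascade may be extended upwards because the minimal resolution at its top is unique, so that it
  is the given \<open>R1\<close>.
\<close>

lemma cascade_blow_up:
  assumes R: "rank_one_resolution R" and R1: "rank_one_resolution R1" and bd: "blow_down R u R1"
    and cas: "admits_cascade (core R1) T"
  shows "admits_cascade (core R) T"
proof -
  obtain t :: nat and X X' where X: "X t = core R1" "X 0 = T" "basic T"
    "\<forall>k\<le>t. toric_log_del_Pezzo (X k) \<and> picard_number (X k) = 1 \<and> minimal_resolution (X k) (X' k)"
    "\<forall>k\<in>{1..t}. \<exists>u. blow_down (X' k) u (X' (k - 1))"
    using cas unfolding admits_cascade_def by blast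
  have "minimal_resolution (core R1) (X' t)" using X(1,4) by auto
  then have "X' t = R1"
    using minimal_resolution_unique rank_one_resolution_core(4)[OF R1] by blast
  define Y where "Y = X(Suc t := core R)"
  define Y' where "Y' = X'(Suc t := R)"
  have "toric_log_del_Pezzo (Y k) \<and> picard_number (Y k) = 1 \<and> minimal_resolution (Y k) (Y' k)"
    if "k \<le> Suc t" for k
    using that X(4) rank_one_resolution_core[OF R] by (cases "k = Suc t") (auto simp: Y_def Y'_def)
  moreover have "\<exists>u. blow_down (Y' k) u (Y' (k - 1))" if "k \<in> {1..Suc t}" for k
  proof (cases "k = Suc t")
    case True
    then show ?thesis using bd \<open>X' t = R1\<close> by (auto simp: Y'_def)
  next
    case False
    then show ?thesis using that X(5) by (auto simp: Y'_def)
  qed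
  moreover have "Y (Suc t) = core R" "Y 0 = T" using X(2) by (simp_all add: Y_def)
  ultimately show ?thesis unfolding admits_cascade_def using X(3) by blast
qed

text \<open>
  Induction on the number of rays.  As the contraction again contains a \<open>(-1)\<close>-curve, the descent
  ends in a basic surface with a \<open>(-1)\<close>-curve.
\<close>

lemma cascade_to_standard:
  assumes "rank_one_resolution R" "minus_one_curve R z"
  shows "\<exists>T. admits_cascade (core R) T \<and>
    ((\<exists>n\<ge>2. min_res_is T (std1 n)) \<or> (\<exists>n\<ge>2. min_res_is T (std2 n)) \<or> min_res_is T threeA2)"
  using assms
proof (induction "card R" arbitrary: R z rule: less_induct)
  case less
  note R = less.prems(1)
  note smooth = rank_one_resolution_core(1)[OF R]
  show ?case
  proof (cases "\<exists>u v w. contraction R u v w \<and> (self_int R v \<le> - 3 \<or> self_int R w \<le> - 3)")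
    case True
    then obtain u v w where con: "contraction R u v w"
      and low: "self_int R v \<le> - 3 \<or> self_int R w \<le> - 3" by blast
    note R1 = rank_one_contraction[OF R con low]
    interpret contraction R u v w by fact
    have "card (R - {u}) < card R"
      using rays(1) complete_fanD(1)[OF smooth_fanD(1)[OF smooth]] by (intro card_Diff1_less) auto
    then obtain T where T: "admits_cascade (core (R - {u})) T"
      "(\<exists>n\<ge>2. min_res_is T (std1 n)) \<or> (\<exists>n\<ge>2. min_res_is T (std2 n)) \<or> min_res_is T threeA2"
      using less.hyps R1 by blast
    then show ?thesis using cascade_blow_up[OF R R1(1) blow_down_contraction] by blast
  next
    case False
    have twos: "self_int R v = - 2 \<and> self_int R w = - 2" if "contraction R u v w" for u v w
      using minus_one_neighbours[OF R that] that False by force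
    have "- 2 \<le> self_int R D" if CD: "minus_one_curve R C \<and> curves_meet R C D" for C D
    proof -
      obtain v w where vw: "contraction R C v w" using contraction_exists[OF smooth] CD by blast
      then interpret contraction R C v w .
      have "D = C \<or> D = v \<or> D = w" using CD vu uw succ_unique pred_unique smooth_fanD(1)[OF smooth]
        unfolding curves_meet_def by blast
      then show ?thesis using twos[OF vw] self_int_u by auto
    qed
    then have "basic (core R)"
      using rank_one_resolution_core[OF R] unfolding basic_def by blast
    then have "admits_cascade (core R) (core R)" by (rule cascade_trivial)
    moreover obtain u v w where con: "contraction R u v w"
      using contraction_exists[OF smooth less.prems(2)] by blast
    interpret basic_fibre R u v w
    proof -
      interpret contraction R u v w by fact
      show "basic_fibre R u v w"
        by unfold_locales (use twos con R in \<open>auto simp: rank_one_resolution_def\<close>)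
    qed
    show ?thesis using classification calculation by blast
  qed
qed

text \<open>
  If neither \<open>v\<close> nor \<open>w\<close> had self-intersection \<open>-1\<close> before the blow-up, then no curve would leave the core, while
  the new \<open>(-1)\<close>-curve enters it.
\<close>

lemma centre_on_minus_one_curve:
  assumes R: "rank_one_resolution R" and R1: "rank_one_resolution (R - {u})"
    and con: "contraction R u v w"
  shows "minus_one_curve (R - {u}) v \<or> minus_one_curve (R - {u}) w"
    "\<not> minus_one_curve R v" "\<not> minus_one_curve R w"
proof -
  interpret contraction R u v w by fact
  note le = minus_one_neighbours[OF R con]
  show "\<not> minus_one_curve R v" "\<not> minus_one_curve R w"
    using le by (auto simp: minus_one_curve_def)
  show "minus_one_curve (R - {u}) v \<or> minus_one_curve (R - {u}) w"
  proof (rule ccontr)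
    assume no: "\<not> ?thesis"
    have "z \<in> core R" if z: "z \<in> core (R - {u})" for z
    proof -
      have "z \<in> R - {u}" using z core_subset by blast
      moreover have "z \<noteq> v" "z \<noteq> w"
        using z no le rays(2,3) self_int_contraction[OF rays(2)] self_int_contraction[OF rays(3)]
        by (auto simp: core_def minus_one_curve_def)
      ultimately show ?thesis using z self_int_contraction[of z] by (simp add: core_def)
    qed
    moreover have "u \<in> core R" "u \<notin> core (R - {u})"
      using rays(1) self_int_u by (auto simp: core_def)
    ultimately have sub: "core (R - {u}) \<subset> core R" by blast
    have "card (core R) = 3" "card (core (R - {u})) = 3"
      using R R1 by (simp_all add: rank_one_resolution_def)
    then show False using psubset_card_mono[OF _ sub] card.infinite[of "core R"] by linarith
  qed
qed

text \<open>
  Minimal resolutions are unique, so the ends of a cascade may be identified with \<open>T'\<close> and \<open>S'\<close>, and a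
  property of smooth fans is carried along from \<open>T'\<close> to \<open>S'\<close>.
\<close>

lemma cascade_induct:
  assumes "admits_cascade S T" "minimal_resolution S S'" "minimal_resolution T T'" "Q T'"
    and step: "\<And>R u v w. rank_one_resolution R \<Longrightarrow> rank_one_resolution (R - {u}) \<Longrightarrow>
      contraction R u v w \<Longrightarrow> Q (R - {u}) \<Longrightarrow> Q R"
  shows "Q S'"
proof -
  obtain t X X' where X: "X t = S" "X 0 = T"
    and r: "\<And>k. k \<le> t \<Longrightarrow> rank_one_resolution (X' k)" "\<And>k. k \<le> t \<Longrightarrow> X k = core (X' k)"
    and b: "\<And>k. k < t \<Longrightarrow> \<exists>u. blow_down (X' (Suc k)) u (X' k)"
    using cascadeE[OF assms(1)] by metis
  have X': "X' k = Y" if "k \<le> t" "minimal_resolution (X k) Y" for k Y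
    using minimal_resolution_unique that rank_one_resolution_core(4)[OF r(1)[OF that(1)]] r(2)[OF that(1)] by metis
  have "Q (X' k)" if "k \<le> t" for k
    using that
  proof (induction k)
    case 0
    then show ?case using X'[of 0] X(2) assms(3,4) by simp
  next
    case (Suc k)
    obtain u where u: "blow_down (X' (Suc k)) u (X' k)" using b Suc.prems by fastforce
    obtain v w where "contraction (X' (Suc k)) u v w" "X' k = X' (Suc k) - {u}"
      using blow_downE[OF u] by blast
    then show ?case using step[of "X' (Suc k)" u v w] Suc r(1)[of k] r(1)[of "Suc k"] by simp
  qed
  moreover have "X' t = S'" using X'[of t S'] X(1) assms(2) by simp
  ultimately show ?thesis by blast
qed

section \<open>Fibrations\<close>

lemma additive_smul:
  fixes p :: "vec \<Rightarrow> int"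
  assumes add: "\<And>x y. p (x + y) = p x + p y"
  shows "p (smul k x) = k * p x"
proof -
  have p0: "p 0 = 0" using add[of 0 0] by simp
  have neg: "p (- x) = - p x" for x using add[of x "- x"] p0 by simp
  have nat: "p (smul (int n) x) = int n * p x" for n x
  proof (induction n)
    case (Suc n)
    have "smul (int (Suc n)) x = smul (int n) x + x" by (simp add: smul_def prod_eq_iff algebra_simps)
    then show ?case using Suc add by (simp add: algebra_simps)
  qed (simp add: p0)
  show ?thesis
  proof (cases "0 \<le> k")
    case True
    then show ?thesis using nat[of "nat k"] by simp
  next
    case False
    then show ?thesis using nat[of "nat (- k)" x] neg[of "smul (- k) x"] by simp
  qed
qed

lemma P1_fibrationD:
  assumes "P1_fibration R p"
  shows "smooth_fan R" "p (x + y) = p x + p y" "p (smul k x) = k * p x"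
    "max_cone R u w \<Longrightarrow> (0 \<le> p u \<and> 0 \<le> p w) \<or> (p u \<le> 0 \<and> p w \<le> 0)"
  using assms additive_smul unfolding P1_fibration_def by blast+

lemma P1_fibration_neg:
  assumes "P1_fibration R p"
  shows "P1_fibration R (\<lambda>x. - p x)"
proof -
  have "surj p" using assms by (simp add: P1_fibration_def)
  then have "surj (\<lambda>x. - p x)" unfolding surj_def by (metis minus_minus)
  then show ?thesis using assms unfolding P1_fibration_def by (simp; blast)
qed

context contraction
begin

lemma fibration_blow_up:
  assumes "P1_fibration (R - {u}) p"
  shows "P1_fibration R p" "p u = p v + p w" "(0 \<le> p v \<and> 0 \<le> p w) \<or> (p v \<le> 0 \<and> p w \<le> 0)"
proof -
  note D = P1_fibrationD[OF assms]
  note C = smooth_fanD(1)[OF smooth]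
  show pu: "p u = p v + p w" using D(2) u_eq by simp
  have "max_cone (R - {u}) v w" using max_cone_contraction by blast
  then show vw: "(0 \<le> p v \<and> 0 \<le> p w) \<or> (p v \<le> 0 \<and> p w \<le> 0)" using D(4) by blast
  have "(0 \<le> p a \<and> 0 \<le> p b) \<or> (p a \<le> 0 \<and> p b \<le> 0)" if ab: "max_cone R a b" for a b
  proof -
    consider "a = u" | "b = u" | "a \<noteq> u" "b \<noteq> u" by blast
    then show ?thesis
    proof cases
      case 1
      then have "b = w" using ab uw succ_unique[OF C] by blast
      then show ?thesis using 1 vw pu by auto
    next
      case 2
      then have "a = v" using ab vu pred_unique[OF C] by blast
      then show ?thesis using 2 vw pu by auto
    next
      case 3
      then show ?thesis using ab D(4) max_cone_contraction by blast
    qed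
  qed
  then show "P1_fibration R p" using assms smooth unfolding P1_fibration_def by blast
qed

lemma fibration_blow_down:
  assumes "P1_fibration R p" "p u < 0"
  shows "P1_fibration (R - {u}) p"
proof -
  note D = P1_fibrationD[OF assms(1)]
  have "p v \<le> 0 \<and> p w \<le> 0" using D(4)[OF vu] D(4)[OF uw] assms(2) by auto
  then have "(0 \<le> p a \<and> 0 \<le> p b) \<or> (p a \<le> 0 \<and> p b \<le> 0)" if "max_cone (R - {u}) a b" for a b
    using that D(4) unfolding max_cone_contraction by blast
  then show ?thesis using assms(1) smooth_contraction unfolding P1_fibration_def by blast
qed

lemma contracts_to_blow_up:
  assumes "contracts_to (R - {u}) F ds" "u \<notin> F"
  shows "contracts_to R (insert u F) ds"
proof -
  have "fiber_blow_down (R, insert u F) (R - {u}, F)"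
    unfolding fiber_blow_down_def using blow_down_contraction assms(2) by auto
  then show ?thesis using assms(1) unfolding contracts_to_def
    by (meson converse_rtranclp_into_rtranclp)
qed

end

text \<open>
  A ray between \<open>a\<close> and \<open>b\<close> is a positive combination of them, so it lies in the same half plane.
  Hence the part of a fan over one half of the base determines its cones there.
\<close>

lemma max_cone_local:
  assumes R: "P1_fibration R p" and eq: "{z\<in>R. p z \<le> 0} = {z\<in>Q. p z \<le> 0}"
    and ab: "max_cone R a b" "p a \<le> 0" "p b \<le> 0"
  shows "max_cone Q a b"
proof -
  note D = P1_fibrationD[OF R]
  have abR: "a \<in> R" "b \<in> R" "0 < det2 a b" using max_coneD[OF ab(1)] by auto
  have "z \<in> R" if z: "z \<in> Q" "0 < det2 a z" "0 < det2 z b" for z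
  proof -
    have "smul (det2 a b) z = smul (det2 z b) a + smul (det2 a z) b"
      by (simp add: smul_def det2_def prod_eq_iff algebra_simps)
    then have "p (smul (det2 a b) z) = p (smul (det2 z b) a + smul (det2 a z) b)" by simp
    then have "det2 a b * p z = det2 z b * p a + det2 a z * p b" using D(2,3) by simp
    also have "\<dots> \<le> 0" using z ab by (simp add: add_nonpos_nonpos mult_nonneg_nonpos)
    finally have "p z \<le> 0" using abR by (simp add: mult_le_0_iff)
    then show ?thesis using z(1) eq by blast
  qed
  moreover have "a \<in> Q" "b \<in> Q" using abR ab eq by blast+
  ultimately show ?thesis using ab(1) unfolding max_cone_def by blast
qed

lemma self_int_local:
  assumes R: "P1_fibration R p" and Q: "P1_fibration Q p"
    and eq: "{z\<in>R. p z \<le> 0} = {z\<in>Q. p z \<le> 0}" and u: "u \<in> R" "p u < 0"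
    and vw: "max_cone R v u" "max_cone R u w"
  shows "max_cone Q v u" "max_cone Q u w" "self_int Q u = self_int R u"
proof -
  have "p v \<le> 0" "p w \<le> 0" using P1_fibrationD(4)[OF R vw(1)] P1_fibrationD(4)[OF R vw(2)] u by auto
  then show "max_cone Q v u" "max_cone Q u w" using max_cone_local[OF R eq] vw u by auto
  then show "self_int Q u = self_int R u"
    using self_int_eqI P1_fibrationD(1)[OF Q] self_int_rel[OF P1_fibrationD(1)[OF R] vw] by blast
qed

lemma is_chain_local:
  assumes R: "P1_fibration R p" and Q: "P1_fibration Q p"
    and eq: "{z\<in>R. p z \<le> 0} = {z\<in>Q. p z \<le> 0}" and ch: "is_chain R {z\<in>R. p z < 0} ds"
  shows "is_chain Q {z\<in>R. p z < 0} ds"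
proof -
  obtain us where us: "distinct us" "set us = {z\<in>R. p z < 0}"
    "\<forall>i. Suc i < length us \<longrightarrow> max_cone R (us ! i) (us ! Suc i)" "map (self_int R) us = ds"
    using ch unfolding is_chain_def by blast
  have in_us: "us ! i \<in> R \<and> p (us ! i) < 0" if "i < length us" for i
    using us(2) nth_mem[OF that] by auto
  have "\<forall>i. Suc i < length us \<longrightarrow> max_cone Q (us ! i) (us ! Suc i)"
    using us(3) max_cone_local[OF R eq] in_us by (meson Suc_lessD less_imp_le)
  moreover have "self_int Q z = self_int R z" if "z \<in> set us" for z
  proof -
    have z: "z \<in> R" "p z < 0" using that us(2) by auto
    obtain v w where "max_cone R v z" "max_cone R z w" using neighbours_exist[OF P1_fibrationD(1)[OF R] z(1)] .
    then show ?thesis using self_int_local(3)[OF R Q eq z] by blast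
  qed
  then have "map (self_int Q) us = ds" using us(4) by auto
  ultimately show ?thesis using us(1,2) unfolding is_chain_def by blast
qed

text \<open>
  Contractions inside one fiber do not see the other fiber: the same rays can be removed in the same
  order from any fan that agrees with \<open>R\<close> in the half plane of the fiber.
\<close>

lemma contracts_to_local:
  assumes "contracts_to R {z\<in>R. p z < 0} ds" "P1_fibration R p" "P1_fibration Q p"
    and "{z\<in>R. p z \<le> 0} = {z\<in>Q. p z \<le> 0}"
  shows "contracts_to Q {z\<in>R. p z < 0} ds"
proof -
  obtain R' F' where star: "fiber_blow_down\<^sup>*\<^sup>* (R, {z\<in>R. p z < 0}) (R', F')" and ch: "is_chain R' F' ds"
    using assms(1) unfolding contracts_to_def by blast
  have "contracts_to Q F ds"
    if "fiber_blow_down\<^sup>*\<^sup>* (R, F) (R', F')" "P1_fibration R p" "P1_fibration Q p"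
      "F = {z\<in>R. p z < 0}" "{z\<in>R. p z \<le> 0} = {z\<in>Q. p z \<le> 0}" for R F Q
    using that
  proof (induction arbitrary: Q rule: converse_rtranclp_induct2)
    case refl
    then have "is_chain Q F' ds" using is_chain_local ch by blast
    then show ?case unfolding contracts_to_def by blast
  next
    case (step R F R1 F1)
    obtain u where u: "u \<in> F" "blow_down R u R1" "F1 = F - {u}"
      using step.hyps(1) by (auto simp: fiber_blow_down_def)
    obtain v w where con: "contraction R u v w" and R1: "R1 = R - {u}" using blow_downE[OF u(2)] .
    have uR: "u \<in> R" "p u < 0" using u(1) step.prems by auto
    have loc: "max_cone Q v u" "max_cone Q u w" "self_int Q u = self_int R u"
      using self_int_local[OF step.prems(1,2,4) uR, of v w] con by (simp_all add: contraction_def)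
    have conQ: "contraction Q u v w"
      using loc con P1_fibrationD(1)[OF step.prems(2)] by (simp add: contraction_def)
    have "P1_fibration R1 p" "P1_fibration (Q - {u}) p"
      using contraction.fibration_blow_down con conQ step.prems uR(2) R1 by blast+
    moreover have "F1 = {z\<in>R1. p z < 0}" using u(3) step.prems(3) R1 by blast
    moreover have "{z\<in>R1. p z \<le> 0} = {z\<in>Q - {u}. p z \<le> 0}" using R1 step.prems(4) by blast
    ultimately have "contracts_to (Q - {u}) F1 ds" by (rule step.IH)
    moreover have "insert u F1 = F" "u \<notin> F1" using u by auto
    ultimately show ?case using contraction.contracts_to_blow_up[OF conQ, of F1] by simp
  qed
  then show ?thesis using star assms by blast
qed

text \<open>
  The set \<open>Z\<close> consists of the two sections, and \<open>ds, es\<close> describe chains to which the two fibers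
  contract.
\<close>

definition fibred_type :: "(vec \<Rightarrow> int) \<Rightarrow> vec set \<Rightarrow> int list \<Rightarrow> int list \<Rightarrow> vec set \<Rightarrow> bool" where
  "fibred_type p Z ds es R \<longleftrightarrow> P1_fibration R p \<and> {z\<in>R. p z = 0} = Z \<and>
     contracts_to R {z\<in>R. 0 < p z} ds \<and> contracts_to R {z\<in>R. p z < 0} es"

lemma fibred_type_neg: "fibred_type p Z ds es R \<Longrightarrow> fibred_type (\<lambda>x. - p x) Z es ds R"
  unfolding fibred_type_def using P1_fibration_neg by simp

lemma fibred_type_blow_up_pos:
  assumes "contraction R u v w" "fibred_type p Z ds es (R - {u})" "0 < p u"
  shows "fibred_type p Z ds es R"
proof -
  interpret contraction R u v w by fact
  have f: "P1_fibration (R - {u}) p" "{z\<in>R - {u}. p z = 0} = Z"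
    "contracts_to (R - {u}) {z\<in>R - {u}. 0 < p z} ds" "contracts_to (R - {u}) {z\<in>R - {u}. p z < 0} es"
    using assms(2) by (simp_all add: fibred_type_def)
  note up = fibration_blow_up[OF f(1)]
  have "{z\<in>R. 0 < p z} = insert u {z\<in>R - {u}. 0 < p z}" using assms(3) rays(1) by auto
  then have "contracts_to R {z\<in>R. 0 < p z} ds" using contracts_to_blow_up[OF f(3)] by simp
  moreover have "{z\<in>R - {u}. p z \<le> 0} = {z\<in>R. p z \<le> 0}" using assms(3) by auto
  then have "contracts_to R {z\<in>R - {u}. p z < 0} es" using contracts_to_local[OF f(4,1) up(1)] by blast
  moreover have "{z\<in>R - {u}. p z < 0} = {z\<in>R. p z < 0}" "{z\<in>R - {u}. p z = 0} = {z\<in>R. p z = 0}"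
    using assms(3) by auto
  ultimately show ?thesis using f(2) up(1) by (simp add: fibred_type_def)
qed

text \<open>
  The new curve is a component of the fiber through the centre.  It can be contracted first, and the
  opposite fiber is unaffected by \<open>contracts_to_local\<close>.
\<close>

lemma fibred_type_blow_up:
  assumes con: "contraction R u v w" and f: "fibred_type p Z ds es (R - {u})" and Z: "v \<notin> Z \<or> w \<notin> Z"
  shows "fibred_type p Z ds es R" "p u \<noteq> 0"
proof -
  interpret contraction R u v w by fact
  have f': "P1_fibration (R - {u}) p" "{z\<in>R - {u}. p z = 0} = Z" using f by (simp_all add: fibred_type_def)
  have "p v \<noteq> 0 \<or> p w \<noteq> 0" using Z f'(2) rays by blast
  then show nz: "p u \<noteq> 0" using fibration_blow_up(2,3)[OF f'(1)] by auto
  show "fibred_type p Z ds es R"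
  proof (cases "0 < p u")
    case True
    then show ?thesis using fibred_type_blow_up_pos[OF con f] by simp
  next
    case False
    then have "0 < - p u" using nz by simp
    then have "fibred_type (\<lambda>x. - p x) Z es ds R"
      using fibred_type_blow_up_pos[OF con fibred_type_neg[OF f]] by simp
    then show ?thesis using fibred_type_neg by fastforce
  qed
qed

text \<open>
  The self-intersection numbers of these curves do not change any more in a cascade, because all
  centres lie on \<open>(-1)\<close>-curves.
\<close>

definition untouched :: "vec set \<Rightarrow> vec set \<Rightarrow> bool" where
  "untouched R Z \<longleftrightarrow> Z \<subseteq> R \<and> (\<forall>C z. minus_one_curve R C \<and> curves_meet R C z \<longrightarrow> z \<notin> Z)"

lemma minus_one_curve_blow_up:
  assumes "rank_one_resolution R" "rank_one_resolution (R - {u})" "contraction R u v w"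
    and "minus_one_curve R C" "C \<noteq> u"
  shows "minus_one_curve (R - {u}) C"
proof -
  interpret contraction R u v w by fact
  have "C \<noteq> v" "C \<noteq> w" using centre_on_minus_one_curve(2,3)[OF assms(1-3)] assms(4) by blast+
  then show ?thesis using self_int_contraction[of C] assms(4,5) by (simp add: minus_one_curve_def)
qed

lemma untouched_blow_up:
  assumes R: "rank_one_resolution R" "rank_one_resolution (R - {u})" "contraction R u v w"
    and Z: "untouched (R - {u}) Z"
  shows "untouched R Z" "v \<notin> Z" "w \<notin> Z" "z \<in> Z \<Longrightarrow> self_int R z = self_int (R - {u}) z"
proof -
  interpret contraction R u v w by fact
  note C = smooth_fanD(1)[OF smooth]
  have ZR: "Z \<subseteq> R - {u}" and far: "\<And>C z. minus_one_curve (R - {u}) C \<Longrightarrow> curves_meet (R - {u}) C z \<Longrightarrow> z \<notin> Z"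
    using Z unfolding untouched_def by blast+
  have "max_cone (R - {u}) v w" using max_cone_contraction by blast
  then have meet: "curves_meet (R - {u}) y z" if "y \<in> {v, w}" "z \<in> {v, w}" for y z
    using that rays by (auto simp: curves_meet_def)
  then show vw: "v \<notin> Z" "w \<notin> Z" using far centre_on_minus_one_curve(1)[OF R] by blast+
  show "self_int R z = self_int (R - {u}) z" if "z \<in> Z"
  proof -
    have "z \<in> R - {u}" "z \<noteq> v" "z \<noteq> w" using that vw ZR by blast+
    then show ?thesis using self_int_contraction by simp
  qed
  have "z \<notin> Z" if Dz: "minus_one_curve R D" "curves_meet R D z" for D z
  proof (cases "D = u \<or> z = u")
    case True
    then have "z = u \<or> z = v \<or> z = w"
      using Dz(2) vu uw succ_unique[OF C] pred_unique[OF C] unfolding curves_meet_def by blast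
    then show ?thesis using vw ZR by blast
  next
    case False
    then have "curves_meet (R - {u}) D z" using Dz(2) unfolding curves_meet_def max_cone_contraction by auto
    then show ?thesis using far minus_one_curve_blow_up[OF R Dz(1)] False by blast
  qed
  then show "untouched R Z" using ZR unfolding untouched_def by blast
qed

section \<open>Fibrations of the standard surfaces\<close>

lemma linked_rel:
  assumes "smooth_fan R"
    "max_cone R a b \<and> max_cone R b c \<or> max_cone R b a \<and> max_cone R c b"
  shows "a + c + smul (self_int R b) b = 0"
  using assms self_int_rel[of R a b c] self_int_rel[of R c b a] by (auto simp: add.commute)

text \<open>
  A symmetric relation that holds along the cycle holds for every pair of adjacent curves.
\<close>

lemma ring_max_cone:
  assumes us: "ring_of_curves R us" and ab: "max_cone R a b"
    and sym: "\<And>a b. P a b \<Longrightarrow> P b a" and P: "us \<noteq> []" "successively P (us @ [hd us])"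
  shows "P a b"
proof -
  have R: "complete_fan R" "set us = R"
    using us smooth_fanD(1) by (auto simp: ring_of_curves_def)
  have cP: "P (us ! i) (us ! (Suc i mod length us))" if "i < length us" for i
    using P that cyclic_chain_iff_successively unfolding cyclic_chain_def by blast
  obtain i where i: "i < length us" "us ! i = a"
    using max_coneD(1)[OF ab] R(2) by (metis in_set_conv_nth)
  obtain j where j: "j < length us" "us ! j = b"
    using max_coneD(2)[OF ab] R(2) by (metis in_set_conv_nth)
  from us consider "cyclic_chain (max_cone R) us" | "cyclic_chain (\<lambda>u w. max_cone R w u) us"
    unfolding ring_of_curves_def by blast
  then show ?thesis
  proof cases
    case 1
    then have "max_cone R a (us ! (Suc i mod length us))" using i unfolding cyclic_chain_def by blast
    then have "us ! (Suc i mod length us) = b" using succ_unique[OF R(1)] ab by blast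
    then show ?thesis using cP[OF i(1)] i(2) by simp
  next
    case 2
    then have "max_cone R (us ! (Suc j mod length us)) b" using j unfolding cyclic_chain_def by blast
    then have "us ! (Suc j mod length us) = a" using pred_unique[OF R(1)] ab by blast
    then show ?thesis using cP[OF j(1)] j(2) sym by simp
  qed
qed

lemma ring_fibration:
  assumes us: "ring_of_curves R us" "us \<noteq> []" and e: "e = 1 \<or> e = (- 1 :: int)" and d: "det2 x d = e"
    and p: "p = (\<lambda>z. e * det2 x z)"
    and sign: "successively (\<lambda>u w. (0 \<le> p u \<and> 0 \<le> p w) \<or> (p u \<le> 0 \<and> p w \<le> 0)) (us @ [hd us])"
  shows "P1_fibration R p"
  unfolding P1_fibration_def
proof (intro conjI allI impI)
  show "smooth_fan R" using us by (simp add: ring_of_curves_def)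
  show "p (y + z) = p y + p z" for y z by (simp add: p algebra_simps)
  have "e * e = 1" using e by auto
  then have "p (smul k d) = k" for k using d by (simp add: p)
  then show "surj p" by (rule surjI)
  show "(0 \<le> p u \<and> 0 \<le> p w) \<or> (p u \<le> 0 \<and> p w \<le> 0)" if "max_cone R u w" for u w
    by (rule ring_max_cone[OF us(1) that _ us(2) sign]) auto
qed

lemma ring_untouched:
  assumes us: "ring_of_curves R us" "us \<noteq> []" and Z: "Z \<subseteq> R" "\<And>z. z \<in> Z \<Longrightarrow> self_int R z \<noteq> - 1"
    and far: "successively (\<lambda>u w. (self_int R u = - 1 \<longrightarrow> w \<notin> Z) \<and> (self_int R w = - 1 \<longrightarrow> u \<notin> Z))
      (us @ [hd us])"
  shows "untouched R Z"
  unfolding untouched_def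
proof (intro conjI allI impI notI)
  fix C z assume Cz: "minus_one_curve R C \<and> curves_meet R C z" and z: "z \<in> Z"
  then have C: "self_int R C = - 1" by (simp add: minus_one_curve_def)
  have far': "(self_int R u = - 1 \<longrightarrow> w \<notin> Z) \<and> (self_int R w = - 1 \<longrightarrow> u \<notin> Z)" if "max_cone R u w" for u w
    by (rule ring_max_cone[OF us(1) that _ us(2) far]) auto
  have "z \<noteq> C" using C z Z(2)[of z] by auto
  then have "max_cone R C z \<or> max_cone R z C" using Cz by (auto simp: curves_meet_def)
  then show False using far' C z by blast
qed (use Z in auto)

text \<open>
  For symmetric sequences of self-intersection numbers it does not matter in which direction the cycle runs.
\<close>

lemma palindromic_chain:
  assumes "distinct vs" "map (self_int R) vs = ds" "rev ds = ds"
    and ch: "successively (max_cone R) vs \<or> successively (\<lambda>u w. max_cone R w u) vs"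
  shows "contracts_to R (set vs) ds"
proof -
  have *: "is_chain R (set vs) ds" if "distinct ws" "set ws = set vs" "map (self_int R) ws = ds"
    "successively (max_cone R) ws" for ws
    using that unfolding is_chain_def successively_conv_nth by blast
  have "is_chain R (set vs) ds"
    using ch
  proof
    assume "successively (max_cone R) vs"
    then show ?thesis using *[of vs] assms by simp
  next
    assume "successively (\<lambda>u w. max_cone R w u) vs"
    moreover have "map (self_int R) (rev vs) = ds" using assms(2,3) by (simp add: rev_map[symmetric])
    ultimately show ?thesis using *[of "rev vs"] assms(1) by simp
  qed
  then show ?thesis unfolding contracts_to_def by blast
qed

lemma ring_orientation:
  assumes "ring_of_curves R us" "us \<noteq> []"
  shows "\<exists>e::int. (e = 1 \<or> e = - 1) \<and> successively (\<lambda>u w. det2 u w = e) (us @ [hd us])"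
proof -
  have s: "smooth_fan R" using assms by (simp add: ring_of_curves_def)
  have d: "det2 u w = 1" "det2 w u = - 1" if "max_cone R u w" for u w
    using smooth_fanD(2)[OF s that] det2_swap[of w u] by simp_all
  from assms have "successively (max_cone R) (us @ [hd us]) \<or>
      successively (\<lambda>u w. max_cone R w u) (us @ [hd us])"
    using cyclic_chain_iff_successively unfolding ring_of_curves_def by blast
  then show ?thesis
  proof
    assume "successively (max_cone R) (us @ [hd us])"
    then have "successively (\<lambda>u w. det2 u w = 1) (us @ [hd us])"
      using d(1) by (rule successively_mono)
    then show ?thesis by blast
  next
    assume "successively (\<lambda>u w. max_cone R w u) (us @ [hd us])"
    then have "successively (\<lambda>u w. det2 u w = - 1) (us @ [hd us])"
      using d(2) by (rule successively_mono)
    then show ?thesis by blast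
  qed
qed

text \<open>
  The relations at the three curves of the fiber of type \<open>I\<^sub>0\<close> express all of its rays through one
  of them and the section \<open>x\<close>, so that \<open>\<plusminus>det2 x\<close> can be evaluated on the whole cycle.  The
  next two lemmas proceed in the same way.
\<close>

lemma std1_fibration:
  assumes us: "ring_of_curves R us" "map (self_int R) us = std1 n" and n: "2 \<le> n"
  shows "\<exists>p x y g. x \<noteq> y \<and> fibred_type p {x, y} [- 2, - 1, - 2] [0] R \<and> untouched R {x, y, g} \<and>
    self_int R x = - n \<and> self_int R y = n - 1 \<and> {z\<in>R. p z < 0} = {g} \<and> \<bar>p g\<bar> = 1"
proof -
  have "length us = 6" using arg_cong[OF us(2), of length] by (simp add: std1_def)
  then obtain g x D C E y where us_eq: "us = [g, x, D, C, E, y]"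
    by (auto simp: length_Suc_conv eval_nat_numeral)
  have selfs: "self_int R g = 0" "self_int R x = - n" "self_int R D = - 2" "self_int R C = - 1"
    "self_int R E = - 2" "self_int R y = n - 1"
    using us(2) by (simp_all add: us_eq std1_def)
  have s: "smooth_fan R" and dist: "distinct [g, x, D, C, E, y]" and R: "R = {g, x, D, C, E, y}"
    using us(1) by (auto simp: ring_of_curves_def us_eq)
  have cyc: "successively (max_cone R) (us @ [hd us]) \<or> successively (\<lambda>u w. max_cone R w u) (us @ [hd us])"
    using us(1) cyclic_chain_iff_successively[of us] by (simp add: ring_of_curves_def us_eq)
  obtain e :: int where e: "e = 1 \<or> e = - 1" "successively (\<lambda>u w. det2 u w = e) (us @ [hd us])"
    using ring_orientation[OF us(1)] us_eq by blast
  have ee: "e * e = 1" using e(1) by auto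
  have rels: "x + C = smul 2 D" "D + E = C" "C + y = smul 2 E"
    using linked_rel[OF s, of x D C] linked_rel[OF s, of D C E] linked_rel[OF s, of C E y] cyc selfs
    by (auto simp: us_eq)
  then have coords: "E = D - x" "C = D + D - x" "y = - x" by (simp_all add: smul_def prod_eq_iff)
  define p where "p = (\<lambda>z. e * det2 x z)"
  have "det2 x D = e" "det2 x g = - e" using e(2) det2_swap[of x g] by (simp_all add: us_eq)
  then have pv: "p x = 0" "p y = 0" "p D = 1" "p E = 1" "p C = 2" "p g = - 1"
    using ee by (simp_all add: p_def coords algebra_simps)
  have "P1_fibration R p"
    by (rule ring_fibration[OF us(1) _ e(1) \<open>det2 x D = e\<close> p_def]) (simp_all add: us_eq pv)
  moreover have "{z\<in>R. p z = 0} = {x, y}" "{z\<in>R. 0 < p z} = set [D, C, E]" "{z\<in>R. p z < 0} = set [g]"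
    unfolding R using pv by auto
  moreover have "contracts_to R (set [D, C, E]) [- 2, - 1, - 2]" "contracts_to R (set [g]) [0]"
    by (rule palindromic_chain; use dist selfs cyc in \<open>auto simp: us_eq\<close>)+
  ultimately have "fibred_type p {x, y} [- 2, - 1, - 2] [0] R"
    by (simp only: fibred_type_def simp_thms)
  moreover have "untouched R {x, y, g}"
    by (rule ring_untouched[OF us(1)]) (use selfs n dist in \<open>auto simp: us_eq R\<close>)
  moreover have "x \<noteq> y" "{z\<in>R. p z < 0} = {g}" "\<bar>p g\<bar> = 1" using dist pv unfolding R by auto
  ultimately show ?thesis using selfs(2,6) by blast
qed

lemma std2_fibration:
  assumes us: "ring_of_curves R us" "map (self_int R) us = std2 n" and n: "2 \<le> n"
  shows "\<exists>p x y. x \<noteq> y \<and> fibred_type p {x, y} [- 2, - 1, - 2] [- 2, - 1, - 2] R \<and> untouched R {x, y} \<and>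
    self_int R x = - n \<and> self_int R y = n - 2"
proof -
  have "length us = 8" using arg_cong[OF us(2), of length] by (simp add: std2_def)
  then obtain s x D C E y r t where us_eq: "us = [s, x, D, C, E, y, r, t]"
    by (auto simp: length_Suc_conv eval_nat_numeral)
  have selfs: "self_int R s = - 2" "self_int R x = - n" "self_int R D = - 2" "self_int R C = - 1"
    "self_int R E = - 2" "self_int R y = n - 2" "self_int R r = - 2" "self_int R t = - 1"
    using us(2) by (simp_all add: us_eq std2_def)
  have sm: "smooth_fan R" and dist: "distinct [s, x, D, C, E, y, r, t]"
    and R: "R = {s, x, D, C, E, y, r, t}"
    using us(1) by (auto simp: ring_of_curves_def us_eq)
  have cyc: "successively (max_cone R) (us @ [hd us]) \<or> successively (\<lambda>u w. max_cone R w u) (us @ [hd us])"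
    using us(1) cyclic_chain_iff_successively[of us] by (simp add: ring_of_curves_def us_eq)
  obtain e :: int where e: "e = 1 \<or> e = - 1" "successively (\<lambda>u w. det2 u w = e) (us @ [hd us])"
    using ring_orientation[OF us(1)] us_eq by blast
  have ee: "e * e = 1" using e(1) by auto
  have rels: "x + C = smul 2 D" "D + E = C" "C + y = smul 2 E" "y + t = smul 2 r"
    using linked_rel[OF sm, of x D C] linked_rel[OF sm, of D C E] linked_rel[OF sm, of C E y]
      linked_rel[OF sm, of y r t] cyc selfs
    by (auto simp: us_eq)
  then have coords: "E = D - x" "C = D + D - x" "y = - x" "t = r + r + x"
    by (simp_all add: smul_def prod_eq_iff)
  define p where "p = (\<lambda>z. e * det2 x z)"
  have "det2 x D = e" "det2 x s = - e" "det2 x r = - e"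
    using e(2) det2_swap[of x s] coords(3) by (simp_all add: us_eq)
  then have pv: "p x = 0" "p y = 0" "p D = 1" "p E = 1" "p C = 2" "p s = - 1" "p r = - 1" "p t = - 2"
    using ee by (simp_all add: p_def coords algebra_simps)
  have "P1_fibration R p"
    by (rule ring_fibration[OF us(1) _ e(1) \<open>det2 x D = e\<close> p_def]) (simp_all add: us_eq pv)
  moreover have "{z\<in>R. p z = 0} = {x, y}" "{z\<in>R. 0 < p z} = set [D, C, E]" "{z\<in>R. p z < 0} = set [r, t, s]"
    unfolding R using pv by auto
  moreover have "contracts_to R (set [D, C, E]) [- 2, - 1, - 2]" "contracts_to R (set [r, t, s]) [- 2, - 1, - 2]"
    by (rule palindromic_chain; use dist selfs cyc in \<open>auto simp: us_eq\<close>)+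
  ultimately have "fibred_type p {x, y} [- 2, - 1, - 2] [- 2, - 1, - 2] R"
    by (simp only: fibred_type_def simp_thms)
  moreover have "untouched R {x, y}"
    by (rule ring_untouched[OF us(1)]) (use selfs n dist in \<open>auto simp: us_eq R\<close>)
  moreover have "x \<noteq> y" using dist by auto
  ultimately show ?thesis using selfs(2,6) by blast
qed

lemma threeA2_fibration:
  assumes us: "ring_of_curves R us" "map (self_int R) us = threeA2"
  shows "\<exists>p x y. x \<noteq> y \<and> fibred_type p {x, y} [- 2, - 1, - 2] [- 1, - 2, - 2, - 1] R \<and>
    self_int R x = - 2 \<and> self_int R y = - 2"
proof -
  have "length us = 9" using arg_cong[OF us(2), of length] by (simp add: threeA2_def)
  then obtain C E y g k l h x D where us_eq: "us = [C, E, y, g, k, l, h, x, D]"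
    by (auto simp: length_Suc_conv eval_nat_numeral)
  have selfs: "self_int R C = - 1" "self_int R E = - 2" "self_int R y = - 2" "self_int R g = - 1"
    "self_int R k = - 2" "self_int R l = - 2" "self_int R h = - 1" "self_int R x = - 2" "self_int R D = - 2"
    using us(2) by (simp_all add: us_eq threeA2_def)
  have sm: "smooth_fan R" and dist: "distinct [C, E, y, g, k, l, h, x, D]"
    and R: "R = {C, E, y, g, k, l, h, x, D}"
    using us(1) by (auto simp: ring_of_curves_def us_eq)
  have cyc: "successively (max_cone R) (us @ [hd us]) \<or> successively (\<lambda>u w. max_cone R w u) (us @ [hd us])"
    using us(1) cyclic_chain_iff_successively[of us] by (simp add: ring_of_curves_def us_eq)
  obtain e :: int where e: "e = 1 \<or> e = - 1" "successively (\<lambda>u w. det2 u w = e) (us @ [hd us])"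
    using ring_orientation[OF us(1)] us_eq by blast
  have ee: "e * e = 1" using e(1) by auto
  have rels: "x + C = smul 2 D" "D + E = C" "C + y = smul 2 E" "y + k = g" "g + l = smul 2 k" "k + h = smul 2 l"
    using linked_rel[OF sm, of x D C] linked_rel[OF sm, of D C E] linked_rel[OF sm, of C E y]
      linked_rel[OF sm, of y g k] linked_rel[OF sm, of g k l] linked_rel[OF sm, of k l h] cyc selfs
    by (auto simp: us_eq)
  then have coords: "E = D - x" "C = D + D - x" "y = - x" "k = g + x" "l = g + x + x" "h = g + x + x + x"
    by (simp_all add: smul_def prod_eq_iff)
  define p where "p = (\<lambda>z. e * det2 x z)"
  have "det2 x D = e" "det2 x g = - e" using e(2) coords(3) by (simp_all add: us_eq)
  then have pv: "p x = 0" "p y = 0" "p D = 1" "p E = 1" "p C = 2" "p g = - 1" "p k = - 1" "p l = - 1" "p h = - 1"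
    using ee by (simp_all add: p_def coords algebra_simps)
  have "P1_fibration R p"
    by (rule ring_fibration[OF us(1) _ e(1) \<open>det2 x D = e\<close> p_def]) (simp_all add: us_eq pv)
  moreover have "{z\<in>R. p z = 0} = {x, y}" "{z\<in>R. 0 < p z} = set [D, C, E]" "{z\<in>R. p z < 0} = set [g, k, l, h]"
    unfolding R using pv by auto
  moreover have "contracts_to R (set [D, C, E]) [- 2, - 1, - 2]"
    "contracts_to R (set [g, k, l, h]) [- 1, - 2, - 2, - 1]"
    by (rule palindromic_chain; use dist selfs cyc in \<open>auto simp: us_eq\<close>)+
  ultimately have "fibred_type p {x, y} [- 2, - 1, - 2] [- 1, - 2, - 2, - 1] R"
    by (simp only: fibred_type_def simp_thms)
  moreover have "x \<noteq> y" using dist by auto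
  ultimately show ?thesis using selfs(3,8) by blast
qed

text \<open>
  All centres lie outside \<open>x, y, g\<close>, hence in the fiber of type \<open>I\<close>; the fiber \<open>g\<close> stays smooth and
  the sections keep their self-intersections.
\<close>

lemma cascade_std1:
  assumes cas: "admits_cascade S T" "minimal_resolution S S'" and T: "min_res_is T (std1 n)" and n: "2 \<le> n"
  shows "\<exists>p F\<^sub>1 F\<^sub>0. fibered S' p (- n) F\<^sub>1 (n - 1) F\<^sub>0 \<and> type_I S' F\<^sub>1 \<and> smooth_fiber p F\<^sub>0"
proof -
  obtain T' where T': "minimal_resolution T T'" using T by (auto simp: min_res_is_def)
  then obtain us where "ring_of_curves T' us" "map (self_int T') us = std1 n"
    using T min_res_is_iff by blast
  then obtain p x y g where base: "x \<noteq> y" "fibred_type p {x, y} [- 2, - 1, - 2] [0] T'" "untouched T' {x, y, g}"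
    "self_int T' x = - n" "self_int T' y = n - 1" "{z\<in>T'. p z < 0} = {g}" "\<bar>p g\<bar> = 1"
    using std1_fibration[OF _ _ n] by blast
  define Q where "Q R \<longleftrightarrow> fibred_type p {x, y} [- 2, - 1, - 2] [0] R \<and> untouched R {x, y, g} \<and>
    self_int R x = - n \<and> self_int R y = n - 1 \<and> {z\<in>R. p z < 0} = {g}" for R
  have "Q S'"
  proof (rule cascade_induct[OF cas T'])
    show "Q T'" using base by (simp add: Q_def)
  next
    fix R u v w
    assume R: "rank_one_resolution R" "rank_one_resolution (R - {u})" and con: "contraction R u v w"
      and q: "Q (R - {u})"
    interpret contraction R u v w by fact
    have q': "fibred_type p {x, y} [- 2, - 1, - 2] [0] (R - {u})" "untouched (R - {u}) {x, y, g}"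
      "self_int (R - {u}) x = - n" "self_int (R - {u}) y = n - 1" "{z\<in>R - {u}. p z < 0} = {g}"
      using q by (simp_all add: Q_def)
    note U = untouched_blow_up[OF R con q'(2)]
    have f: "fibred_type p {x, y} [- 2, - 1, - 2] [0] R" "p u \<noteq> 0"
      using fibred_type_blow_up[OF con q'(1)] U(2) by auto
    have "\<not> p v < 0" using U(2) q'(5) rays(2) by blast
    then have "0 \<le> p u"
      using fibration_blow_up(2,3)[of p] q'(1,5) U(3) rays(3) unfolding fibred_type_def
      by (smt (verit) mem_Collect_eq insertCI singletonD)
    then have "{z\<in>R. p z < 0} = {z\<in>R - {u}. p z < 0}" by auto
    then show "Q R" using f U(1,4) q' by (simp add: Q_def)
  qed
  then have q: "fibred_type p {x, y} [- 2, - 1, - 2] [0] S'"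
    "self_int S' x = - n" "self_int S' y = n - 1" "{z\<in>S'. p z < 0} = {g}"
    by (simp_all add: Q_def)
  then show ?thesis
    using base(1,7) unfolding fibered_def fibred_type_def type_I_def smooth_fiber_def by blast
qed

lemma cascade_std2:
  assumes cas: "admits_cascade S T" "minimal_resolution S S'" and T: "min_res_is T (std2 n)" and n: "2 \<le> n"
  shows "\<exists>p F\<^sub>1 F\<^sub>1'. fibered S' p (- n) F\<^sub>1 (n - 2) F\<^sub>1' \<and> type_I S' F\<^sub>1 \<and> type_I S' F\<^sub>1'"
proof -
  obtain T' where T': "minimal_resolution T T'" using T by (auto simp: min_res_is_def)
  then obtain us where "ring_of_curves T' us" "map (self_int T') us = std2 n"
    using T min_res_is_iff by blast
  then obtain p x y where base: "x \<noteq> y" "fibred_type p {x, y} [- 2, - 1, - 2] [- 2, - 1, - 2] T'"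
    "untouched T' {x, y}" "self_int T' x = - n" "self_int T' y = n - 2"
    using std2_fibration n by metis
  define Q where "Q R \<longleftrightarrow> fibred_type p {x, y} [- 2, - 1, - 2] [- 2, - 1, - 2] R \<and> untouched R {x, y} \<and>
    self_int R x = - n \<and> self_int R y = n - 2" for R
  have "Q S'"
  proof (rule cascade_induct[OF cas T'])
    show "Q T'" using base by (simp add: Q_def)
  next
    fix R u v w
    assume R: "rank_one_resolution R" "rank_one_resolution (R - {u})" and con: "contraction R u v w"
      and q: "Q (R - {u})"
    note U = untouched_blow_up[OF R con, of "{x, y}"]
    have "fibred_type p {x, y} [- 2, - 1, - 2] [- 2, - 1, - 2] R"
      using fibred_type_blow_up(1)[OF con] U(2) q by (auto simp: Q_def)
    then show "Q R" using U(1,4) q by (simp add: Q_def)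
  qed
  then have "fibred_type p {x, y} [- 2, - 1, - 2] [- 2, - 1, - 2] S'"
    "self_int S' x = - n" "self_int S' y = n - 2"
    by (simp_all add: Q_def)
  then show ?thesis
    using base(1) unfolding fibered_def fibred_type_def type_I_def by blast
qed

text \<open>
  Here the sections may be blown up, as they meet \<open>(-1)\<close>-curves of the fiber of type \<open>II\<close>; but they never
  are \<open>(-1)\<close>-curves, so that each centre lies on a \<open>(-1)\<close>-curve contained in a fiber.
\<close>

lemma cascade_threeA2:
  assumes cas: "admits_cascade S T" "minimal_resolution S S'" and T: "min_res_is T threeA2"
  shows "\<exists>n m p F\<^sub>1 F\<^sub>2. fibered S' p (- n) F\<^sub>1 (- m) F\<^sub>2 \<and> type_I S' F\<^sub>1 \<and> type_II S' F\<^sub>2"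
proof -
  obtain T' where T': "minimal_resolution T T'" using T by (auto simp: min_res_is_def)
  then obtain us where "ring_of_curves T' us" "map (self_int T') us = threeA2"
    using T min_res_is_iff by blast
  then obtain p x y where base: "x \<noteq> y" "fibred_type p {x, y} [- 2, - 1, - 2] [- 1, - 2, - 2, - 1] T'"
    "self_int T' x = - 2" "self_int T' y = - 2"
    using threeA2_fibration by metis
  define Q where "Q R \<longleftrightarrow> fibred_type p {x, y} [- 2, - 1, - 2] [- 1, - 2, - 2, - 1] R \<and>
    \<not> minus_one_curve R x \<and> \<not> minus_one_curve R y" for R
  have "Q S'"
  proof (rule cascade_induct[OF cas T'])
    show "Q T'" using base by (simp add: Q_def minus_one_curve_def)
  next
    fix R u v w
    assume R: "rank_one_resolution R" "rank_one_resolution (R - {u})" and con: "contraction R u v w"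
      and q: "Q (R - {u})"
    have "v \<notin> {x, y} \<or> w \<notin> {x, y}"
      using centre_on_minus_one_curve(1)[OF R con] q by (auto simp: Q_def)
    then have "fibred_type p {x, y} [- 2, - 1, - 2] [- 1, - 2, - 2, - 1] R"
      using fibred_type_blow_up(1)[OF con] q by (auto simp: Q_def)
    moreover have "x \<noteq> u" "y \<noteq> u" using q by (auto simp: Q_def fibred_type_def)
    ultimately show "Q R" using minus_one_curve_blow_up[OF R con] q unfolding Q_def by blast
  qed
  then have f: "fibred_type p {x, y} [- 2, - 1, - 2] [- 1, - 2, - 2, - 1] S'" by (simp add: Q_def)
  have "fibered S' p (- (- self_int S' x)) {z\<in>S'. 0 < p z} (- (- self_int S' y)) {z\<in>S'. p z < 0}"
    using f base(1) unfolding fibered_def fibred_type_def by auto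
  moreover have "type_I S' {z\<in>S'. 0 < p z}" "type_II S' {z\<in>S'. p z < 0}"
    using f by (simp_all add: fibred_type_def type_I_def type_II_def)
  ultimately show ?thesis by blast
qed

section \<open>The classification theorem\<close>

theorem theorem4p1:
  fixes S S' :: "vec set"
  assumes "toric_log_del_Pezzo S"
    and "picard_number S = 1"
    and "minimal_resolution S S'"
  shows
    "((\<exists>n\<ge>1. toric_iso S (P11 n)) \<or>
      (\<exists>T. admits_cascade S T \<and>
        ((\<exists>n\<ge>2. min_res_is T (std1 n)) \<or> (\<exists>n\<ge>2. min_res_is T (std2 n)) \<or>
         min_res_is T threeA2)))
     \<and>
     (\<forall>T. admits_cascade S T \<longrightarrow>
        (\<forall>n\<ge>2. min_res_is T (std1 n) \<longrightarrow>
           (\<exists>p F\<^sub>1 F\<^sub>0. fibered S' p (- n) F\<^sub>1 (n - 1) F\<^sub>0 \<and> type_I S' F\<^sub>1 \<and> smooth_fiber p F\<^sub>0)) \<and>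
        (\<forall>n\<ge>2. min_res_is T (std2 n) \<longrightarrow>
           (\<exists>p F\<^sub>1 F\<^sub>1'. fibered S' p (- n) F\<^sub>1 (n - 2) F\<^sub>1' \<and> type_I S' F\<^sub>1 \<and> type_I S' F\<^sub>1')) \<and>
        (min_res_is T threeA2 \<longrightarrow>
           (\<exists>n m p F\<^sub>1 F\<^sub>2. fibered S' p (- n) F\<^sub>1 (- m) F\<^sub>2 \<and> type_I S' F\<^sub>1 \<and> type_II S' F\<^sub>2)))"
proof (intro conjI allI impI)
  have R: "rank_one_resolution S'" and core: "core S' = S"
    using rank_one_resolution_of[OF assms(2,3)] .
  show "(\<exists>n\<ge>1. toric_iso S (P11 n)) \<or>
      (\<exists>T. admits_cascade S T \<and>
        ((\<exists>n\<ge>2. min_res_is T (std1 n)) \<or> (\<exists>n\<ge>2. min_res_is T (std2 n)) \<or>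
         min_res_is T threeA2))"
    using no_minus_one_curve_P11[OF R] cascade_to_standard[OF R] unfolding core by blast
next
  fix T n assume "admits_cascade S T" "2 \<le> n" "min_res_is T (std1 n)"
  then show "\<exists>p F\<^sub>1 F\<^sub>0. fibered S' p (- n) F\<^sub>1 (n - 1) F\<^sub>0 \<and> type_I S' F\<^sub>1 \<and> smooth_fiber p F\<^sub>0"
    using cascade_std1 assms(3) by blast
next
  fix T n assume "admits_cascade S T" "2 \<le> n" "min_res_is T (std2 n)"
  then show "\<exists>p F\<^sub>1 F\<^sub>1'. fibered S' p (- n) F\<^sub>1 (n - 2) F\<^sub>1' \<and> type_I S' F\<^sub>1 \<and> type_I S' F\<^sub>1'"
    using cascade_std2 assms(3) by blast
next
  fix T assume "admits_cascade S T" "min_res_is T threeA2"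
  then show "\<exists>n m p F\<^sub>1 F\<^sub>2. fibered S' p (- n) F\<^sub>1 (- m) F\<^sub>2 \<and> type_I S' F\<^sub>1 \<and> type_II S' F\<^sub>2"
    using cascade_threeA2 assms(3) by blast
qed

end
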